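(* Let $A$ be a semi-real multiring and consider the morphisms $\pi_A\colon A\to Q(A)$, $v_A\colon A\to V(A)$ and $V(\pi_A)\colon V(A)\to V(Q(A))$. Then $V(A)$ is semi-real and the induced map $Q(V(A))\to V(Q(A))$, i.e. the unique multiring morphism $f\colon Q(V(A))\to V(Q(A))$ with $f\circ\pi_{V(A)}=V(\pi_A)$, is an isomorphism.
   Context: A multiring is a tuple $(A,+,-,\cdot,0,1)$ where $(A,\cdot,1)$ is a commutative monoid, $+\colon A\times A\to\{\text{nonempty subsets of }A\}$ and $-\colon A\to A$ are functions and $0\in A$, such that for all $a,b,c,d\in A$: (1) $a\in b+c$ implies $c\in -b+a$ and $b\in a+(-c)$; (2) $a\in b+0$ iff $a=b$; (3) if $x\in g+c$ with $g\in a+b$, then there is $h\in b+c$ with $x\in a+h$; (4) $a+b=b+a$; (5) $a\cdot 0=0$; (6) $a\in b+c$ implies $ad\in bd+cd$. Sums of subsets are unions of elementwise sums. A morphism of multirings $f$ satisfies $f(a)\in f(b)+f(c)$ whenever $a\in b+c$, and preserves $\cdot,-,0,1$; an isomorphism is a morphism with an inverse morphism. $\sum A^2$ is the union of all sets $x_1^2+\cdots+x_n^2$, $n\ge1$, $x_i\in A$. $A$ is semi-real if $-1\notin\sum A^2$. The multiring $\mathbf 3=\{-1,0,1\}$ has the usual multiplication and negation, and sum $0+x=x+0=\{x\}$, $1+1=\{1\}$, $(-1)+(-1)=\{-1\}$, $1+(-1)=(-1)+1=\{-1,0,1\}$. $\mathrm{sper}(A)$ is the set of multiring morphisms $A\to\mathbf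 3$. For $A$ semi-real and $a\in A$ let $\hat a\in\mathbf 3^{\mathrm{sper}(A)}$, $\hat a(\sigma)=\sigma(a)$; $Q(A)=\{\hat a: a\in A\}$ with $\hat a\hat b=\widehat{ab}$, $-\hat a=\widehat{-a}$, constants $\hat 0,\hat 1$, and $\hat a\in\hat b+\hat c$ iff there are $a',b',c'\in A$ with $\hat a'=\hat a$, $\hat b'=\hat b$, $\hat c'=\hat c$, $a'\in b'+c'$. It is a (semi-real) multiring, and $\pi_A\colon A\to Q(A)$, $a\mapsto\hat a$, is a morphism. An ideal is a nonempty $\alpha\subseteq A$ with $\alpha+\alpha\subseteq\alpha$, $A\alpha\subseteq\alpha$; it is prime if $1\notin\alpha$ and $ab\in\alpha$ implies $a\in\alpha$ or $b\in\alpha$. $\mathrm{spec}(A)$ is the set of prime ideals, $D(a)=\{p: a\notin p\}$; $(\mathrm{spec}(A))_{const}$ is $\mathrm{spec}(A)$ with the constructible topology (generated by the $D(a)$ and their complements). For a multiplicative set $S$ ($1\in S$, $SS\subseteq S$), $S^{-1}A$ is the multiring of fractions $a/s$, with $a/s=b/t$ iff $atu=bsu$ for some $u\in S$, $a/s\in b/t+c/u$ iff $atuv\in bsuv+cstv$ for some $v\in S$, and $(a/s)(b/t)=ab/st$. For an ideal $I$, $A/I$ is the set of classes of $a\sim b\Leftrightarrow (a-b)\cap I\ne\emptyset$, with $\overline a\in\overline b+\overline c$ iff $a\in b+c+i$ for some $i\in I$, and induced product. For $p\in\mathrm{spec}(A)$, $K_A(p)=((A/p)\setminus\{0\})^{-1}(A/p)$.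 A constructible section is a function $f\colon\mathrm{spec}(A)\to\bigsqcup_{p}K_A(p)$ with $f(p)\in K_A(p)$ such that for each $p$ there are a clopen $U$ of $(\mathrm{spec}(A))_{const}$ and $x,y\in A$ with $p\in U\subseteq D(y)$ and $f(q)=\frac xy\in K_A(q)$ for all $q\in U$. $V(A)$ is the set of constructible sections, with pointwise product, negation and constants and with $f\in g+h$ iff $f(p)\in g(p)+h(p)$ in $K_A(p)$ for all $p$; it is a multiring and $v_A\colon A\to V(A)$, $v_A(a)(p)=\frac a1$, is a morphism. For a morphism $g\colon A\to B$, $V(g)\colon V(A)\to V(B)$ is the unique morphism with $V(g)\circ v_A=v_B\circ g$; explicitly $V(g)(s)(p)=g_p(s(g^{-1}(p)))$ where $g_p\colon K_A(g^{-1}(p))\to K_B(p)$ is induced by $g$. *)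

theory Defs
  imports "HOL-Analysis.Analysis" "HOL-Algebra.Group"
begin

section \<open>Multirings and their morphisms\<close>

record 'a multiring = "'a monoid" +
  madd :: "'a \<Rightarrow> 'a \<Rightarrow> 'a set" (infixl "\<boxplus>\<index>" 65)
  mneg :: "'a \<Rightarrow> 'a" ("\<boxminus>\<index> _" [81] 80)
  mzero :: 'a ("\<zero>\<index>")

locale multiring = comm_monoid A for A :: "'a multiring" (structure) +
  assumes add_closed: "\<lbrakk>a \<in> carrier A; b \<in> carrier A\<rbrakk> \<Longrightarrow> a \<boxplus> b \<subseteq> carrier A"
    and add_nonempty: "\<lbrakk>a \<in> carrier A; b \<in> carrier A\<rbrakk> \<Longrightarrow> a \<boxplus> b \<noteq> {}"
    and neg_closed: "a \<in> carrier A \<Longrightarrow> \<boxminus> a \<in> carrier A"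
    and zero_closed: "\<zero> \<in> carrier A"
    and add_reversible:
      "\<lbrakk>a \<in> carrier A; b \<in> carrier A; c \<in> carrier A; a \<in> b \<boxplus> c\<rbrakk>
        \<Longrightarrow> c \<in> (\<boxminus> b) \<boxplus> a \<and> b \<in> a \<boxplus> (\<boxminus> c)"
    and add_zero: "\<lbrakk>a \<in> carrier A; b \<in> carrier A\<rbrakk> \<Longrightarrow> a \<in> b \<boxplus> \<zero> \<longleftrightarrow> a = b"
    and add_assoc:
      "\<lbrakk>a \<in> carrier A; b \<in> carrier A; c \<in> carrier A; g \<in> a \<boxplus> b; x \<in> g \<boxplus> c\<rbrakk>
        \<Longrightarrow> \<exists>h \<in> b \<boxplus> c. x \<in> a \<boxplus> h"
    and add_commute: "\<lbrakk>a \<in> carrier A; b \<in> carrier A\<rbrakk> \<Longrightarrow> a \<boxplus> b = b \<boxplus> a"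
    and mult_zero: "a \<in> carrier A \<Longrightarrow> a \<otimes> \<zero> = \<zero>"
    and mult_distrib:
      "\<lbrakk>a \<in> carrier A; b \<in> carrier A; c \<in> carrier A; d \<in> carrier A; a \<in> b \<boxplus> c\<rbrakk>
        \<Longrightarrow> a \<otimes> d \<in> (b \<otimes> d) \<boxplus> (c \<otimes> d)"

text \<open>Morphisms are extensional functions on the carrier, so that HOL equality of two of them
  is equality of morphisms.\<close>

definition multiring_hom :: "'a multiring \<Rightarrow> 'b multiring \<Rightarrow> ('a \<Rightarrow> 'b) set" where
  "multiring_hom A B = {f \<in> carrier A \<rightarrow>\<^sub>E carrier B.
     (\<forall>a\<in>carrier A. \<forall>b\<in>carrier A. \<forall>c\<in>carrier A.
        a \<in> b \<boxplus>\<^bsub>A\<^esub> c \<longrightarrow> f a \<in> f b \<boxplus>\<^bsub>B\<^esub> f c) \<and>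
     (\<forall>a\<in>carrier A. \<forall>b\<in>carrier A. f (a \<otimes>\<^bsub>A\<^esub> b) = f a \<otimes>\<^bsub>B\<^esub> f b) \<and>
     (\<forall>a\<in>carrier A. f (\<boxminus>\<^bsub>A\<^esub> a) = \<boxminus>\<^bsub>B\<^esub> f a) \<and>
     f \<zero>\<^bsub>A\<^esub> = \<zero>\<^bsub>B\<^esub> \<and> f \<one>\<^bsub>A\<^esub> = \<one>\<^bsub>B\<^esub>}"

definition multiring_iso :: "'a multiring \<Rightarrow> 'b multiring \<Rightarrow> ('a \<Rightarrow> 'b) set" where
  "multiring_iso A B = {f \<in> multiring_hom A B. \<exists>g \<in> multiring_hom B A.
     (\<forall>x\<in>carrier A. g (f x) = x) \<and> (\<forall>y\<in>carrier B. f (g y) = y)}"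

section \<open>Semi-real multirings and the real reduced multiring\<close>

inductive_set sums_of_squares :: "'a multiring \<Rightarrow> 'a set" for A :: "'a multiring" where
  square: "x \<in> carrier A \<Longrightarrow> x \<otimes>\<^bsub>A\<^esub> x \<in> sums_of_squares A"
| add_square: "\<lbrakk>y \<in> sums_of_squares A; x \<in> carrier A; z \<in> y \<boxplus>\<^bsub>A\<^esub> (x \<otimes>\<^bsub>A\<^esub> x)\<rbrakk>
    \<Longrightarrow> z \<in> sums_of_squares A"

locale semireal_multiring = multiring +
  assumes semireal: "\<boxminus> \<one> \<notin> sums_of_squares A"

definition three :: "int multiring" where
  "three = \<lparr>carrier = {-1, 0, 1}, mult = (*), one = 1,
     madd = (\<lambda>x y. if x = 0 then {y} else if y = 0 then {x} else if x = y then {x} else {-1, 0, 1}),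
     mneg = uminus, mzero = 0\<rparr>"

definition sper :: "'a multiring \<Rightarrow> ('a \<Rightarrow> int) set" where
  "sper A = multiring_hom A three"

definition hat :: "'a multiring \<Rightarrow> 'a \<Rightarrow> ('a \<Rightarrow> int) \<Rightarrow> int" where
  "hat A a = (\<lambda>\<sigma>\<in>sper A. \<sigma> a)"

text \<open>The product and negation below are those of the power of \<^const>\<open>three\<close> over \<open>sper A\<close>;
  since every \<open>\<sigma>\<close> is a morphism, they send the hats of \<open>a\<close>, \<open>b\<close> to the hats of \<open>a \<otimes> b\<close>
  and \<open>\<boxminus> a\<close>.\<close>

definition Q :: "'a multiring \<Rightarrow> (('a \<Rightarrow> int) \<Rightarrow> int) multiring" where
  "Q A = \<lparr>carrier = hat A ` carrier A,
     mult = (\<lambda>F G. \<lambda>\<sigma>\<in>sper A. F \<sigma> * G \<sigma>),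
     one = hat A \<one>\<^bsub>A\<^esub>,
     madd = (\<lambda>F G. {hat A a | a b c. a \<in> carrier A \<and> b \<in> carrier A \<and> c \<in> carrier A \<and>
                      hat A b = F \<and> hat A c = G \<and> a \<in> b \<boxplus>\<^bsub>A\<^esub> c}),
     mneg = (\<lambda>F. \<lambda>\<sigma>\<in>sper A. - F \<sigma>),
     mzero = hat A \<zero>\<^bsub>A\<^esub>\<rparr>"

definition Q_map :: "'a multiring \<Rightarrow> 'a \<Rightarrow> ('a \<Rightarrow> int) \<Rightarrow> int" where
  "Q_map A = (\<lambda>a\<in>carrier A. hat A a)"

section \<open>Prime ideals and the constructible topology\<close>

definition multiring_ideal :: "'a multiring \<Rightarrow> 'a set \<Rightarrow> bool" where
  "multiring_ideal A I \<longleftrightarrow> I \<noteq> {} \<and> I \<subseteq> carrier A \<and>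
     (\<forall>a\<in>I. \<forall>b\<in>I. a \<boxplus>\<^bsub>A\<^esub> b \<subseteq> I) \<and>
     (\<forall>a\<in>carrier A. \<forall>b\<in>I. a \<otimes>\<^bsub>A\<^esub> b \<in> I)"

definition multiring_spec :: "'a multiring \<Rightarrow> 'a set set" where
  "multiring_spec A = {p. multiring_ideal A p \<and> \<one>\<^bsub>A\<^esub> \<notin> p \<and>
     (\<forall>a\<in>carrier A. \<forall>b\<in>carrier A. a \<otimes>\<^bsub>A\<^esub> b \<in> p \<longrightarrow> a \<in> p \<or> b \<in> p)}"

definition basic_open :: "'a multiring \<Rightarrow> 'a \<Rightarrow> 'a set set" where
  "basic_open A a = {p \<in> multiring_spec A. a \<notin> p}"

definition constructible_topology :: "'a multiring \<Rightarrow> 'a set topology" where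
  "constructible_topology A = topology_generated_by
     (basic_open A ` carrier A \<union> (\<lambda>a. multiring_spec A - basic_open A a) ` carrier A)"

section \<open>Fractions, quotients and residue multirings\<close>

text \<open>Elements of fraction and quotient multirings are equivalence classes. An operation defined
  on representatives is written as a union over all representatives, which on the carrier is a
  union of equal classes.\<close>

definition fraction_class :: "'a multiring \<Rightarrow> 'a set \<Rightarrow> 'a \<Rightarrow> 'a \<Rightarrow> ('a \<times> 'a) set" where
  "fraction_class A S a s = {(b, t). b \<in> carrier A \<and> t \<in> S \<and>
     (\<exists>u\<in>S. a \<otimes>\<^bsub>A\<^esub> t \<otimes>\<^bsub>A\<^esub> u = b \<otimes>\<^bsub>A\<^esub> s \<otimes>\<^bsub>A\<^esub> u)}"

definition fractions :: "'a multiring \<Rightarrow> 'a set \<Rightarrow> ('a \<times> 'a) set multiring" where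
  "fractions A S = (let C = {fraction_class A S a s | a s. a \<in> carrier A \<and> s \<in> S} in
   \<lparr>carrier = C,
    mult = (\<lambda>X Y. \<Union>(a, s)\<in>X. \<Union>(b, t)\<in>Y. fraction_class A S (a \<otimes>\<^bsub>A\<^esub> b) (s \<otimes>\<^bsub>A\<^esub> t)),
    one = fraction_class A S \<one>\<^bsub>A\<^esub> \<one>\<^bsub>A\<^esub>,
    madd = (\<lambda>Y Z. {X \<in> C. \<exists>(a, s)\<in>X. \<exists>(b, t)\<in>Y. \<exists>(c, u)\<in>Z. \<exists>v\<in>S.
       a \<otimes>\<^bsub>A\<^esub> t \<otimes>\<^bsub>A\<^esub> u \<otimes>\<^bsub>A\<^esub> v
         \<in> (b \<otimes>\<^bsub>A\<^esub> s \<otimes>\<^bsub>A\<^esub> u \<otimes>\<^bsub>A\<^esub> v) \<boxplus>\<^bsub>A\<^esub> (c \<otimes>\<^bsub>A\<^esub> s \<otimes>\<^bsub>A\<^esub> t \<otimes>\<^bsub>A\<^esub> v)}),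
    mneg = (\<lambda>X. \<Union>(a, s)\<in>X. fraction_class A S (\<boxminus>\<^bsub>A\<^esub> a) s),
    mzero = fraction_class A S \<zero>\<^bsub>A\<^esub> \<one>\<^bsub>A\<^esub>\<rparr>)"

definition residue_class :: "'a multiring \<Rightarrow> 'a set \<Rightarrow> 'a \<Rightarrow> 'a set" where
  "residue_class A I a = {b \<in> carrier A. (a \<boxplus>\<^bsub>A\<^esub> (\<boxminus>\<^bsub>A\<^esub> b)) \<inter> I \<noteq> {}}"

definition quotient_multiring :: "'a multiring \<Rightarrow> 'a set \<Rightarrow> 'a set multiring" where
  "quotient_multiring A I = (let C = residue_class A I ` carrier A in
   \<lparr>carrier = C,
    mult = (\<lambda>X Y. \<Union>a\<in>X. \<Union>b\<in>Y. residue_class A I (a \<otimes>\<^bsub>A\<^esub> b)),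
    one = residue_class A I \<one>\<^bsub>A\<^esub>,
    madd = (\<lambda>Y Z. {X \<in> C. \<exists>a\<in>X. \<exists>b\<in>Y. \<exists>c\<in>Z. \<exists>i\<in>I. \<exists>d \<in> b \<boxplus>\<^bsub>A\<^esub> c. a \<in> d \<boxplus>\<^bsub>A\<^esub> i}),
    mneg = (\<lambda>X. \<Union>a\<in>X. residue_class A I (\<boxminus>\<^bsub>A\<^esub> a)),
    mzero = residue_class A I \<zero>\<^bsub>A\<^esub>\<rparr>)"

definition nonzero :: "'a multiring \<Rightarrow> 'a set" where
  "nonzero A = carrier A - {\<zero>\<^bsub>A\<^esub>}"

definition K :: "'a multiring \<Rightarrow> 'a set \<Rightarrow> ('a set \<times> 'a set) set multiring" where
  "K A p = fractions (quotient_multiring A p) (nonzero (quotient_multiring A p))"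

text \<open>\<open>K_frac A p x y\<close> is the element \<open>x/y\<close> of \<open>K A p\<close>, for \<open>x\<close>, \<open>y\<close> in \<open>A\<close> with \<open>y \<notin> p\<close>.\<close>

definition K_frac :: "'a multiring \<Rightarrow> 'a set \<Rightarrow> 'a \<Rightarrow> 'a \<Rightarrow> ('a set \<times> 'a set) set" where
  "K_frac A p x y = fraction_class (quotient_multiring A p) (nonzero (quotient_multiring A p))
     (residue_class A p x) (residue_class A p y)"

section \<open>Constructible sections\<close>

definition constructible_sections :: "'a multiring \<Rightarrow> ('a set \<Rightarrow> ('a set \<times> 'a set) set) set" where
  "constructible_sections A = {f \<in> (\<Pi>\<^sub>E p\<in>multiring_spec A. carrier (K A p)).
     \<forall>p\<in>multiring_spec A. \<exists>U. \<exists>x\<in>carrier A. \<exists>y\<in>carrier A.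
       openin (constructible_topology A) U \<and> closedin (constructible_topology A) U \<and>
       p \<in> U \<and> U \<subseteq> basic_open A y \<and> (\<forall>q\<in>U. f q = K_frac A q x y)}"

definition V :: "'a multiring \<Rightarrow> ('a set \<Rightarrow> ('a set \<times> 'a set) set) multiring" where
  "V A = \<lparr>carrier = constructible_sections A,
     mult = (\<lambda>f g. \<lambda>p\<in>multiring_spec A. f p \<otimes>\<^bsub>K A p\<^esub> g p),
     one = (\<lambda>p\<in>multiring_spec A. \<one>\<^bsub>K A p\<^esub>),
     madd = (\<lambda>g h. {f \<in> constructible_sections A.
                      \<forall>p\<in>multiring_spec A. f p \<in> g p \<boxplus>\<^bsub>K A p\<^esub> h p}),
     mneg = (\<lambda>f. \<lambda>p\<in>multiring_spec A. \<boxminus>\<^bsub>K A p\<^esub> f p),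
     mzero = (\<lambda>p\<in>multiring_spec A. \<zero>\<^bsub>K A p\<^esub>)\<rparr>"

definition V_unit :: "'a multiring \<Rightarrow> 'a \<Rightarrow> 'a set \<Rightarrow> ('a set \<times> 'a set) set" where
  "V_unit A = (\<lambda>a\<in>carrier A. \<lambda>p\<in>multiring_spec A. K_frac A p a \<one>\<^bsub>A\<^esub>)"

definition preimage :: "'a multiring \<Rightarrow> ('a \<Rightarrow> 'b) \<Rightarrow> 'b set \<Rightarrow> 'a set" where
  "preimage A g p = {a \<in> carrier A. g a \<in> p}"

text \<open>\<open>K_map B g p\<close> is the map \<open>K A (preimage A g p) \<rightarrow> K B p\<close> induced by \<open>g\<close>. The members of an
  element of \<open>K A (preimage A g p)\<close> are pairs of residue classes, and \<open>x\<close>, \<open>y\<close> run over their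
  representatives in \<open>A\<close>; on the carrier this is again a union of equal classes.\<close>

definition K_map ::
  "'b multiring \<Rightarrow> ('a \<Rightarrow> 'b) \<Rightarrow> 'b set \<Rightarrow> ('a set \<times> 'a set) set \<Rightarrow> ('b set \<times> 'b set) set" where
  "K_map B g p F = (\<Union>(X, Y)\<in>F. \<Union>x\<in>X. \<Union>y\<in>Y. K_frac B p (g x) (g y))"

text \<open>For a morphism \<open>g\<close>, this is the unique morphism \<open>V A \<rightarrow> V B\<close> whose composition with
  \<open>V_unit A\<close> is that of \<open>V_unit B\<close> with \<open>g\<close>.\<close>

definition V_map :: "'a multiring \<Rightarrow> 'b multiring \<Rightarrow> ('a \<Rightarrow> 'b) \<Rightarrow>
    ('a set \<Rightarrow> ('a set \<times> 'a set) set) \<Rightarrow> 'b set \<Rightarrow> ('b set \<times> 'b set) set" where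
  "V_map A B g = (\<lambda>s\<in>carrier (V A). \<lambda>p\<in>multiring_spec B. K_map B g p (s (preimage A g p)))"

end

theory Submission
  imports Defs
begin

text \<open>
  The map \<open>f\<close> exists, is unique and is an isomorphism as soon as \<open>V \<pi> : V A \<rightarrow> V (Q A)\<close> has the
  same fibres as \<open>V A \<rightarrow> Q (V A)\<close> and every relation \<open>F \<in> G + H\<close> in \<open>V (Q A)\<close> lifts to such a
  relation in \<open>V A\<close> (\<open>Q_universal_iso\<close>); lifting \<open>F \<in> F + 0\<close> gives surjectivity.

  Lifting is local. Over a common denominator, a sum in a residue multiring of \<open>Q A\<close> is the image of
  a sum in \<open>Q A\<close> (\<open>K_add_iff\<close>), and a sum in \<open>Q A\<close> is by definition the image of a sum in \<open>A\<close>. The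
  lift stays valid on a clopen neighbourhood, and every such neighbourhood in the spectrum of \<open>Q A\<close>
  is cut out by elements of \<open>A\<close> (\<open>near_lift\<close>). The primes of \<open>A\<close> that come from \<open>Q A\<close> form
  a compact set, so finitely many local lifts, made disjoint and extended by zero, glue to sections
  on the whole spectrum of \<open>A\<close> (\<open>exists_sections\<close>, \<open>V_hat_lifts_sums\<close>).

  For the fibres (\<open>hat_V_eq_iff\<close>), let \<open>s\<close> and \<open>t\<close> be sections over \<open>A\<close>. If their images differ at
  a prime \<open>p\<close> of \<open>Q A\<close>, then some point of the real spectrum of the residue multiring at \<open>p\<close>
  separates them (\<open>sper_K_Q_separates\<close>), because this multiring inherits \<open>a a a = a\<close> and
  \<open>a + a = {a}\<close> from \<open>Q A\<close>; its composite with \<open>V A \<rightarrow> V (Q A)\<close> is a point of the real spectrum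
  of \<open>V A\<close> that separates \<open>s\<close> and \<open>t\<close>. Conversely, a point \<open>\<tau>\<close> of the real spectrum of \<open>V A\<close>
  restricts to a point \<open>\<sigma>\<close> for \<open>A\<close>, and a section that equals \<open>x/y\<close> at the kernel of \<open>\<sigma>\<close> has value
  \<open>\<sigma> x \<cdot> \<sigma> y\<close> at \<open>\<tau>\<close> (\<open>sper_V_value\<close>), so \<open>\<tau> s\<close> depends only on the image of \<open>s\<close>. The same
  composites show that the real spectrum of \<open>V A\<close> is nonempty, whence \<open>V A\<close> is semi-real.

  Points of real spectra are obtained from an abstract Positivstellensatz (\<open>positivstellensatz\<close>). It
  also yields that \<open>Q A\<close> is a multiring (\<open>multiring_Q\<close>). The difficulty there is associativity: the
  two given sums contain different lifts \<open>g\<close>, \<open>g'\<close> of the same element, and both must be modified so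
  as to contain a common one without changing the signs of the summands (\<open>exists_common_sum\<close>).
\<close>


section \<open>Arithmetic in multirings\<close>

context multiring
begin

lemma add_mem_carrier: "\<lbrakk>x \<in> a \<boxplus> b; a \<in> carrier A; b \<in> carrier A\<rbrakk> \<Longrightarrow> x \<in> carrier A"
  using add_closed by blast

lemma zero_add: "\<lbrakk>a \<in> carrier A; b \<in> carrier A\<rbrakk> \<Longrightarrow> a \<in> \<zero> \<boxplus> b \<longleftrightarrow> a = b"
  using add_zero add_commute zero_closed by metis

lemma zero_in_add_neg: "a \<in> carrier A \<Longrightarrow> \<zero> \<in> a \<boxplus> \<boxminus> a"
  using add_reversible[of a a \<zero>] add_zero[of a a] zero_closed add_commute neg_closed by metis

lemma neg_unique: "\<lbrakk>\<zero> \<in> a \<boxplus> b; a \<in> carrier A; b \<in> carrier A\<rbrakk> \<Longrightarrow> b = \<boxminus> a"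
  using add_reversible[of \<zero> a b] add_zero[of b "\<boxminus> a"] zero_closed neg_closed by metis

lemma neg_neg [simp]: "a \<in> carrier A \<Longrightarrow> \<boxminus> (\<boxminus> a) = a"
  using zero_in_add_neg[of a] neg_unique[of "\<boxminus> a" a] add_commute neg_closed by metis

lemma neg_zero [simp]: "\<boxminus> \<zero> = \<zero>"
  using neg_unique[of \<zero> \<zero>] add_zero zero_closed by metis

lemma zero_mult [simp]: "a \<in> carrier A \<Longrightarrow> \<zero> \<otimes> a = \<zero>"
  using mult_zero m_comm zero_closed by metis

lemma neg_mult: "\<lbrakk>a \<in> carrier A; b \<in> carrier A\<rbrakk> \<Longrightarrow> (\<boxminus> a) \<otimes> b = \<boxminus> (a \<otimes> b)"
  by (metis m_closed mult_distrib neg_closed neg_unique zero_closed zero_in_add_neg zero_mult)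

lemma mult_neg: "\<lbrakk>a \<in> carrier A; b \<in> carrier A\<rbrakk> \<Longrightarrow> a \<otimes> (\<boxminus> b) = \<boxminus> (a \<otimes> b)"
  by (metis m_comm neg_closed neg_mult)

lemma neg_mult_neg: "\<lbrakk>a \<in> carrier A; b \<in> carrier A\<rbrakk> \<Longrightarrow> (\<boxminus> a) \<otimes> (\<boxminus> b) = a \<otimes> b"
  by (simp add: neg_mult mult_neg neg_closed)

lemma mult_distrib_left:
  "\<lbrakk>a \<in> b \<boxplus> c; b \<in> carrier A; c \<in> carrier A; d \<in> carrier A\<rbrakk> \<Longrightarrow> d \<otimes> a \<in> (d \<otimes> b) \<boxplus> (d \<otimes> c)"
  using mult_distrib[of a b c d] add_mem_carrier[of a b c] by (simp add: m_comm)

lemma neg_add: "\<lbrakk>a \<in> b \<boxplus> c; b \<in> carrier A; c \<in> carrier A\<rbrakk> \<Longrightarrow> \<boxminus> a \<in> (\<boxminus> b) \<boxplus> (\<boxminus> c)"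
  using mult_distrib_left[of a b c "\<boxminus> \<one>"] add_mem_carrier[of a b c]
  by (simp add: neg_mult neg_closed)

lemma add_solve_left: "\<lbrakk>a \<in> b \<boxplus> c; b \<in> carrier A; c \<in> carrier A\<rbrakk> \<Longrightarrow> b \<in> a \<boxplus> (\<boxminus> c)"
  using add_reversible add_mem_carrier by blast

lemma add_solve_right: "\<lbrakk>a \<in> b \<boxplus> c; b \<in> carrier A; c \<in> carrier A\<rbrakk> \<Longrightarrow> c \<in> a \<boxplus> (\<boxminus> b)"
  using add_solve_left add_commute by blast

lemma add_commute_mem: "\<lbrakk>x \<in> a \<boxplus> b; a \<in> carrier A; b \<in> carrier A\<rbrakk> \<Longrightarrow> x \<in> b \<boxplus> a"
  using add_commute by blast

lemma add_assoc_rev: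
  assumes "x \<in> a \<boxplus> h" "h \<in> b \<boxplus> c" "a \<in> carrier A" "b \<in> carrier A" "c \<in> carrier A"
  shows "\<exists>g \<in> a \<boxplus> b. x \<in> g \<boxplus> c"
proof -
  have h: "h \<in> carrier A" using assms add_mem_carrier by blast
  then obtain g where "g \<in> b \<boxplus> a" "x \<in> c \<boxplus> g"
    using add_assoc[of c b a h x] assms add_commute by metis
  then show ?thesis using assms add_commute add_mem_carrier by metis
qed

lemma add_interchange:
  assumes "z \<in> u \<boxplus> v" "u \<in> x \<boxplus> y" "v \<in> x' \<boxplus> y'"
    and "x \<in> carrier A" "y \<in> carrier A" "x' \<in> carrier A" "y' \<in> carrier A"
  shows "\<exists>s \<in> x \<boxplus> x'. \<exists>t \<in> y \<boxplus> y'. z \<in> s \<boxplus> t"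
proof -
  have uv: "u \<in> carrier A" "v \<in> carrier A" using assms add_mem_carrier by blast+
  obtain h where h: "h \<in> y \<boxplus> v" "z \<in> x \<boxplus> h"
    using add_assoc[of x y v u z] assms uv by blast
  then have "h \<in> v \<boxplus> y" using add_commute uv assms by blast
  then obtain k where k: "k \<in> y' \<boxplus> y" "h \<in> x' \<boxplus> k"
    using add_assoc[of x' y' y v h] assms by blast
  have kc: "k \<in> carrier A" using k assms add_mem_carrier by blast
  obtain g where "g \<in> x \<boxplus> x'" "z \<in> g \<boxplus> k"
    using add_assoc_rev[OF h(2) k(2)] assms kc by blast
  then show ?thesis using k add_commute assms by blast
qed

end

section \<open>Preorderings and the real spectrum\<close>

definition preordering :: "'a multiring \<Rightarrow> 'a set \<Rightarrow> bool" where
  "preordering A P \<longleftrightarrow> P \<subseteq> carrier A \<and> (\<forall>x\<in>carrier A. x \<otimes>\<^bsub>A\<^esub> x \<in> P) \<and>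
     (\<forall>a\<in>P. \<forall>b\<in>P. a \<boxplus>\<^bsub>A\<^esub> b \<subseteq> P) \<and> (\<forall>a\<in>P. \<forall>b\<in>P. a \<otimes>\<^bsub>A\<^esub> b \<in> P)"

text \<open>Distributivity is only an inclusion, so the multiples \<open>a \<otimes> t\<close> with \<open>t\<close> in a preordering
  are in general not closed under sums; the preordering generated by \<open>T\<close> and \<open>a\<close> needs all
  finite sums of them.\<close>

inductive_set multiple_sums :: "'a multiring \<Rightarrow> 'a set \<Rightarrow> 'a \<Rightarrow> 'a set"
  for A :: "'a multiring" and T :: "'a set" and a :: 'a where
  multiple: "t \<in> T \<Longrightarrow> a \<otimes>\<^bsub>A\<^esub> t \<in> multiple_sums A T a"
| add: "\<lbrakk>u \<in> multiple_sums A T a; v \<in> multiple_sums A T a; w \<in> u \<boxplus>\<^bsub>A\<^esub> v\<rbrakk> \<Longrightarrow> w \<in> multiple_sums A T a"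

definition adjoin :: "'a multiring \<Rightarrow> 'a set \<Rightarrow> 'a \<Rightarrow> 'a set" where
  "adjoin A T a = {x. \<exists>s\<in>T. \<exists>u\<in>multiple_sums A T a. x \<in> s \<boxplus>\<^bsub>A\<^esub> u}"

context multiring
begin

lemma preorderingI:
  assumes "T \<subseteq> carrier A" "\<And>x. x \<in> carrier A \<Longrightarrow> x \<otimes> x \<in> T"
    and "\<And>a b c. \<lbrakk>a \<in> T; b \<in> T; c \<in> a \<boxplus> b\<rbrakk> \<Longrightarrow> c \<in> T"
    and "\<And>a b. \<lbrakk>a \<in> T; b \<in> T\<rbrakk> \<Longrightarrow> a \<otimes> b \<in> T"
  shows "preordering A T"
proof -
  have "a \<boxplus> b \<subseteq> T" if "a \<in> T" "b \<in> T" for a b using assms(3)[OF that] by (rule subsetI)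
  then show ?thesis using assms(1,2,4) by (simp add: preordering_def)
qed

lemma preorderingD:
  assumes "preordering A T"
  shows "T \<subseteq> carrier A" "x \<in> carrier A \<Longrightarrow> x \<otimes> x \<in> T" "\<zero> \<in> T" "\<one> \<in> T"
    "\<lbrakk>a \<in> T; b \<in> T; c \<in> a \<boxplus> b\<rbrakk> \<Longrightarrow> c \<in> T" "\<lbrakk>a \<in> T; b \<in> T\<rbrakk> \<Longrightarrow> a \<otimes> b \<in> T"
proof -
  show sq: "x \<otimes> x \<in> T" if "x \<in> carrier A" for x
    using assms that by (simp add: preordering_def)
  show "\<zero> \<in> T" using sq[OF zero_closed] zero_closed by simp
  show "\<one> \<in> T" using sq[OF one_closed] by simp
  show "\<lbrakk>a \<in> T; b \<in> T; c \<in> a \<boxplus> b\<rbrakk> \<Longrightarrow> c \<in> T"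
    using assms subsetD[of "a \<boxplus> b" T c] by (simp add: preordering_def)
qed (use assms in \<open>simp_all add: preordering_def\<close>)

lemma multiple_sums_carrier:
  assumes "T \<subseteq> carrier A" "a \<in> carrier A" "u \<in> multiple_sums A T a"
  shows "u \<in> carrier A"
  using assms(3) by induction (use assms add_mem_carrier in auto)

lemma multiple_sums_mult:
  assumes T: "preordering A T" and ab: "a \<in> carrier A" "b \<in> carrier A"
    and u: "u \<in> multiple_sums A T a" and v: "v \<in> multiple_sums A T b"
  shows "u \<otimes> v \<in> multiple_sums A T (a \<otimes> b)"
  using u
proof induction
  case (multiple t)
  note tc = multiple subsetD[OF preorderingD(1)[OF T] multiple]
  show ?case using v
  proof induction
    case (multiple s)
    then have s: "s \<in> carrier A" using preorderingD(1)[OF T] by blast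
    have "(a \<otimes> t) \<otimes> (b \<otimes> s) = (a \<otimes> b) \<otimes> (t \<otimes> s)"
      using ab s tc by (simp add: m_ac)
    then show ?case using multiple_sums.multiple preorderingD(6)[OF T tc(1) multiple] by metis
  next
    case (add x y w)
    then have "x \<in> carrier A" "y \<in> carrier A"
      using multiple_sums_carrier preorderingD(1)[OF T] ab by blast+
    then show ?case using add mult_distrib_left[of w x y "a \<otimes> t"] ab tc multiple_sums.add by fastforce
  qed
next
  case (add x y w)
  then have "x \<in> carrier A" "y \<in> carrier A" "v \<in> carrier A"
    using multiple_sums_carrier preorderingD(1)[OF T] ab v by blast+
  then show ?case using add mult_distrib[of w x y v] add_mem_carrier multiple_sums.add by fastforce
qed

lemma multiple_sums_subset:
  assumes "a \<in> S" "\<And>t. t \<in> T \<Longrightarrow> a \<otimes> t \<in> S"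
    and "\<And>x y. x \<in> S \<Longrightarrow> y \<in> S \<Longrightarrow> x \<boxplus> y \<subseteq> S"
  shows "multiple_sums A T a \<subseteq> S"
proof
  fix u assume "u \<in> multiple_sums A T a"
  then show "u \<in> S" by induction (use assms in auto)
qed

lemma multiple_sums_subset_preordering:
  assumes "preordering A T" "a \<in> T"
  shows "multiple_sums A T a \<subseteq> T"
  using assms by (intro multiple_sums_subset) (auto dest: preorderingD)

lemma multiple_sums_neg:
  assumes P: "preordering A P" and a: "a \<in> carrier A" "\<boxminus> a \<in> P"
  shows "multiple_sums A P a \<subseteq> {x. \<boxminus> x \<in> P}"
proof -
  let ?N = "{x \<in> carrier A. \<boxminus> x \<in> P}"
  have "multiple_sums A P a \<subseteq> ?N"
  proof (rule multiple_sums_subset)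
    show "a \<in> ?N" using a by simp
    show "a \<otimes> t \<in> ?N" if "t \<in> P" for t
      using a that preorderingD(1)[OF P] preorderingD(6)[OF P a(2) that] neg_mult[of a t] by auto
    show "x \<boxplus> y \<subseteq> ?N" if xy: "x \<in> ?N" "y \<in> ?N" for x y
    proof
      fix z assume z: "z \<in> x \<boxplus> y"
      have "\<boxminus> z \<in> (\<boxminus> x) \<boxplus> (\<boxminus> y)" using neg_add[OF z] xy by simp
      then show "z \<in> ?N" using preorderingD(5)[OF P] xy add_mem_carrier[OF z] by blast
    qed
  qed
  then show ?thesis by blast
qed

lemma multiple_sums_mult_preordering:
  assumes T: "preordering A T" and "a \<in> carrier A" "u \<in> multiple_sums A T a" "s \<in> T"
  shows "u \<otimes> s \<in> multiple_sums A T a"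
proof -
  have "\<one> \<otimes> s \<in> multiple_sums A T \<one>" using assms multiple_sums.multiple by metis
  then show ?thesis
    using multiple_sums_mult[OF T, of a \<one> u s] assms preorderingD(1)[OF T] by fastforce
qed

lemma preordering_adjoin:
  assumes T: "preordering A T" and a: "a \<in> carrier A"
  shows "preordering A (adjoin A T a)" and "T \<subseteq> adjoin A T a" and "a \<in> adjoin A T a"
proof -
  note T' = preorderingD[OF T]
  have z: "\<zero> \<in> multiple_sums A T a" using multiple_sums.multiple[OF T'(3), of A a] mult_zero a by simp
  show sub: "T \<subseteq> adjoin A T a"
    using z T'(1) add_zero zero_closed unfolding adjoin_def by blast
  have "a \<in> multiple_sums A T a" using multiple_sums.multiple[OF T'(4), of A a] a by simp
  then show "a \<in> adjoin A T a"
    using T'(3) zero_add a unfolding adjoin_def by blast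
  have Tc: "s \<in> carrier A" if "s \<in> T" for s using that T'(1) by blast
  have cc: "s \<in> carrier A" if "s \<in> multiple_sums A T a" for s using that T'(1) a multiple_sums_carrier by blast
  have add: "z \<in> adjoin A T a" if xy: "x \<in> adjoin A T a" "y \<in> adjoin A T a" "z \<in> x \<boxplus> y" for x y z
  proof -
    obtain s u s' u' where *: "s \<in> T" "u \<in> multiple_sums A T a" "x \<in> s \<boxplus> u"
      "s' \<in> T" "u' \<in> multiple_sums A T a" "y \<in> s' \<boxplus> u'"
      using xy unfolding adjoin_def by blast
    obtain t w where tw: "t \<in> s \<boxplus> s'" "w \<in> u \<boxplus> u'" "z \<in> t \<boxplus> w"
      using add_interchange[OF xy(3) *(3) *(6)] Tc[OF *(1)] Tc[OF *(4)] cc[OF *(2)] cc[OF *(5)]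
      by blast
    have "t \<in> T" "w \<in> multiple_sums A T a"
      using T'(5)[OF *(1) *(4) tw(1)] multiple_sums.add[OF *(2) *(5) tw(2)] .
    then show ?thesis using tw(3) unfolding adjoin_def by blast
  qed
  have mult: "x \<otimes> y \<in> adjoin A T a" if xy: "x \<in> adjoin A T a" "y \<in> adjoin A T a" for x y
  proof -
    obtain s u s' u' where *: "s \<in> T" "u \<in> multiple_sums A T a" "x \<in> s \<boxplus> u"
      "s' \<in> T" "u' \<in> multiple_sums A T a" "y \<in> s' \<boxplus> u'"
      using xy unfolding adjoin_def by blast
    have c: "s \<in> carrier A" "u \<in> carrier A" "s' \<in> carrier A" "u' \<in> carrier A"
      using * Tc cc by auto
    have yc: "y \<in> carrier A" "x \<in> carrier A"
      using add_mem_carrier[OF *(6) c(3,4)] add_mem_carrier[OF *(3) c(1,2)] .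
    have 1: "x \<otimes> y \<in> (s \<otimes> y) \<boxplus> (u \<otimes> y)" using mult_distrib * c yc by blast
    have 2: "s \<otimes> y \<in> (s \<otimes> s') \<boxplus> (s \<otimes> u')" using mult_distrib_left * c by blast
    have 3: "u \<otimes> y \<in> (u \<otimes> u') \<boxplus> (u \<otimes> s')"
      using mult_distrib_left[of y s' u' u] * c add_commute by fastforce
    obtain t w where tw: "t \<in> (s \<otimes> s') \<boxplus> (u \<otimes> u')" "w \<in> (s \<otimes> u') \<boxplus> (u \<otimes> s')" "x \<otimes> y \<in> t \<boxplus> w"
      using add_interchange[OF 1 2 3] c by blast
    have "u \<otimes> u' \<in> T"
      using multiple_sums_mult[OF T a a *(2) *(5)] multiple_sums_subset_preordering[OF T T'(2)[OF a]] by blast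
    then have "t \<in> T" using T'(5)[OF T'(6)[OF *(1) *(4)] _ tw(1)] by blast
    moreover have "s \<otimes> u' \<in> multiple_sums A T a" "u \<otimes> s' \<in> multiple_sums A T a"
      using multiple_sums_mult_preordering[OF T a *(5) *(1)] multiple_sums_mult_preordering[OF T a *(2) *(4)]
      by (simp_all add: m_comm c)
    then have "w \<in> multiple_sums A T a" using tw(2) by (rule multiple_sums.add)
    ultimately show ?thesis using tw(3) unfolding adjoin_def by blast
  qed
  have "adjoin A T a \<subseteq> carrier A"
    using Tc cc add_mem_carrier unfolding adjoin_def by blast
  then show "preordering A (adjoin A T a)"
  proof (rule preorderingI)
    show "w \<in> adjoin A T a" if "x \<in> adjoin A T a" "y \<in> adjoin A T a" "w \<in> x \<boxplus> y" for x y w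
      using add[OF that] .
  qed (use mult subsetD[OF sub T'(2)] in simp_all)
qed

lemma preordering_sums_of_squares: "preordering A (sums_of_squares A)"
proof -
  let ?S = "sums_of_squares A"
  have c: "x \<in> carrier A" if "x \<in> ?S" for x
    using that by induction (use add_mem_carrier in auto)
  have add: "x \<boxplus> y \<subseteq> ?S" if "x \<in> ?S" "y \<in> ?S" for x y
    using that(2)
  proof induction
    case (square z) then show ?case using sums_of_squares.add_square[OF that(1)] by blast
  next
    case (add_square y x' z)
    show ?case
    proof
      fix w assume w: "w \<in> x \<boxplus> z"
      have "x \<in> carrier A" "y \<in> carrier A" using c add_square that(1) by auto
      then obtain g where "g \<in> x \<boxplus> y" "w \<in> g \<boxplus> (x' \<otimes> x')"
        using add_assoc_rev[OF w add_square(3)] add_square(2) by auto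
      then show "w \<in> ?S"
        using sums_of_squares.add_square[of g A x' w] add_square(2,4) by blast
    qed
  qed
  have sq: "x \<otimes> (y \<otimes> y) \<in> ?S" if "x \<in> ?S" "y \<in> carrier A" for x y
    using that(1)
  proof induction
    case (square z)
    have "(z \<otimes> z) \<otimes> (y \<otimes> y) = (z \<otimes> y) \<otimes> (z \<otimes> y)" using square that(2) by (simp add: m_ac)
    then show ?case using sums_of_squares.square[of "z \<otimes> y" A] square that(2) by simp
  next
    case (add_square s t z)
    have "(t \<otimes> t) \<otimes> (y \<otimes> y) = (t \<otimes> y) \<otimes> (t \<otimes> y)" using add_square that(2) by (simp add: m_ac)
    moreover have "z \<otimes> (y \<otimes> y) \<in> (s \<otimes> (y \<otimes> y)) \<boxplus> ((t \<otimes> t) \<otimes> (y \<otimes> y))"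
      using add_square that(2) c mult_distrib add_mem_carrier by simp
    ultimately show ?case
      using sums_of_squares.add_square[OF add_square.IH, of "t \<otimes> y"] add_square that(2) by simp
  qed
  have mult: "x \<otimes> y \<in> ?S" if "x \<in> ?S" "y \<in> ?S" for x y
    using that(2)
  proof induction
    case (square z) then show ?case using sq that(1) by blast
  next
    case (add_square s t z)
    have "x \<otimes> z \<in> (x \<otimes> s) \<boxplus> (x \<otimes> (t \<otimes> t))"
      using mult_distrib_left add_square c that(1) by simp
    then show ?case
      using add[OF add_square.IH sq[OF that(1), of t]] add_square(2) by blast
  qed
  show ?thesis
  proof (rule preorderingI)
    show "w \<in> ?S" if "x \<in> ?S" "y \<in> ?S" "w \<in> x \<boxplus> y" for x y w
      using add[OF that(1,2)] that(3) by (rule subsetD)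
    show "?S \<subseteq> carrier A" using c by blast
  qed (use mult sums_of_squares.square in simp_all)
qed

end

lemma three_simps [simp]:
  "carrier three = {-1, 0, 1}" "x \<otimes>\<^bsub>three\<^esub> y = x * y" "\<one>\<^bsub>three\<^esub> = 1"
  "\<boxminus>\<^bsub>three\<^esub> x = - x" "\<zero>\<^bsub>three\<^esub> = 0"
  by (simp_all add: three_def)

lemma three_madd:
  "x \<boxplus>\<^bsub>three\<^esub> y =
     (if x = 0 then {y} else if y = 0 then {x} else if x = y then {x} else {-1, 0, 1})"
  by (simp add: three_def)

lemma multiring_homD:
  assumes "f \<in> multiring_hom A B"
  shows "a \<in> carrier A \<Longrightarrow> f a \<in> carrier B"
    "\<lbrakk>a \<in> b \<boxplus>\<^bsub>A\<^esub> c; a \<in> carrier A; b \<in> carrier A; c \<in> carrier A\<rbrakk> \<Longrightarrow> f a \<in> f b \<boxplus>\<^bsub>B\<^esub> f c"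
    "\<lbrakk>a \<in> carrier A; b \<in> carrier A\<rbrakk> \<Longrightarrow> f (a \<otimes>\<^bsub>A\<^esub> b) = f a \<otimes>\<^bsub>B\<^esub> f b"
    "a \<in> carrier A \<Longrightarrow> f (\<boxminus>\<^bsub>A\<^esub> a) = \<boxminus>\<^bsub>B\<^esub> f a"
    "f \<zero>\<^bsub>A\<^esub> = \<zero>\<^bsub>B\<^esub>" "f \<one>\<^bsub>A\<^esub> = \<one>\<^bsub>B\<^esub>" "f \<in> extensional (carrier A)"
  using assms unfolding multiring_hom_def by (auto simp: PiE_def)

lemma sperD:
  assumes "\<sigma> \<in> sper A"
  shows "a \<in> carrier A \<Longrightarrow> \<sigma> a \<in> {-1, 0, 1}"
    "\<lbrakk>a \<in> carrier A; b \<in> carrier A\<rbrakk> \<Longrightarrow> \<sigma> (a \<otimes>\<^bsub>A\<^esub> b) = \<sigma> a * \<sigma> b"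
    "a \<in> carrier A \<Longrightarrow> \<sigma> (\<boxminus>\<^bsub>A\<^esub> a) = - \<sigma> a"
    "\<sigma> \<zero>\<^bsub>A\<^esub> = 0" "\<sigma> \<one>\<^bsub>A\<^esub> = 1"
    "\<lbrakk>a \<in> b \<boxplus>\<^bsub>A\<^esub> c; a \<in> carrier A; b \<in> carrier A; c \<in> carrier A\<rbrakk> \<Longrightarrow>
      (\<sigma> b = 0 \<longrightarrow> \<sigma> a = \<sigma> c) \<and> (\<sigma> c = 0 \<longrightarrow> \<sigma> a = \<sigma> b) \<and> (\<sigma> b = \<sigma> c \<longrightarrow> \<sigma> a = \<sigma> b)"
proof -
  note hom = multiring_homD[OF assms[unfolded sper_def]]
  show "a \<in> carrier A \<Longrightarrow> \<sigma> a \<in> {-1, 0, 1}" using hom(1)[of a] by simp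
  show "\<lbrakk>a \<in> b \<boxplus>\<^bsub>A\<^esub> c; a \<in> carrier A; b \<in> carrier A; c \<in> carrier A\<rbrakk> \<Longrightarrow>
      (\<sigma> b = 0 \<longrightarrow> \<sigma> a = \<sigma> c) \<and> (\<sigma> c = 0 \<longrightarrow> \<sigma> a = \<sigma> b) \<and> (\<sigma> b = \<sigma> c \<longrightarrow> \<sigma> a = \<sigma> b)"
    using hom(2)[of a b c] by (simp add: three_madd split: if_splits)
qed (use multiring_homD[OF assms[unfolded sper_def]] in simp_all)

context multiring
begin

lemma sign_add:
  "(a \<or> a') \<and> (b \<or> b') \<and> (c \<or> c') \<and> (b \<longrightarrow> c \<longrightarrow> a) \<and> (b' \<longrightarrow> c' \<longrightarrow> a') \<and>
     (a \<longrightarrow> c' \<longrightarrow> b) \<and> (a \<longrightarrow> b' \<longrightarrow> c) \<and> (a' \<longrightarrow> c \<longrightarrow> b') \<and> (a' \<longrightarrow> b \<longrightarrow> c') \<Longrightarrow>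
   (if \<not> a then -1 else if \<not> a' then 1 else 0) \<in>
     (if \<not> b then -1 else if \<not> b' then 1 else 0) \<boxplus>\<^bsub>three\<^esub> (if \<not> c then -1 else if \<not> c' then 1 else 0)"
  unfolding three_madd by (cases a; cases a'; cases b; cases b'; cases c; cases c'; simp)

text \<open>The sign function of an ordering, that is, of a total preordering with prime support.\<close>

lemma sper_of_ordering:
  assumes P: "preordering A P" and total: "\<And>a. a \<in> carrier A \<Longrightarrow> a \<in> P \<or> \<boxminus> a \<in> P"
    and one: "\<boxminus> \<one> \<notin> P"
    and prime: "\<And>a b. \<lbrakk>a \<in> carrier A; b \<in> carrier A; a \<otimes> b \<in> P; \<boxminus> (a \<otimes> b) \<in> P\<rbrakk>
      \<Longrightarrow> a \<in> P \<and> \<boxminus> a \<in> P \<or> b \<in> P \<and> \<boxminus> b \<in> P"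
  defines "\<sigma> \<equiv> \<lambda>a\<in>carrier A. if a \<notin> P then -1 else if \<boxminus> a \<notin> P then 1 else (0::int)"
  shows "\<sigma> \<in> sper A"
proof -
  note P' = preorderingD[OF P]
  have cancel: "b \<in> P" if "a \<in> b \<boxplus> c" "a \<in> P" "\<boxminus> c \<in> P" "b \<in> carrier A" "c \<in> carrier A" for a b c
    using P'(5)[OF that(2,3) add_solve_left[OF that(1,4,5)]] .
  have add: "\<sigma> a \<in> \<sigma> b \<boxplus>\<^bsub>three\<^esub> \<sigma> c"
    if abc: "a \<in> carrier A" "b \<in> carrier A" "c \<in> carrier A" "a \<in> b \<boxplus> c" for a b c
  proof -
    note n = neg_add[OF abc(4,2,3)] neg_closed
    have 1: "b \<in> P \<Longrightarrow> c \<in> P \<Longrightarrow> a \<in> P" using P'(5) abc(4) by metis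
    have 2: "\<boxminus> b \<in> P \<Longrightarrow> \<boxminus> c \<in> P \<Longrightarrow> \<boxminus> a \<in> P" using P'(5) n(1) by metis
    have 3: "a \<in> P \<Longrightarrow> \<boxminus> c \<in> P \<Longrightarrow> b \<in> P" using cancel abc by blast
    have 4: "a \<in> P \<Longrightarrow> \<boxminus> b \<in> P \<Longrightarrow> c \<in> P" using cancel abc add_commute by blast
    have 5: "\<boxminus> a \<in> P \<Longrightarrow> c \<in> P \<Longrightarrow> \<boxminus> b \<in> P"
      using cancel[of "\<boxminus> a" "\<boxminus> b" "\<boxminus> c"] abc n by simp
    have 6: "\<boxminus> a \<in> P \<Longrightarrow> b \<in> P \<Longrightarrow> \<boxminus> c \<in> P"
      using cancel[of "\<boxminus> a" "\<boxminus> c" "\<boxminus> b"] abc n add_commute by auto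
    show ?thesis
      using sign_add[of "a \<in> P" "\<boxminus> a \<in> P" "b \<in> P" "\<boxminus> b \<in> P" "c \<in> P" "\<boxminus> c \<in> P"]
        total[OF abc(1)] total[OF abc(2)] total[OF abc(3)] 1 2 3 4 5 6
      unfolding \<sigma>_def restrict_apply'[OF abc(1)] restrict_apply'[OF abc(2)]
        restrict_apply'[OF abc(3)] by argo
  qed
  have mult: "\<sigma> (a \<otimes> b) = \<sigma> a * \<sigma> b" if ab: "a \<in> carrier A" "b \<in> carrier A" for a b
  proof -
    have 1: "a \<in> P \<Longrightarrow> b \<in> P \<Longrightarrow> a \<otimes> b \<in> P" using P'(6) by blast
    have 2: "\<boxminus> a \<in> P \<Longrightarrow> \<boxminus> b \<in> P \<Longrightarrow> a \<otimes> b \<in> P" using P'(6) neg_mult_neg ab by metis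
    have 3: "\<boxminus> a \<in> P \<Longrightarrow> b \<in> P \<Longrightarrow> \<boxminus> (a \<otimes> b) \<in> P" using P'(6) neg_mult ab by metis
    have 4: "a \<in> P \<Longrightarrow> \<boxminus> b \<in> P \<Longrightarrow> \<boxminus> (a \<otimes> b) \<in> P" using P'(6) mult_neg ab by metis
    show ?thesis
      using 1 2 3 4 total[OF ab(1)] total[OF ab(2)] prime[OF ab] ab by (auto simp: \<sigma>_def)
  qed
  have neg: "\<sigma> (\<boxminus> a) = - \<sigma> a" if "a \<in> carrier A" for a
    using total[OF that] that neg_closed by (auto simp: \<sigma>_def)
  have "\<sigma> \<zero> = 0" "\<sigma> \<one> = 1" using P'(3,4) one zero_closed by (auto simp: \<sigma>_def)
  then show ?thesis
    using add mult neg unfolding sper_def multiring_hom_def by (auto simp: \<sigma>_def)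
qed

text \<open>The abstract Positivstellensatz. A preordering that is maximal among those avoiding \<open>-M\<close>
  is an ordering: if neither \<open>a\<close> nor \<open>b\<close> lies in it, then adjoining either of them gives elements of
  \<open>-M\<close>, and multiplying the two resulting identities puts an element of \<open>-M\<close> into the
  preordering as soon as the negatives of all multiples of \<open>a \<otimes> b\<close> lie there. Taking \<open>b = \<boxminus> a\<close>
  gives totality, and taking \<open>a \<otimes> b\<close> in the support gives primality of the support.\<close>

theorem positivstellensatz:
  assumes T: "preordering A T" and M: "M \<subseteq> T" "\<one> \<in> M" "\<And>m n. m \<in> M \<Longrightarrow> n \<in> M \<Longrightarrow> m \<otimes> n \<in> M"
    and avoid: "\<And>m. m \<in> M \<Longrightarrow> \<boxminus> m \<notin> T"
  shows "\<exists>\<sigma>\<in>sper A. (\<forall>t\<in>T. 0 \<le> \<sigma> t) \<and> (\<forall>m\<in>M. \<sigma> m \<noteq> 0)"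
proof -
  define S where "S = {P. preordering A P \<and> T \<subseteq> P \<and> (\<forall>m\<in>M. \<boxminus> m \<notin> P)}"
  have "\<Union>C \<in> S" if C: "C \<noteq> {}" "subset.chain S C" for C
  proof -
    have CS: "P \<in> S" if "P \<in> C" for P using C that by (auto simp: subset.chain_def)
    have dir: "\<exists>P\<in>C. a \<in> P \<and> b \<in> P" if "a \<in> \<Union>C" "b \<in> \<Union>C" for a b
      using C(2) that unfolding subset.chain_def by blast
    obtain P0 where "P0 \<in> C" using C by blast
    then have *: "x \<otimes> x \<in> \<Union>C" "T \<subseteq> \<Union>C" if "x \<in> carrier A" for x
      using CS[of P0] that unfolding S_def preordering_def by blast+
    have ab: "a \<otimes> b \<in> \<Union>C" "a \<boxplus> b \<subseteq> \<Union>C" if ab: "a \<in> \<Union>C" "b \<in> \<Union>C" for a b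
    proof -
      obtain P where P: "P \<in> C" "a \<in> P" "b \<in> P" using dir[OF ab] by blast
      then have "a \<otimes> b \<in> P" "a \<boxplus> b \<subseteq> P" using CS[of P] by (auto simp: S_def preordering_def)
      then show "a \<otimes> b \<in> \<Union>C" "a \<boxplus> b \<subseteq> \<Union>C" using P by blast+
    qed
    have "P \<subseteq> carrier A" "\<forall>m\<in>M. \<boxminus> m \<notin> P" if "P \<in> C" for P
      using CS[OF that] by (auto simp: S_def preordering_def)
    then have C': "\<Union>C \<subseteq> carrier A" "\<forall>m\<in>M. \<boxminus> m \<notin> \<Union>C" by blast+
    have "preordering A (\<Union>C)"
    proof (rule preorderingI)
      show "c \<in> \<Union>C" if "a \<in> \<Union>C" "b \<in> \<Union>C" "c \<in> a \<boxplus> b" for a b c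
        using ab(2)[OF that(1,2)] that(3) by (rule subsetD)
    qed (use C' * ab in simp_all)
    then show ?thesis using *(2)[OF one_closed] C' by (simp add: S_def)
  qed
  moreover have "T \<in> S" using T avoid by (simp add: S_def)
  ultimately obtain P where PS: "P \<in> S" and max: "\<And>P'. P' \<in> S \<Longrightarrow> P \<subseteq> P' \<Longrightarrow> P' = P"
    using subset_Zorn_nonempty[of S] by blast
  have P: "preordering A P" and TP: "T \<subseteq> P" and PM: "\<And>m. m \<in> M \<Longrightarrow> \<boxminus> m \<notin> P"
    using PS by (auto simp: S_def)
  note P' = preorderingD[OF P]
  have Pc: "x \<in> carrier A" if "x \<in> P" for x using that P'(1) by blast
  have MP: "m \<in> P" if "m \<in> M" for m using that M TP by blast
  \<comment> \<open>A relation \<open>-m \<in> s + u\<close>, solved for \<open>u\<close>.\<close>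
  have witness: "\<exists>m\<in>M. \<exists>s\<in>P. \<exists>u\<in>multiple_sums A P a. \<boxminus> u \<in> m \<boxplus> s"
    if a: "a \<in> carrier A" "a \<notin> P" for a
  proof -
    have "adjoin A P a \<notin> S" using max preordering_adjoin[OF P a(1)] a by blast
    then obtain m where m: "m \<in> M" "\<boxminus> m \<in> adjoin A P a"
      using preordering_adjoin[OF P a(1)] TP by (auto simp: S_def)
    then obtain s u where su: "s \<in> P" "u \<in> multiple_sums A P a" "\<boxminus> m \<in> s \<boxplus> u"
      by (auto simp: adjoin_def)
    have c: "m \<in> carrier A" "s \<in> carrier A" "u \<in> carrier A"
      using Pc[OF MP[OF m(1)]] Pc[OF su(1)] multiple_sums_carrier[OF P'(1) a(1) su(2)] .
    have "\<boxminus> u \<in> (\<boxminus> (\<boxminus> m)) \<boxplus> (\<boxminus> (\<boxminus> s))"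
      using neg_add[OF add_solve_right[OF su(3)]] c neg_closed by blast
    then show ?thesis using m su c by auto
  qed
  have key: "\<not> multiple_sums A P (a \<otimes> b) \<subseteq> {x. \<boxminus> x \<in> P}"
    if ab: "a \<in> carrier A" "b \<in> carrier A" "a \<notin> P" "b \<notin> P" for a b
  proof
    assume sub: "multiple_sums A P (a \<otimes> b) \<subseteq> {x. \<boxminus> x \<in> P}"
    obtain m s u where *: "m \<in> M" "s \<in> P" "u \<in> multiple_sums A P a" "\<boxminus> u \<in> m \<boxplus> s"
      using witness ab by blast
    obtain m' s' u' where **: "m' \<in> M" "s' \<in> P" "u' \<in> multiple_sums A P b" "\<boxminus> u' \<in> m' \<boxplus> s'"
      using witness ab by blast
    have c: "m \<in> carrier A" "s \<in> carrier A" "u \<in> carrier A" "m' \<in> carrier A" "s' \<in> carrier A"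
      "u' \<in> carrier A"
      using Pc[OF MP[OF *(1)]] Pc[OF *(2)] Pc[OF MP[OF **(1)]] Pc[OF **(2)]
        multiple_sums_carrier[OF P'(1) ab(1) *(3)] multiple_sums_carrier[OF P'(1) ab(2) **(3)] by simp_all
    have u'P: "\<boxminus> u' \<in> P" using P'(5)[OF MP[OF **(1)] **(2,4)] .
    \<comment> \<open>Multiplying the two relations gives \<open>u u' \<in> m m' + h\<close> with \<open>h\<close> in the preordering.\<close>
    have "\<boxminus> u \<otimes> \<boxminus> u' \<in> (m \<otimes> \<boxminus> u') \<boxplus> (s \<otimes> \<boxminus> u')"
      using mult_distrib[of "\<boxminus> u" m s "\<boxminus> u'"] *(4) c neg_closed by simp
    then have 1: "u \<otimes> u' \<in> (m \<otimes> \<boxminus> u') \<boxplus> (s \<otimes> \<boxminus> u')" using c by (simp add: neg_mult_neg)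
    have 2: "m \<otimes> \<boxminus> u' \<in> (m \<otimes> m') \<boxplus> (m \<otimes> s')"
      using mult_distrib_left[OF **(4)] c by blast
    obtain h where h: "h \<in> (m \<otimes> s') \<boxplus> (s \<otimes> \<boxminus> u')" "u \<otimes> u' \<in> (m \<otimes> m') \<boxplus> h"
      using add_assoc[OF _ _ _ 2 1] c neg_closed by blast
    have hP: "h \<in> P" using P'(5)[OF P'(6)[OF MP[OF *(1)] **(2)] P'(6)[OF *(2) u'P] h(1)] .
    have "\<boxminus> (m \<otimes> m') \<in> (\<boxminus> (u \<otimes> u')) \<boxplus> \<boxminus> (\<boxminus> h)"
      using neg_add[OF add_solve_left[OF h(2)]] c hP Pc neg_closed by simp
    moreover have "\<boxminus> (u \<otimes> u') \<in> P" using multiple_sums_mult[OF P ab(1,2) *(3) **(3)] sub by blast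
    ultimately have "\<boxminus> (m \<otimes> m') \<in> P" using hP Pc P'(5)[of "\<boxminus> (u \<otimes> u')" h] by simp
    then show False using PM M(3) * ** by blast
  qed
  have total: "a \<in> P \<or> \<boxminus> a \<in> P" if a: "a \<in> carrier A" for a
  proof (rule ccontr)
    assume no: "\<not> (a \<in> P \<or> \<boxminus> a \<in> P)"
    have "\<boxminus> (a \<otimes> \<boxminus> a) \<in> P" using a P'(2) by (simp add: mult_neg neg_closed)
    then have "multiple_sums A P (a \<otimes> \<boxminus> a) \<subseteq> {x. \<boxminus> x \<in> P}"
      using multiple_sums_neg[OF P] a neg_closed by simp
    then show False using key[of a "\<boxminus> a"] a no neg_closed by blast
  qed
  have prime: "a \<in> P \<and> \<boxminus> a \<in> P \<or> b \<in> P \<and> \<boxminus> b \<in> P"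
    if ab: "a \<in> carrier A" "b \<in> carrier A" "a \<otimes> b \<in> P" "\<boxminus> (a \<otimes> b) \<in> P" for a b
  proof (rule ccontr)
    assume no: "\<not> (a \<in> P \<and> \<boxminus> a \<in> P \<or> b \<in> P \<and> \<boxminus> b \<in> P)"
    \<comment> \<open>Signs can be changed, since the support is closed under negation.\<close>
    obtain a' where a': "a' = a \<or> a' = \<boxminus> a" "a' \<notin> P" using no by blast
    obtain b' where b': "b' = b \<or> b' = \<boxminus> b" "b' \<notin> P" using no by blast
    have c: "a' \<in> carrier A" "b' \<in> carrier A" using a' b' ab neg_closed by auto
    have "\<boxminus> (a' \<otimes> b') \<in> P" using a' b' ab by (auto simp: neg_mult mult_neg neg_closed)
    then have "multiple_sums A P (a' \<otimes> b') \<subseteq> {x. \<boxminus> x \<in> P}" using multiple_sums_neg[OF P] c by simp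
    then show False using key[OF c] a' b' by blast
  qed
  define \<sigma> where "\<sigma> = (\<lambda>a\<in>carrier A. if a \<notin> P then -1 else if \<boxminus> a \<notin> P then 1 else (0::int))"
  have "\<sigma> \<in> sper A"
    unfolding \<sigma>_def using sper_of_ordering[OF P total PM[OF M(2)] prime] by blast
  moreover have "\<forall>t\<in>T. 0 \<le> \<sigma> t" "\<forall>m\<in>M. \<sigma> m \<noteq> 0"
    using TP Pc MP PM by (auto simp: \<sigma>_def)
  ultimately show ?thesis by blast
qed

end

section \<open>The real reduced multiring\<close>

lemma hat_eq_iff: "hat A a = hat A b \<longleftrightarrow> (\<forall>\<sigma>\<in>sper A. \<sigma> a = \<sigma> b)"
  by (auto simp: hat_def restrict_def fun_eq_iff)

lemma Q_simps [simp]: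
  "carrier (Q A) = hat A ` carrier A" "\<one>\<^bsub>Q A\<^esub> = hat A \<one>\<^bsub>A\<^esub>" "\<zero>\<^bsub>Q A\<^esub> = hat A \<zero>\<^bsub>A\<^esub>"
  by (simp_all add: Q_def)

lemma Q_mult [simp]:
  "\<lbrakk>a \<in> carrier A; b \<in> carrier A\<rbrakk> \<Longrightarrow> hat A a \<otimes>\<^bsub>Q A\<^esub> hat A b = hat A (a \<otimes>\<^bsub>A\<^esub> b)"
  by (auto simp: Q_def hat_def restrict_def fun_eq_iff sperD)

lemma Q_neg [simp]: "a \<in> carrier A \<Longrightarrow> \<boxminus>\<^bsub>Q A\<^esub> hat A a = hat A (\<boxminus>\<^bsub>A\<^esub> a)"
  by (auto simp: Q_def hat_def restrict_def fun_eq_iff sperD)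

lemma Q_add_iff:
  "F \<in> G \<boxplus>\<^bsub>Q A\<^esub> H \<longleftrightarrow> (\<exists>a\<in>carrier A. \<exists>b\<in>carrier A. \<exists>c\<in>carrier A.
     F = hat A a \<and> G = hat A b \<and> H = hat A c \<and> a \<in> b \<boxplus>\<^bsub>A\<^esub> c)"
  by (auto simp: Q_def)

definition subsign :: "'a multiring \<Rightarrow> 'a \<Rightarrow> 'a set" where
  "subsign A x = {u \<in> carrier A. \<forall>\<sigma>\<in>sper A. \<sigma> u = 0 \<or> \<sigma> u = \<sigma> x}"

text \<open>In \<open>weak_sums\<close>, the summands may vanish where \<open>x\<close> and \<open>y\<close> do not; in \<open>strict_sums\<close>, they
  have the same signs as \<open>x\<close> and \<open>y\<close>. Adding a weak sum to a strict one keeps it strict.\<close>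

definition weak_sums :: "'a multiring \<Rightarrow> 'a \<Rightarrow> 'a \<Rightarrow> 'a set" where
  "weak_sums A x y = {g. \<exists>u\<in>subsign A x. \<exists>v\<in>subsign A y. g \<in> u \<boxplus>\<^bsub>A\<^esub> v}"

definition strict_sums :: "'a multiring \<Rightarrow> 'a \<Rightarrow> 'a \<Rightarrow> 'a set" where
  "strict_sums A x y = {g. \<exists>u\<in>carrier A. \<exists>v\<in>carrier A.
     hat A u = hat A x \<and> hat A v = hat A y \<and> g \<in> u \<boxplus>\<^bsub>A\<^esub> v}"

inductive_set even_powers :: "'a multiring \<Rightarrow> 'a \<Rightarrow> 'a set" for A :: "'a multiring" and g :: 'a where
  one: "\<one>\<^bsub>A\<^esub> \<in> even_powers A g"
| step: "m \<in> even_powers A g \<Longrightarrow> m \<otimes>\<^bsub>A\<^esub> (g \<otimes>\<^bsub>A\<^esub> g) \<in> even_powers A g"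

context multiring
begin

lemma sper_sum_of_squares_nonneg:
  assumes "\<sigma> \<in> sper A" "t \<in> sums_of_squares A"
  shows "0 \<le> \<sigma> t"
  using assms(2)
proof induction
  case (square x)
  then show ?case using assms by (simp add: sperD)
next
  case (add_square y x z)
  have yc: "y \<in> carrier A"
    using preorderingD(1)[OF preordering_sums_of_squares] add_square by blast
  then have zc: "z \<in> carrier A" using add_square add_mem_carrier[of z y] by simp
  have "0 \<le> \<sigma> (x \<otimes> x)" using add_square assms by (simp add: sperD)
  moreover have "\<sigma> y \<in> {-1, 0, 1}" "\<sigma> (x \<otimes> x) \<in> {-1, 0, 1}"
    using sperD(1)[OF assms(1) yc] sperD(1)[OF assms(1), of "x \<otimes> x"] add_square(2) by simp_all
  ultimately show ?case using sperD(6)[OF assms(1) add_square(3) zc yc] add_square by auto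
qed

lemma subsignI: "\<lbrakk>u \<in> carrier A; \<And>\<sigma>. \<sigma> \<in> sper A \<Longrightarrow> \<sigma> u = 0 \<or> \<sigma> u = \<sigma> x\<rbrakk> \<Longrightarrow> u \<in> subsign A x"
  by (simp add: subsign_def)

lemma subsign_add:
  assumes "u \<in> subsign A x" "v \<in> subsign A x" "w \<in> u \<boxplus> v"
  shows "w \<in> subsign A x"
proof -
  have c: "u \<in> carrier A" "v \<in> carrier A" "w \<in> carrier A"
    using assms add_mem_carrier[OF assms(3)] by (auto simp: subsign_def)
  show ?thesis
  proof (rule subsignI[OF c(3)])
    fix \<sigma> assume s: "\<sigma> \<in> sper A"
    show "\<sigma> w = 0 \<or> \<sigma> w = \<sigma> x"
    proof -
      have "\<sigma> u = 0 \<or> \<sigma> u = \<sigma> x" "\<sigma> v = 0 \<or> \<sigma> v = \<sigma> x"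
        using s assms(1,2) by (simp_all add: subsign_def)
      then show ?thesis using sperD(6)[OF s assms(3) c(3,1,2)] by auto
    qed
  qed
qed

lemma hat_add_subsign:
  assumes "u \<in> carrier A" "hat A u = hat A x" "v \<in> subsign A x" "w \<in> u \<boxplus> v"
  shows "w \<in> carrier A" "hat A w = hat A x"
proof -
  have c: "v \<in> carrier A" "w \<in> carrier A"
    using assms add_mem_carrier[OF assms(4)] by (auto simp: subsign_def)
  show "w \<in> carrier A" using c by simp
  show "hat A w = hat A x"
    unfolding hat_eq_iff
  proof
    fix \<sigma> assume s: "\<sigma> \<in> sper A"
    then have "\<sigma> u = \<sigma> x" "\<sigma> v = 0 \<or> \<sigma> v = \<sigma> x"
      using assms(2,3) by (auto simp: subsign_def hat_eq_iff)
    then show "\<sigma> w = \<sigma> x" using sperD(6)[OF s assms(4) c(2) assms(1) c(1)] by auto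
  qed
qed

lemma weak_sums_add:
  assumes "g \<in> weak_sums A x y" "h \<in> weak_sums A x y" "k \<in> g \<boxplus> h"
  shows "k \<in> weak_sums A x y"
proof -
  obtain u v u' v' where *: "u \<in> subsign A x" "v \<in> subsign A y" "g \<in> u \<boxplus> v"
    "u' \<in> subsign A x" "v' \<in> subsign A y" "h \<in> u' \<boxplus> v'"
    using assms(1,2) unfolding weak_sums_def by blast
  then obtain s t where st: "s \<in> u \<boxplus> u'" "t \<in> v \<boxplus> v'" "k \<in> s \<boxplus> t"
    using add_interchange[OF assms(3) *(3,6)] by (auto simp: subsign_def)
  have "s \<in> subsign A x" "t \<in> subsign A y"
    using subsign_add[OF *(1,4) st(1)] subsign_add[OF *(2,5) st(2)] .
  then show ?thesis using st(3) unfolding weak_sums_def by blast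
qed

lemma strict_sums_add:
  assumes "g \<in> strict_sums A x y" "h \<in> weak_sums A x y" "k \<in> g \<boxplus> h"
  shows "k \<in> strict_sums A x y"
proof -
  obtain u v u' v' where *: "u \<in> carrier A" "v \<in> carrier A" "hat A u = hat A x" "hat A v = hat A y"
    "g \<in> u \<boxplus> v" "u' \<in> subsign A x" "v' \<in> subsign A y" "h \<in> u' \<boxplus> v'"
    using assms(1,2) unfolding weak_sums_def strict_sums_def by blast
  then obtain s t where st: "s \<in> u \<boxplus> u'" "t \<in> v \<boxplus> v'" "k \<in> s \<boxplus> t"
    using add_interchange[OF assms(3) *(5,8)] by (auto simp: subsign_def)
  have "s \<in> carrier A" "hat A s = hat A x" "t \<in> carrier A" "hat A t = hat A y"
    using hat_add_subsign[OF *(1,3,6) st(1)] hat_add_subsign[OF *(2,4,7) st(2)] by auto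
  then show ?thesis using st(3) unfolding strict_sums_def by blast
qed

lemma sums_carrier: "g \<in> weak_sums A x y \<Longrightarrow> g \<in> carrier A" "g \<in> strict_sums A x y \<Longrightarrow> g \<in> carrier A"
  unfolding weak_sums_def strict_sums_def subsign_def using add_mem_carrier by blast+

lemma mult_nonneg_weak_sums:
  assumes "g \<in> x \<boxplus> y" "x \<in> carrier A" "y \<in> carrier A" "t \<in> carrier A"
    and t: "\<And>\<sigma>. \<sigma> \<in> sper A \<Longrightarrow> 0 \<le> \<sigma> t"
  shows "g \<otimes> t \<in> weak_sums A x y"
proof -
  have "z \<otimes> t \<in> subsign A z" if z: "z \<in> carrier A" for z
  proof (rule subsignI)
    fix \<sigma> assume s: "\<sigma> \<in> sper A"
    have "\<sigma> t \<in> {0, 1}" using sperD(1)[OF s assms(4)] t[OF s] by auto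
    then show "\<sigma> (z \<otimes> t) = 0 \<or> \<sigma> (z \<otimes> t) = \<sigma> z" using sperD(2)[OF s z assms(4)] by auto
  qed (use z assms in simp)
  moreover have "g \<otimes> t \<in> (x \<otimes> t) \<boxplus> (y \<otimes> t)"
    using mult_distrib[OF _ assms(2,3,4,1)] add_mem_carrier[OF assms(1-3)] by blast
  ultimately show ?thesis using assms unfolding weak_sums_def by blast
qed

text \<open>Expanding \<open>g \<otimes> (z \<otimes> z)\<close> with \<open>g \<in> u + v\<close>, where \<open>u\<close> and \<open>v\<close> have the signs of \<open>x\<close> and
  \<open>y\<close>, and \<open>z \<in> x + y\<close> gives
  \<open>u x x + v x y + u y y + v y x\<close>, with the sign of \<open>x\<close>, plus
  \<open>v x x + u x y + v y y + u y x\<close>, with the sign of \<open>y\<close>. Hence all odd powers of \<open>z\<close> are strict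
  sums; in even powers the terms cannot be sorted by sign.\<close>

lemma mult_square_strict_sums:
  assumes g: "g \<in> strict_sums A x y" and z: "z \<in> x \<boxplus> y" and xy: "x \<in> carrier A" "y \<in> carrier A"
  shows "g \<otimes> (z \<otimes> z) \<in> strict_sums A x y"
proof -
  obtain u v where uv: "u \<in> carrier A" "v \<in> carrier A" "hat A u = hat A x" "hat A v = hat A y"
    "g \<in> u \<boxplus> v"
    using g unfolding strict_sums_def by blast
  have c: "g \<in> carrier A" "z \<in> carrier A"
    using add_mem_carrier[OF uv(5,1,2)] add_mem_carrier[OF z xy] .
  have gd: "g \<otimes> d \<in> (u \<otimes> d) \<boxplus> (v \<otimes> d)" "g \<otimes> d \<in> (v \<otimes> d) \<boxplus> (u \<otimes> d)" if "d \<in> carrier A" for d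
    using mult_distrib[OF c(1) uv(1,2) that uv(5)] add_commute uv that by auto
  have 1: "g \<otimes> (x \<otimes> z) \<in> (g \<otimes> (x \<otimes> x)) \<boxplus> (g \<otimes> (x \<otimes> y))"
    using mult_distrib_left[OF z xy, of "g \<otimes> x"] c xy by (simp add: m_assoc)
  have 2: "g \<otimes> (y \<otimes> z) \<in> (g \<otimes> (y \<otimes> x)) \<boxplus> (g \<otimes> (y \<otimes> y))"
    using mult_distrib_left[OF z xy, of "g \<otimes> y"] c xy by (simp add: m_assoc)
  have 3: "g \<otimes> (z \<otimes> z) \<in> (g \<otimes> (x \<otimes> z)) \<boxplus> (g \<otimes> (y \<otimes> z))"
    using mult_distrib_left[OF z xy, of "g \<otimes> z"] c xy by (simp add: m_ac)
  obtain s1 t1 where st1: "s1 \<in> (u \<otimes> (x \<otimes> x)) \<boxplus> (v \<otimes> (x \<otimes> y))"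
    "t1 \<in> (v \<otimes> (x \<otimes> x)) \<boxplus> (u \<otimes> (x \<otimes> y))" "g \<otimes> (x \<otimes> z) \<in> s1 \<boxplus> t1"
    using add_interchange[OF 1 gd(1) gd(2)] xy uv by auto
  obtain s2 t2 where st2: "s2 \<in> (v \<otimes> (y \<otimes> x)) \<boxplus> (u \<otimes> (y \<otimes> y))"
    "t2 \<in> (u \<otimes> (y \<otimes> x)) \<boxplus> (v \<otimes> (y \<otimes> y))" "g \<otimes> (y \<otimes> z) \<in> s2 \<boxplus> t2"
    using add_interchange[OF 2 gd(2) gd(1)] xy uv by auto
  have t2: "t2 \<in> (v \<otimes> (y \<otimes> y)) \<boxplus> (u \<otimes> (y \<otimes> x))" using st2(2) add_commute uv xy by simp
  have val: "\<sigma> u = \<sigma> x" "\<sigma> v = \<sigma> y" if "\<sigma> \<in> sper A" for \<sigma>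
    using uv that by (auto simp: hat_eq_iff)
  have cube: "\<sigma> w * (\<sigma> w * \<sigma> w) = \<sigma> w" if "\<sigma> \<in> sper A" "w \<in> carrier A" for \<sigma> w
    using sperD(1)[OF that] by auto
  have hx: "hat A (u \<otimes> (x \<otimes> x)) = hat A x" and hy: "hat A (v \<otimes> (y \<otimes> y)) = hat A y"
    using cube xy uv by (auto simp: hat_eq_iff sperD(2) val)
  have absorb: "u' \<otimes> (p \<otimes> q) \<in> subsign A z"
    if "u' \<in> carrier A" "p \<in> carrier A" "q \<in> carrier A" "a \<in> carrier A"
      and "\<And>\<sigma>. \<sigma> \<in> sper A \<Longrightarrow> \<sigma> u' * (\<sigma> p * \<sigma> q) = \<sigma> z * (\<sigma> a * \<sigma> a)" for u' p q z a
  proof (rule subsignI)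
    fix \<sigma> assume s: "\<sigma> \<in> sper A"
    have "\<sigma> (u' \<otimes> (p \<otimes> q)) = \<sigma> z * (\<sigma> a * \<sigma> a)" using that s by (simp add: sperD(2))
    then show "\<sigma> (u' \<otimes> (p \<otimes> q)) = 0 \<or> \<sigma> (u' \<otimes> (p \<otimes> q)) = \<sigma> z"
      using sperD(1)[OF s that(4)] by auto
  qed (use that in simp)
  have wx: "v \<otimes> (x \<otimes> y) \<in> subsign A x" "v \<otimes> (y \<otimes> x) \<in> subsign A x" "u \<otimes> (y \<otimes> y) \<in> subsign A x"
    using xy uv by (auto intro!: absorb[where a = y] simp: val)
  have wy: "u \<otimes> (x \<otimes> y) \<in> subsign A y" "u \<otimes> (y \<otimes> x) \<in> subsign A y" "v \<otimes> (x \<otimes> x) \<in> subsign A y"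
    using xy uv by (auto intro!: absorb[where a = x] simp: val)
  have s1: "s1 \<in> carrier A" "hat A s1 = hat A x"
    using hat_add_subsign[OF _ hx wx(1) st1(1)] uv xy by auto
  have s2: "s2 \<in> subsign A x" using subsign_add[OF wx(2,3) st2(1)] .
  have t1: "t1 \<in> subsign A y" using subsign_add[OF wy(3,1) st1(2)] .
  have t2: "t2 \<in> carrier A" "hat A t2 = hat A y"
    using hat_add_subsign[OF _ hy wy(2) t2] uv xy by auto
  have c': "s2 \<in> carrier A" "t1 \<in> carrier A" using s2 t1 by (auto simp: subsign_def)
  obtain s t where st: "s \<in> s1 \<boxplus> s2" "t \<in> t1 \<boxplus> t2" "g \<otimes> (z \<otimes> z) \<in> s \<boxplus> t"
    using add_interchange[OF 3 st1(3) st2(3) s1(1) c'(2) c'(1) t2(1)] by blast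
  have "t \<in> t2 \<boxplus> t1" using st(2) add_commute[OF c'(2) t2(1)] by simp
  then have "s \<in> carrier A" "hat A s = hat A x" "t \<in> carrier A" "hat A t = hat A y"
    using hat_add_subsign[OF s1 s2 st(1)] hat_add_subsign[OF t2 t1] by auto
  then show ?thesis using st(3) unfolding strict_sums_def by blast
qed

lemma even_powers:
  assumes "g \<in> carrier A"
  shows "m \<in> even_powers A g \<Longrightarrow> m \<in> sums_of_squares A"
    and "\<lbrakk>m \<in> even_powers A g; n \<in> even_powers A g\<rbrakk> \<Longrightarrow> n \<otimes> m \<in> even_powers A g"
proof -
  note S = preorderingD[OF preordering_sums_of_squares]
  show *: "m \<in> sums_of_squares A" if "m \<in> even_powers A g" for m
    using that by induction (use S(4) S(6)[OF _ S(2)[OF assms]] in simp_all)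
  then have c: "m \<in> carrier A" if "m \<in> even_powers A g" for m using that S(1) by blast
  show "n \<otimes> m \<in> even_powers A g" if "m \<in> even_powers A g" "n \<in> even_powers A g"
    using that(1)
  proof induction
    case (step m)
    then show ?case
      using even_powers.step[of "n \<otimes> m" A g] c that(2) assms by (simp add: m_assoc)
  qed (use that c in simp)
qed

text \<open>If \<open>g\<close> and \<open>g'\<close> have the same signs, then \<open>g \<otimes> g'\<close> is positive where \<open>g\<close> does not vanish, so
  by the Positivstellensatz some sum \<open>k\<close> of multiples of \<open>g \<otimes> g'\<close> by sums of squares lies in \<open>m + s\<close>
  with \<open>m\<close> an even power of \<open>g\<close> and \<open>s\<close> a sum of squares. Then \<open>g \<otimes> k\<close> lies in
  \<open>g \<otimes> m + g \<otimes> s\<close>, where \<open>g \<otimes> m\<close> is an odd power of \<open>g\<close>, and it is also a sum of multiples of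
  \<open>g'\<close> by sums of squares.\<close>

lemma exists_strict_weak_sum:
  assumes g: "g \<in> x \<boxplus> y" "x \<in> carrier A" "y \<in> carrier A"
    and g': "g' \<in> x' \<boxplus> y'" "x' \<in> carrier A" "y' \<in> carrier A"
    and eq: "hat A g = hat A g'"
  shows "\<exists>k. k \<in> strict_sums A x y \<and> k \<in> weak_sums A x' y'"
proof -
  let ?T = "sums_of_squares A"
  have c: "g \<in> carrier A" "g' \<in> carrier A"
    using add_mem_carrier[OF g] add_mem_carrier[OF g'] .
  define w where "w = g \<otimes> g'"
  have w: "w \<in> carrier A" using c by (simp add: w_def)
  note S = preorderingD[OF preordering_sums_of_squares]
  note adj = preordering_adjoin[OF preordering_sums_of_squares neg_closed[OF w]]
  have Mc: "m \<in> carrier A" if "m \<in> even_powers A g" for m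
    using even_powers(1)[OF c(1) that] S(1) by blast
  have gg: "g \<otimes> g \<in> even_powers A g"
    using even_powers.step[OF even_powers.one, of A g] c by simp
  have "\<exists>m\<in>even_powers A g. \<boxminus> m \<in> adjoin A ?T (\<boxminus> w)"
  proof (rule ccontr)
    assume no: "\<not> ?thesis"
    obtain \<sigma> where \<sigma>: "\<sigma> \<in> sper A" "\<forall>t\<in>adjoin A ?T (\<boxminus> w). 0 \<le> \<sigma> t"
      "\<forall>m\<in>even_powers A g. \<sigma> m \<noteq> 0"
    proof -
      have "even_powers A g \<subseteq> adjoin A ?T (\<boxminus> w)" using even_powers(1)[OF c(1)] adj(2) by blast
      from positivstellensatz[OF adj(1) this even_powers.one even_powers(2)[OF c(1)]]
      show ?thesis using no that by blast
    qed
    have "\<sigma> (\<boxminus> w) = - (\<sigma> g * \<sigma> g)"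
      using \<sigma>(1) bspec[OF eq[unfolded hat_eq_iff] \<sigma>(1)] c w by (simp add: w_def sperD(2,3))
    moreover have "\<sigma> g * \<sigma> g \<noteq> 0" using \<sigma>(3) gg sperD(2)[OF \<sigma>(1) c(1) c(1)] by auto
    moreover have "0 \<le> \<sigma> g * \<sigma> g" by simp
    ultimately show False using \<sigma>(2) adj(3) by fastforce
  qed
  then obtain m s u where m: "m \<in> even_powers A g" and s: "s \<in> ?T"
    and u: "u \<in> multiple_sums A ?T (\<boxminus> w)" and msu: "\<boxminus> m \<in> s \<boxplus> u"
    unfolding adjoin_def by blast
  have uc: "v \<in> carrier A" if "v \<in> multiple_sums A ?T (\<boxminus> w)" for v
    using multiple_sums_carrier[OF S(1) neg_closed[OF w] that] .
  have c': "m \<in> carrier A" "s \<in> carrier A" "u \<in> carrier A" using Mc[OF m] s S(1) uc[OF u] by auto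
  have u': "\<boxminus> u \<in> m \<boxplus> s"
    using neg_add[OF add_solve_right[OF msu]] c' neg_closed by simp
  have "g \<otimes> m' \<in> strict_sums A x y" if "m' \<in> even_powers A g" for m'
    using that
  proof induction
    case one
    show ?case using g c unfolding strict_sums_def by auto
  next
    case (step m')
    then show ?case
      using mult_square_strict_sums[OF step.IH g] Mc c by (simp add: m_assoc)
  qed
  from this[OF m] have gm: "g \<otimes> m \<in> strict_sums A x y" .
  have gs: "g \<otimes> s \<in> weak_sums A x y"
    using mult_nonneg_weak_sums[OF g c'(2)] sper_sum_of_squares_nonneg s by blast
  have 1: "g \<otimes> \<boxminus> u \<in> strict_sums A x y"
    using strict_sums_add[OF gm gs mult_distrib_left[OF u' c'(1,2) c(1)]] .
  have "g \<otimes> \<boxminus> v \<in> weak_sums A x' y'" if "v \<in> multiple_sums A ?T (\<boxminus> w)" for v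
    using that
  proof induction
    case (multiple t)
    have t: "t \<in> carrier A" using multiple S(1) by blast
    have "g \<otimes> \<boxminus> (\<boxminus> w \<otimes> t) = g' \<otimes> ((g \<otimes> g) \<otimes> t)"
      using c t w by (simp add: neg_mult) (simp add: w_def m_ac)
    moreover have "0 \<le> \<sigma> ((g \<otimes> g) \<otimes> t)" if "\<sigma> \<in> sper A" for \<sigma>
      using sper_sum_of_squares_nonneg[OF that S(6)[OF S(2)[OF c(1)] multiple]] .
    ultimately show ?case using mult_nonneg_weak_sums[OF g', of "(g \<otimes> g) \<otimes> t"] c t by simp
  next
    case (add p q r)
    have pq: "p \<in> carrier A" "q \<in> carrier A" using add uc by auto
    have "g \<otimes> \<boxminus> r \<in> (g \<otimes> \<boxminus> p) \<boxplus> (g \<otimes> \<boxminus> q)"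
      using mult_distrib_left[OF neg_add[OF add(3) pq]] pq c neg_closed by blast
    then show ?case using weak_sums_add[OF add.IH] by blast
  qed
  from this[OF u] show ?thesis using 1 by blast
qed

text \<open>Two sums that have equal hats have, after changing the summands within their hats, a common
  element. Adding the elements of the previous lemma for \<open>(g, g')\<close> and for \<open>(g', g)\<close> makes
  it strict on both sides.\<close>

lemma exists_common_sum:
  assumes g: "g \<in> x \<boxplus> y" "x \<in> carrier A" "y \<in> carrier A"
    and g': "g' \<in> x' \<boxplus> y'" "x' \<in> carrier A" "y' \<in> carrier A"
    and eq: "hat A g = hat A g'"
  shows "\<exists>k. k \<in> strict_sums A x y \<and> k \<in> strict_sums A x' y'"
proof -
  obtain k where k: "k \<in> strict_sums A x y" "k \<in> weak_sums A x' y'"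
    using exists_strict_weak_sum[OF assms] by blast
  obtain k' where k': "k' \<in> strict_sums A x' y'" "k' \<in> weak_sums A x y"
    using exists_strict_weak_sum[OF g' g eq[symmetric]] by blast
  have c: "k \<in> carrier A" "k' \<in> carrier A" using k k' sums_carrier by blast+
  then obtain l where l: "l \<in> k \<boxplus> k'" using add_nonempty by blast
  then have "l \<in> k' \<boxplus> k" using add_commute c by blast
  then show ?thesis
    using strict_sums_add[OF k(1) k'(2) l] strict_sums_add[OF k'(1) k(2)] by blast
qed

text \<open>All axioms but associativity are inherited by lifting to \<open>A\<close>. For associativity, let
  \<open>g \<in> a + b\<close> and \<open>x \<in> g' + c\<close> with \<open>g\<close> and \<open>g'\<close> of equal hats, and write the latter as
  \<open>g' \<in> x - c\<close>. After changing \<open>a\<close>, \<open>b\<close>, \<open>x\<close>, \<open>c\<close> within their hats, the two sums have a common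
  element, and associativity in \<open>A\<close> applies.\<close>

theorem multiring_Q: "multiring (Q A)"
proof -
  have assoc: "\<exists>H\<in>hat A b \<boxplus>\<^bsub>Q A\<^esub> hat A c. X \<in> hat A a \<boxplus>\<^bsub>Q A\<^esub> H"
    if abc: "a \<in> carrier A" "b \<in> carrier A" "c \<in> carrier A"
      and G: "G \<in> hat A a \<boxplus>\<^bsub>Q A\<^esub> hat A b" and X: "X \<in> G \<boxplus>\<^bsub>Q A\<^esub> hat A c" for a b c G X
  proof -
    obtain g a1 b1 where 1: "G = hat A g" "hat A a = hat A a1" "hat A b = hat A b1"
      "g \<in> a1 \<boxplus> b1" "a1 \<in> carrier A" "b1 \<in> carrier A" "g \<in> carrier A"
      using G unfolding Q_add_iff by blast
    obtain x g' c1 where 2: "X = hat A x" "G = hat A g'" "hat A c = hat A c1"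
      "x \<in> g' \<boxplus> c1" "x \<in> carrier A" "g' \<in> carrier A" "c1 \<in> carrier A"
      using X unfolding Q_add_iff by blast
    have "hat A g = hat A g'" using 1 2 by simp
    then obtain k where k: "k \<in> strict_sums A a1 b1" "k \<in> strict_sums A x (\<boxminus> c1)"
      using exists_common_sum[OF 1(4-6) add_solve_left[OF 2(4,6,7)] 2(5) neg_closed[OF 2(7)]] by blast
    obtain a2 b2 where 3: "a2 \<in> carrier A" "b2 \<in> carrier A" "hat A a2 = hat A a1"
      "hat A b2 = hat A b1" "k \<in> a2 \<boxplus> b2"
      using k(1) unfolding strict_sums_def by blast
    obtain x2 d where 4: "x2 \<in> carrier A" "d \<in> carrier A" "hat A x2 = hat A x"
      "hat A d = hat A (\<boxminus> c1)" "k \<in> x2 \<boxplus> d"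
      using k(2) unfolding strict_sums_def by blast
    have d: "hat A (\<boxminus> d) = hat A c1" "\<boxminus> d \<in> carrier A"
      using 4 2(7) neg_closed Q_neg[of d A] Q_neg[of "\<boxminus> c1" A] by auto
    have x2: "x2 \<in> k \<boxplus> \<boxminus> d" using add_solve_left 4 by blast
    obtain h where h: "h \<in> b2 \<boxplus> \<boxminus> d" "x2 \<in> a2 \<boxplus> h"
      using add_assoc[OF 3(1,2) d(2) 3(5) x2] by blast
    have hc: "h \<in> carrier A" using add_mem_carrier[OF h(1) 3(2) d(2)] .
    have "hat A h \<in> hat A b \<boxplus>\<^bsub>Q A\<^esub> hat A c"
      unfolding Q_add_iff using h(1) hc 3 d 1 2 by metis
    moreover have "X \<in> hat A a \<boxplus>\<^bsub>Q A\<^esub> hat A h"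
      unfolding Q_add_iff using h(2) hc 3 4 1 2 by metis
    ultimately show ?thesis by blast
  qed
  show ?thesis
  proof (unfold_locales)
    fix F G assume "F \<in> carrier (Q A)" "G \<in> carrier (Q A)"
    have "X \<in> H \<boxplus>\<^bsub>Q A\<^esub> G" if "X \<in> G \<boxplus>\<^bsub>Q A\<^esub> H" for X G H
      using that add_commute_mem unfolding Q_add_iff by blast
    then show "F \<boxplus>\<^bsub>Q A\<^esub> G = G \<boxplus>\<^bsub>Q A\<^esub> F" by blast
  next
    fix F G assume "F \<in> carrier (Q A)" "G \<in> carrier (Q A)"
    then obtain a b where ab: "F = hat A a" "G = hat A b" "a \<in> carrier A" "b \<in> carrier A" by auto
    then obtain c where c: "c \<in> a \<boxplus> b" using add_nonempty by blast
    then have "hat A c \<in> F \<boxplus>\<^bsub>Q A\<^esub> G"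
      unfolding Q_add_iff using ab add_mem_carrier[OF c] by blast
    then show "F \<boxplus>\<^bsub>Q A\<^esub> G \<noteq> {}" by blast
  next
    fix F G H assume "F \<in> G \<boxplus>\<^bsub>Q A\<^esub> H"
    then obtain a b c where *: "F = hat A a" "G = hat A b" "H = hat A c" "a \<in> b \<boxplus> c"
      "a \<in> carrier A" "b \<in> carrier A" "c \<in> carrier A" unfolding Q_add_iff by blast
    have "H \<in> hat A (\<boxminus> b) \<boxplus>\<^bsub>Q A\<^esub> F" "G \<in> F \<boxplus>\<^bsub>Q A\<^esub> hat A (\<boxminus> c)"
      unfolding Q_add_iff using * add_reversible[OF *(5-7,4)] neg_closed by blast+
    then show "H \<in> \<boxminus>\<^bsub>Q A\<^esub> G \<boxplus>\<^bsub>Q A\<^esub> F \<and> G \<in> F \<boxplus>\<^bsub>Q A\<^esub> \<boxminus>\<^bsub>Q A\<^esub> H" using * by simp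
    fix D assume "D \<in> carrier (Q A)"
    then obtain d where d: "D = hat A d" "d \<in> carrier A" by auto
    have "hat A (a \<otimes> d) \<in> hat A (b \<otimes> d) \<boxplus>\<^bsub>Q A\<^esub> hat A (c \<otimes> d)"
      unfolding Q_add_iff using * d mult_distrib[OF *(5-7) d(2) *(4)] by blast
    then show "F \<otimes>\<^bsub>Q A\<^esub> D \<in> G \<otimes>\<^bsub>Q A\<^esub> D \<boxplus>\<^bsub>Q A\<^esub> H \<otimes>\<^bsub>Q A\<^esub> D" using * d by simp
  next
    fix F G assume F: "F \<in> carrier (Q A)" "G \<in> carrier (Q A)"
    show "F \<in> G \<boxplus>\<^bsub>Q A\<^esub> \<zero>\<^bsub>Q A\<^esub> \<longleftrightarrow> F = G"
    proof
      assume "F \<in> G \<boxplus>\<^bsub>Q A\<^esub> \<zero>\<^bsub>Q A\<^esub>"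
      then obtain a b c where *: "F = hat A a" "G = hat A b" "hat A \<zero> = hat A c" "a \<in> b \<boxplus> c"
        "a \<in> carrier A" "b \<in> carrier A" "c \<in> carrier A" unfolding Q_add_iff by auto
      have "\<sigma> a = \<sigma> b" if s: "\<sigma> \<in> sper A" for \<sigma>
        using sperD(6)[OF s *(4-7)] sperD(4)[OF s] *(3) s by (metis hat_eq_iff)
      then show "F = G" using * by (simp add: hat_eq_iff)
    next
      assume "F = G"
      moreover obtain a where a: "a \<in> carrier A" "G = hat A a" using F by auto
      moreover have "a \<in> a \<boxplus> \<zero>" using add_zero a by blast
      ultimately show "F \<in> G \<boxplus>\<^bsub>Q A\<^esub> \<zero>\<^bsub>Q A\<^esub>"
        unfolding Q_add_iff using zero_closed Q_simps(3) by blast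
    qed
  next
    fix F G assume "F \<in> carrier (Q A)" "G \<in> carrier (Q A)"
    show "F \<boxplus>\<^bsub>Q A\<^esub> G \<subseteq> carrier (Q A)" by (auto simp: Q_add_iff)
  next
    fix F G H X Y assume "F \<in> carrier (Q A)" "G \<in> carrier (Q A)" "H \<in> carrier (Q A)"
      and *: "X \<in> F \<boxplus>\<^bsub>Q A\<^esub> G" "Y \<in> X \<boxplus>\<^bsub>Q A\<^esub> H"
    then show "\<exists>Z\<in>G \<boxplus>\<^bsub>Q A\<^esub> H. Y \<in> F \<boxplus>\<^bsub>Q A\<^esub> Z" using assoc by auto
  qed (auto simp: m_ac neg_closed zero_closed mult_zero)
qed

lemma Q_map_hom: "Q_map A \<in> multiring_hom A (Q A)"
  unfolding multiring_hom_def
  by (auto simp: Q_map_def neg_closed zero_closed Q_add_iff)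

end

section \<open>Residue multirings\<close>

text \<open>The members of a prime ideal serve as error terms: \<open>congruent_mod A p x y\<close> is equality of the
  classes of \<open>x\<close> and \<open>y\<close> modulo \<open>p\<close>, and \<open>frac_eq A p x y a b\<close> is equality of \<open>x/y\<close> and \<open>a/b\<close> in
  the residue multiring at \<open>p\<close>.\<close>

definition congruent_mod :: "'a multiring \<Rightarrow> 'a set \<Rightarrow> 'a \<Rightarrow> 'a \<Rightarrow> bool" where
  "congruent_mod A p x y \<longleftrightarrow> (\<exists>i\<in>p. x \<in> y \<boxplus>\<^bsub>A\<^esub> i)"

definition frac_eq :: "'a multiring \<Rightarrow> 'a set \<Rightarrow> 'a \<Rightarrow> 'a \<Rightarrow> 'a \<Rightarrow> 'a \<Rightarrow> bool" where
  "frac_eq A p x y a b \<longleftrightarrow> (\<exists>u\<in>carrier A - p.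
     congruent_mod A p (x \<otimes>\<^bsub>A\<^esub> b \<otimes>\<^bsub>A\<^esub> u) (a \<otimes>\<^bsub>A\<^esub> y \<otimes>\<^bsub>A\<^esub> u))"

lemma UN_eq_const: "\<lbrakk>z \<in> S; \<And>w. w \<in> S \<Longrightarrow> f w = c\<rbrakk> \<Longrightarrow> (\<Union>w\<in>S. f w) = c"
  by auto

context multiring
begin

lemma specD:
  assumes "p \<in> multiring_spec A"
  shows "p \<subseteq> carrier A" "\<zero> \<in> p" "\<one> \<notin> p" "\<lbrakk>a \<in> p; b \<in> p; c \<in> a \<boxplus> b\<rbrakk> \<Longrightarrow> c \<in> p"
    "\<lbrakk>a \<in> carrier A; b \<in> p\<rbrakk> \<Longrightarrow> a \<otimes> b \<in> p" "\<lbrakk>a \<in> p; b \<in> carrier A\<rbrakk> \<Longrightarrow> a \<otimes> b \<in> p"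
    "a \<in> p \<Longrightarrow> \<boxminus> a \<in> p"
    "\<lbrakk>a \<in> carrier A; b \<in> carrier A; a \<otimes> b \<in> p\<rbrakk> \<Longrightarrow> a \<in> p \<or> b \<in> p"
proof -
  have I: "p \<noteq> {}" "p \<subseteq> carrier A" "\<And>a b. a \<in> p \<Longrightarrow> b \<in> p \<Longrightarrow> a \<boxplus> b \<subseteq> p"
    "\<And>a b. a \<in> carrier A \<Longrightarrow> b \<in> p \<Longrightarrow> a \<otimes> b \<in> p"
    using assms by (simp_all add: multiring_spec_def multiring_ideal_def)
  show "p \<subseteq> carrier A" "\<And>a b. a \<in> carrier A \<Longrightarrow> b \<in> p \<Longrightarrow> a \<otimes> b \<in> p" using I by auto
  obtain a where "a \<in> p" using I by blast
  then show "\<zero> \<in> p" using I(4)[OF zero_closed] I(2) zero_mult by fastforce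
  show "\<one> \<notin> p" "\<lbrakk>a \<in> carrier A; b \<in> carrier A; a \<otimes> b \<in> p\<rbrakk> \<Longrightarrow> a \<in> p \<or> b \<in> p" for a b
    using assms by (simp_all add: multiring_spec_def)
  show "c \<in> p" if "a \<in> p" "b \<in> p" "c \<in> a \<boxplus> b" for a b c
    using I(3)[OF that(1,2)] that(3) by (rule subsetD)
  show "a \<otimes> b \<in> p" if "a \<in> p" "b \<in> carrier A" for a b
    using I(4)[OF that(2,1)] m_comm[of a b] I(2) that by auto
  show "\<boxminus> a \<in> p" if "a \<in> p" for a
  proof -
    have "a \<in> carrier A" using I(2) that by blast
    then show ?thesis
      using I(4)[OF neg_closed[OF one_closed] that] neg_mult[of \<one> a] by simp
  qed
qed

lemma spec_mult_notin:
  "\<lbrakk>p \<in> multiring_spec A; a \<in> carrier A - p; b \<in> carrier A - p\<rbrakk> \<Longrightarrow> a \<otimes> b \<in> carrier A - p"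
  using specD(8) by auto

lemma congruent_refl: "\<lbrakk>p \<in> multiring_spec A; x \<in> carrier A\<rbrakk> \<Longrightarrow> congruent_mod A p x x"
  unfolding congruent_mod_def using specD(2) add_zero by blast

lemma congruent_sym:
  assumes "p \<in> multiring_spec A" "y \<in> carrier A" "congruent_mod A p x y"
  shows "congruent_mod A p y x"
proof -
  obtain i where "i \<in> p" "x \<in> y \<boxplus> i" using assms unfolding congruent_mod_def by blast
  then show ?thesis
    using add_solve_left[of x y i] specD(1,7)[OF assms(1)] assms(2) unfolding congruent_mod_def by blast
qed

lemma congruent_trans:
  assumes "p \<in> multiring_spec A" "z \<in> carrier A" "congruent_mod A p x y" "congruent_mod A p y z"
  shows "congruent_mod A p x z"
proof -
  note S = specD[OF assms(1)]
  obtain i j where ij: "i \<in> p" "x \<in> y \<boxplus> i" "j \<in> p" "y \<in> z \<boxplus> j"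
    using assms(3,4) unfolding congruent_mod_def by blast
  have c: "i \<in> carrier A" "j \<in> carrier A" using ij(1,3) S(1) by auto
  obtain h where h: "h \<in> j \<boxplus> i" "x \<in> z \<boxplus> h"
    using add_assoc[OF assms(2) c(2,1) ij(4,2)] by blast
  then show ?thesis using S(4)[OF ij(3,1) h(1)] unfolding congruent_mod_def by blast
qed

lemma congruent_mult:
  assumes "p \<in> multiring_spec A" "y \<in> carrier A" "c \<in> carrier A" "congruent_mod A p x y"
  shows "congruent_mod A p (x \<otimes> c) (y \<otimes> c)"
proof -
  note S = specD[OF assms(1)]
  obtain i where i: "i \<in> p" "x \<in> y \<boxplus> i" using assms unfolding congruent_mod_def by blast
  have ic: "i \<in> carrier A" using i S(1) by blast
  have "x \<otimes> c \<in> (y \<otimes> c) \<boxplus> (i \<otimes> c)"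
    using mult_distrib[OF add_mem_carrier[OF i(2) assms(2) ic] assms(2) ic assms(3) i(2)] .
  then show ?thesis using S(6)[OF i(1) assms(3)] unfolding congruent_mod_def by blast
qed

lemma congruent_mult_mult:
  assumes p: "p \<in> multiring_spec A" and c: "x \<in> carrier A" "y \<in> carrier A" "a \<in> carrier A" "b \<in> carrier A"
    and "congruent_mod A p x y" "congruent_mod A p a b"
  shows "congruent_mod A p (x \<otimes> a) (y \<otimes> b)"
proof -
  have "congruent_mod A p (x \<otimes> a) (y \<otimes> a)" "congruent_mod A p (a \<otimes> y) (b \<otimes> y)"
    using congruent_mult assms by auto
  then show ?thesis
    using congruent_trans[OF p _ , of "y \<otimes> b" "x \<otimes> a" "y \<otimes> a"] c by (simp add: m_comm)
qed

lemma congruent_zero_iff: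
  assumes "p \<in> multiring_spec A" "y \<in> carrier A"
  shows "congruent_mod A p y \<zero> \<longleftrightarrow> y \<in> p"
proof -
  have "y \<in> \<zero> \<boxplus> i \<longleftrightarrow> y = i" if "i \<in> p" for i
    using zero_add[OF assms(2), of i] specD(1)[OF assms(1)] that by blast
  then show ?thesis unfolding congruent_mod_def by auto
qed

lemma congruent_neg:
  assumes "p \<in> multiring_spec A" "y \<in> carrier A" "x \<in> carrier A" "congruent_mod A p x y"
  shows "congruent_mod A p (\<boxminus> x) (\<boxminus> y)"
  using congruent_mult[OF assms(1,2) neg_closed[OF one_closed] assms(4)] assms(2,3)
  by (simp add: mult_neg)

lemma residue_class_mem_iff:
  assumes p: "p \<in> multiring_spec A" and a: "a \<in> carrier A"
  shows "b \<in> residue_class A p a \<longleftrightarrow> b \<in> carrier A \<and> congruent_mod A p a b"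
proof -
  have "(\<exists>i\<in>p. i \<in> a \<boxplus> \<boxminus> b) \<longleftrightarrow> (\<exists>i\<in>p. a \<in> b \<boxplus> i)" if b: "b \<in> carrier A"
  proof -
    have "i \<in> a \<boxplus> \<boxminus> b \<longleftrightarrow> a \<in> b \<boxplus> i" if i: "i \<in> carrier A" for i
    proof
      assume "i \<in> a \<boxplus> \<boxminus> b"
      then show "a \<in> b \<boxplus> i"
        using add_solve_left[of i a "\<boxminus> b"] a b i neg_closed add_commute by simp
    next
      assume "a \<in> b \<boxplus> i" then show "i \<in> a \<boxplus> \<boxminus> b"
        using add_solve_right[of a b i] b i by simp
    qed
    then show ?thesis using specD(1)[OF p] by blast
  qed
  then show ?thesis unfolding residue_class_def congruent_mod_def by blast
qed

lemma residue_class_eq_iff: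
  assumes p: "p \<in> multiring_spec A" and c: "a \<in> carrier A" "b \<in> carrier A"
  shows "residue_class A p a = residue_class A p b \<longleftrightarrow> congruent_mod A p a b"
proof
  assume "residue_class A p a = residue_class A p b"
  then show "congruent_mod A p a b"
    using residue_class_mem_iff[OF p c(1), of b] residue_class_mem_iff[OF p c(2), of b]
      congruent_refl[OF p c(2)] c by simp
next
  assume ab: "congruent_mod A p a b"
  then have ba: "congruent_mod A p b a" using congruent_sym p c by blast
  show "residue_class A p a = residue_class A p b"
    using congruent_trans[OF p _ ab] congruent_trans[OF p _ ba] 
    by (auto simp: residue_class_mem_iff p c)
qed

lemma mem_residue_class: "\<lbrakk>p \<in> multiring_spec A; a \<in> carrier A\<rbrakk> \<Longrightarrow> a \<in> residue_class A p a"
  by (simp add: residue_class_mem_iff congruent_refl)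

lemma residue_class_of_mem:
  "\<lbrakk>p \<in> multiring_spec A; a \<in> carrier A; b \<in> residue_class A p a\<rbrakk>
    \<Longrightarrow> b \<in> carrier A \<and> residue_class A p b = residue_class A p a"
  using residue_class_mem_iff residue_class_eq_iff by metis

lemma quotient_simps:
  "carrier (quotient_multiring A p) = residue_class A p ` carrier A"
  "\<one>\<^bsub>quotient_multiring A p\<^esub> = residue_class A p \<one>"
  "\<zero>\<^bsub>quotient_multiring A p\<^esub> = residue_class A p \<zero>"
  by (simp_all add: quotient_multiring_def Let_def)

lemma quotient_mult:
  assumes p: "p \<in> multiring_spec A" and c: "a \<in> carrier A" "b \<in> carrier A"
  shows "residue_class A p a \<otimes>\<^bsub>quotient_multiring A p\<^esub> residue_class A p b = residue_class A p (a \<otimes> b)"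
proof -
  have "residue_class A p (x \<otimes> y) = residue_class A p (a \<otimes> b)"
    if "x \<in> residue_class A p a" "y \<in> residue_class A p b" for x y
  proof -
    have xy: "x \<in> carrier A" "congruent_mod A p x a" "y \<in> carrier A" "congruent_mod A p y b"
      using that c by (auto simp: residue_class_mem_iff p intro: congruent_sym)
    show ?thesis
      using congruent_mult_mult[OF p xy(1) c(1) xy(3) c(2) xy(2,4)] xy c
      by (simp add: residue_class_eq_iff p)
  qed
  then have "(\<Union>x\<in>residue_class A p a. \<Union>y\<in>residue_class A p b. residue_class A p (x \<otimes> y)) =
      residue_class A p (a \<otimes> b)"
    using mem_residue_class[OF p c(1)] mem_residue_class[OF p c(2)] by blast
  then show ?thesis by (simp add: quotient_multiring_def Let_def)
qed

lemma quotient_neg: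
  assumes p: "p \<in> multiring_spec A" and c: "a \<in> carrier A"
  shows "\<boxminus>\<^bsub>quotient_multiring A p\<^esub> residue_class A p a = residue_class A p (\<boxminus> a)"
proof -
  have "residue_class A p (\<boxminus> x) = residue_class A p (\<boxminus> a)" if "x \<in> residue_class A p a" for x
  proof -
    have x: "x \<in> carrier A" "congruent_mod A p x a"
      using that c by (auto simp: residue_class_mem_iff p intro: congruent_sym)
    show ?thesis
      using congruent_neg[OF p c x] x(1) c by (simp add: residue_class_eq_iff p neg_closed)
  qed
  then have "(\<Union>x\<in>residue_class A p a. residue_class A p (\<boxminus> x)) = residue_class A p (\<boxminus> a)"
    using mem_residue_class[OF p c] by blast
  then show ?thesis by (simp add: quotient_multiring_def Let_def)
qed

text \<open>The error term in the sum of residue classes can be moved into the element on the left.\<close>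

lemma quotient_add_iff:
  assumes p: "p \<in> multiring_spec A"
  shows "X \<in> Y \<boxplus>\<^bsub>quotient_multiring A p\<^esub> Z \<and> Y \<in> carrier (quotient_multiring A p) \<and>
      Z \<in> carrier (quotient_multiring A p) \<longleftrightarrow>
    (\<exists>x\<in>carrier A. \<exists>y\<in>carrier A. \<exists>z\<in>carrier A. X = residue_class A p x \<and>
      Y = residue_class A p y \<and> Z = residue_class A p z \<and> x \<in> y \<boxplus> z)"
    (is "?L \<longleftrightarrow> ?R")
proof
  assume ?L
  then obtain a b c i d x' y' z' where
    *: "X = residue_class A p x'" "x' \<in> carrier A" "Y = residue_class A p y'" "y' \<in> carrier A"
      "Z = residue_class A p z'" "z' \<in> carrier A"
      "a \<in> X" "b \<in> Y" "c \<in> Z" "i \<in> p" "d \<in> b \<boxplus> c" "a \<in> d \<boxplus> i"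
    unfolding quotient_multiring_def Let_def by auto
  have b: "b \<in> carrier A" "Y = residue_class A p b" and c: "c \<in> carrier A" "Z = residue_class A p c"
    and a: "a \<in> carrier A" "X = residue_class A p a"
    using * residue_class_of_mem[OF p] by metis+
  have d: "d \<in> carrier A" using add_mem_carrier[OF *(11) b(1) c(1)] .
  have "congruent_mod A p a d" using *(10,12) unfolding congruent_mod_def by blast
  then have "X = residue_class A p d" using a d by (simp add: residue_class_eq_iff p)
  then show ?R using b c d *(11) by blast
next
  assume ?R
  then obtain x y z where *: "x \<in> carrier A" "y \<in> carrier A" "z \<in> carrier A"
    "X = residue_class A p x" "Y = residue_class A p y" "Z = residue_class A p z" "x \<in> y \<boxplus> z"
    by blast
  then have "x \<in> X" "y \<in> Y" "z \<in> Z" using mem_residue_class[OF p] by auto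
  moreover have "x \<in> x \<boxplus> \<zero>" using add_zero *(1) zero_closed by blast
  ultimately have "\<exists>a\<in>X. \<exists>b\<in>Y. \<exists>c\<in>Z. \<exists>i\<in>p. \<exists>d\<in>b \<boxplus> c. a \<in> d \<boxplus> i"
    using *(7) specD(2)[OF p] by blast
  then show ?L using *(1-6) by (simp add: quotient_multiring_def Let_def)
qed

lemma nonzero_quotient:
  assumes p: "p \<in> multiring_spec A"
  shows "nonzero (quotient_multiring A p) = residue_class A p ` (carrier A - p)"
proof -
  have "residue_class A p x = residue_class A p \<zero> \<longleftrightarrow> x \<in> p" if "x \<in> carrier A" for x
    using that by (simp add: residue_class_eq_iff p zero_closed congruent_zero_iff)
  then show ?thesis unfolding nonzero_def quotient_simps by auto
qed

lemma K_frac_mem_iff: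
  assumes p: "p \<in> multiring_spec A" and x: "x \<in> carrier A" and y: "y \<in> carrier A"
  shows "(X, Y) \<in> K_frac A p x y \<longleftrightarrow> (\<exists>a\<in>carrier A. \<exists>b\<in>carrier A - p.
    X = residue_class A p a \<and> Y = residue_class A p b \<and> frac_eq A p x y a b)"
proof -
  have *: "(residue_class A p a, residue_class A p b) \<in> K_frac A p x y \<longleftrightarrow> frac_eq A p x y a b"
    if ab: "a \<in> carrier A" "b \<in> carrier A - p" for a b
  proof -
    have "(residue_class A p a, residue_class A p b) \<in> K_frac A p x y \<longleftrightarrow>
      (\<exists>u\<in>carrier A - p. residue_class A p x \<otimes>\<^bsub>quotient_multiring A p\<^esub> residue_class A p b
          \<otimes>\<^bsub>quotient_multiring A p\<^esub> residue_class A p u =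
        residue_class A p a \<otimes>\<^bsub>quotient_multiring A p\<^esub> residue_class A p y
          \<otimes>\<^bsub>quotient_multiring A p\<^esub> residue_class A p u)"
      using ab by (simp add: K_frac_def fraction_class_def quotient_simps nonzero_quotient p)
    also have "\<dots> \<longleftrightarrow> frac_eq A p x y a b"
      unfolding frac_eq_def
      using ab x y by (intro bex_cong refl) (simp add: quotient_mult p residue_class_eq_iff)
    finally show ?thesis .
  qed
  show ?thesis
  proof
    assume m: "(X, Y) \<in> K_frac A p x y"
    then have "X \<in> residue_class A p ` carrier A" "Y \<in> residue_class A p ` (carrier A - p)"
      by (simp_all add: K_frac_def fraction_class_def quotient_simps nonzero_quotient p)
    then obtain a b where ab: "a \<in> carrier A" "b \<in> carrier A - p" "X = residue_class A p a"
      "Y = residue_class A p b" by blast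
    then show "\<exists>a\<in>carrier A. \<exists>b\<in>carrier A - p.
        X = residue_class A p a \<and> Y = residue_class A p b \<and> frac_eq A p x y a b"
      using m *[OF ab(1,2)] by auto
  next
    assume "\<exists>a\<in>carrier A. \<exists>b\<in>carrier A - p.
        X = residue_class A p a \<and> Y = residue_class A p b \<and> frac_eq A p x y a b"
    then show "(X, Y) \<in> K_frac A p x y" using * by auto
  qed
qed

lemma frac_eq_refl:
  assumes "p \<in> multiring_spec A" "x \<in> carrier A" "y \<in> carrier A"
  shows "frac_eq A p x y x y"
  unfolding frac_eq_def using assms specD(3)[OF assms(1)] congruent_refl[of p "x \<otimes> y \<otimes> \<one>"]
  by (intro bexI[of _ \<one>]) simp_all

lemma frac_eqI:
  "\<lbrakk>p \<in> multiring_spec A; x \<in> carrier A; y \<in> carrier A; a \<in> carrier A; b \<in> carrier A;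
    u \<in> carrier A - p; x \<otimes> b \<otimes> u = a \<otimes> y \<otimes> u\<rbrakk> \<Longrightarrow> frac_eq A p x y a b"
  unfolding frac_eq_def using congruent_refl[of p "a \<otimes> y \<otimes> u"] by (intro bexI[of _ u]) simp_all

lemma frac_eq_sym:
  assumes "p \<in> multiring_spec A" "x \<in> carrier A" "y \<in> carrier A" "a \<in> carrier A" "b \<in> carrier A"
    "frac_eq A p x y a b"
  shows "frac_eq A p a b x y"
proof -
  obtain u where u: "u \<in> carrier A - p" "congruent_mod A p (x \<otimes> b \<otimes> u) (a \<otimes> y \<otimes> u)"
    using assms unfolding frac_eq_def by blast
  then have "congruent_mod A p (a \<otimes> y \<otimes> u) (x \<otimes> b \<otimes> u)" using congruent_sym assms by simp
  then show ?thesis using u unfolding frac_eq_def by blast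
qed

lemma frac_eq_trans:
  assumes p: "p \<in> multiring_spec A" and c: "x \<in> carrier A" "y \<in> carrier A" "a \<in> carrier A"
    "b \<in> carrier A - p" "c \<in> carrier A" "d \<in> carrier A"
    and e: "frac_eq A p x y a b" "frac_eq A p a b c d"
  shows "frac_eq A p x y c d"
proof -
  obtain u where u: "u \<in> carrier A - p" "congruent_mod A p (x \<otimes> b \<otimes> u) (a \<otimes> y \<otimes> u)"
    using e(1) unfolding frac_eq_def by blast
  obtain v where v: "v \<in> carrier A - p" "congruent_mod A p (a \<otimes> d \<otimes> v) (c \<otimes> b \<otimes> v)"
    using e(2) unfolding frac_eq_def by blast
  have "congruent_mod A p (x \<otimes> b \<otimes> u \<otimes> (d \<otimes> v)) (a \<otimes> y \<otimes> u \<otimes> (d \<otimes> v))"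
    using congruent_mult[OF p _ _ u(2), of "d \<otimes> v"] c u v by simp
  moreover have "congruent_mod A p (a \<otimes> d \<otimes> v \<otimes> (y \<otimes> u)) (c \<otimes> b \<otimes> v \<otimes> (y \<otimes> u))"
    using congruent_mult[OF p _ _ v(2), of "y \<otimes> u"] c u v by simp
  moreover have "a \<otimes> d \<otimes> v \<otimes> (y \<otimes> u) = a \<otimes> y \<otimes> u \<otimes> (d \<otimes> v)" using c u v by (simp add: m_ac)
  ultimately have "congruent_mod A p (x \<otimes> b \<otimes> u \<otimes> (d \<otimes> v)) (c \<otimes> b \<otimes> v \<otimes> (y \<otimes> u))"
    using congruent_trans[OF p, of "c \<otimes> b \<otimes> v \<otimes> (y \<otimes> u)" "x \<otimes> b \<otimes> u \<otimes> (d \<otimes> v)"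
      "a \<otimes> y \<otimes> u \<otimes> (d \<otimes> v)"] c u v by simp
  moreover have "x \<otimes> b \<otimes> u \<otimes> (d \<otimes> v) = x \<otimes> d \<otimes> (b \<otimes> u \<otimes> v)"
    "c \<otimes> b \<otimes> v \<otimes> (y \<otimes> u) = c \<otimes> y \<otimes> (b \<otimes> u \<otimes> v)"
    using c u v by (simp_all add: m_ac)
  moreover have "b \<otimes> u \<otimes> v \<in> carrier A - p"
    using c(4) u(1) v(1) by (intro spec_mult_notin[OF p])
  ultimately show ?thesis unfolding frac_eq_def by metis
qed

lemma K_frac_eq_iff:
  assumes p: "p \<in> multiring_spec A" and c: "x \<in> carrier A" "y \<in> carrier A - p"
    "a \<in> carrier A" "b \<in> carrier A - p"
  shows "K_frac A p x y = K_frac A p a b \<longleftrightarrow> frac_eq A p x y a b"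
proof
  assume eq: "K_frac A p x y = K_frac A p a b"
  have "(residue_class A p a, residue_class A p b) \<in> K_frac A p x y"
    using c frac_eq_refl[OF p c(3), of b] unfolding eq by (subst K_frac_mem_iff[OF p]) auto
  then obtain a' b' where *: "a' \<in> carrier A" "b' \<in> carrier A - p" "frac_eq A p x y a' b'"
    "congruent_mod A p a a'" "congruent_mod A p b b'"
    using c by (auto simp: K_frac_mem_iff p residue_class_eq_iff)
  have 1: "congruent_mod A p (a' \<otimes> b \<otimes> \<one>) (a \<otimes> b' \<otimes> \<one>)"
    using congruent_mult_mult[OF p, of a' a b b'] * c congruent_sym[OF p _ *(4)] by simp
  have "frac_eq A p a' b' a b"
    unfolding frac_eq_def using 1 specD(3)[OF p] by (intro bexI[of _ \<one>]) simp_all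
  then show "frac_eq A p x y a b"
    using frac_eq_trans[OF p _ _ *(1,2) _ _ *(3)] c by blast
next
  assume f: "frac_eq A p x y a b"
  then have "frac_eq A p a b x y" using frac_eq_sym p c by simp
  then have "frac_eq A p x y a' b' \<longleftrightarrow> frac_eq A p a b a' b'"
    if "a' \<in> carrier A" "b' \<in> carrier A" for a' b'
    using f that c by (meson DiffD1 frac_eq_trans p)
  then have "(X, Y) \<in> K_frac A p x y \<longleftrightarrow> (X, Y) \<in> K_frac A p a b" for X Y
    using c by (auto simp: K_frac_mem_iff p)
  then show "K_frac A p x y = K_frac A p a b" by auto
qed

lemma K_frac_eqI:
  "\<lbrakk>p \<in> multiring_spec A; x \<in> carrier A; y \<in> carrier A - p; a \<in> carrier A; b \<in> carrier A - p;
    u \<in> carrier A - p; x \<otimes> b \<otimes> u = a \<otimes> y \<otimes> u\<rbrakk> \<Longrightarrow> K_frac A p x y = K_frac A p a b"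
  using frac_eqI[of p x y a b u] by (simp add: K_frac_eq_iff)

lemma K_frac_expand:
  assumes "p \<in> multiring_spec A" "x \<in> carrier A" "y \<in> carrier A - p" "u \<in> carrier A - p"
  shows "K_frac A p (x \<otimes> u) (y \<otimes> u) = K_frac A p x y"
proof (rule K_frac_eqI[OF assms(1), where u = \<one>])
  show "x \<otimes> u \<otimes> y \<otimes> \<one> = x \<otimes> (y \<otimes> u) \<otimes> \<one>" using assms by (simp add: m_ac)
  show "y \<otimes> u \<in> carrier A - p" using spec_mult_notin assms by blast
qed (use assms specD(3)[OF assms(1)] in auto)

lemma K_frac_zero:
  assumes "p \<in> multiring_spec A" "y \<in> carrier A - p"
  shows "K_frac A p \<zero> y = K_frac A p \<zero> \<one>"
  by (rule K_frac_eqI[OF assms(1), where u = \<one>]) (use assms specD(3)[OF assms(1)] zero_closed in auto)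

lemma K_frac_zero_iff:
  assumes p: "p \<in> multiring_spec A" and c: "x \<in> carrier A" "y \<in> carrier A - p"
  shows "K_frac A p x y = K_frac A p \<zero> \<one> \<longleftrightarrow> x \<in> p"
proof -
  have "K_frac A p x y = K_frac A p \<zero> \<one> \<longleftrightarrow> frac_eq A p x y \<zero> \<one>"
    using K_frac_eq_iff[OF p c zero_closed] specD(3)[OF p] by simp
  also have "\<dots> \<longleftrightarrow> (\<exists>u\<in>carrier A - p. x \<otimes> u \<in> p)"
    unfolding frac_eq_def using c by (simp add: congruent_zero_iff p)
  also have "\<dots> \<longleftrightarrow> x \<in> p"
    using specD(3,6,8)[OF p] c one_closed by blast
  finally show ?thesis .
qed

lemma K_carrier:
  assumes "p \<in> multiring_spec A"
  shows "carrier (K A p) = {K_frac A p x y | x y. x \<in> carrier A \<and> y \<in> carrier A - p}"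
proof -
  have "carrier (K A p) = {fraction_class (quotient_multiring A p) (nonzero (quotient_multiring A p)) a s
    | a s. a \<in> carrier (quotient_multiring A p) \<and> s \<in> nonzero (quotient_multiring A p)}"
    by (simp add: K_def fractions_def Let_def)
  also have "\<dots> = {K_frac A p x y | x y. x \<in> carrier A \<and> y \<in> carrier A - p}"
    unfolding quotient_simps nonzero_quotient[OF assms] K_frac_def by blast
  finally show ?thesis .
qed

lemma K_frac_closed:
  "\<lbrakk>p \<in> multiring_spec A; x \<in> carrier A; y \<in> carrier A - p\<rbrakk> \<Longrightarrow> K_frac A p x y \<in> carrier (K A p)"
  using K_carrier by blast

lemma K_cases:
  assumes "p \<in> multiring_spec A" "F \<in> carrier (K A p)"
  obtains x y where "x \<in> carrier A" "y \<in> carrier A - p" "F = K_frac A p x y"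
  using assms K_carrier by blast

lemma K_zero: "\<zero>\<^bsub>K A p\<^esub> = K_frac A p \<zero> \<one>"
  by (simp add: K_def fractions_def Let_def K_frac_def quotient_simps)

lemma K_one: "\<one>\<^bsub>K A p\<^esub> = K_frac A p \<one> \<one>"
  by (simp add: K_def fractions_def Let_def K_frac_def quotient_simps)

lemma K_frac_repr:
  assumes p: "p \<in> multiring_spec A" and c: "x \<in> carrier A" "y \<in> carrier A - p"
    and "(X, Y) \<in> K_frac A p x y"
  obtains a b where "a \<in> carrier A" "b \<in> carrier A - p" "X = residue_class A p a"
    "Y = residue_class A p b" "K_frac A p x y = K_frac A p a b"
proof -
  obtain a b where *: "a \<in> carrier A" "b \<in> carrier A - p" "X = residue_class A p a"
    "Y = residue_class A p b" "frac_eq A p x y a b"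
    using assms(4) K_frac_mem_iff[OF p c(1)] c(2) by auto
  then show thesis using that K_frac_eq_iff[OF p c *(1,2)] by blast
qed

lemma K_frac_self:
  assumes p: "p \<in> multiring_spec A" and c: "x \<in> carrier A" "y \<in> carrier A - p"
  shows "(residue_class A p x, residue_class A p y) \<in> K_frac A p x y"
  using c frac_eq_refl[OF p c(1), of y] by (subst K_frac_mem_iff[OF p]) auto

lemma K_frac_mult_cong:
  assumes p: "p \<in> multiring_spec A" and c: "x \<in> carrier A" "y \<in> carrier A - p"
    "x' \<in> carrier A" "y' \<in> carrier A - p" "a \<in> carrier A" "b \<in> carrier A - p"
    and e: "K_frac A p x y = K_frac A p x' y'"
  shows "K_frac A p (x \<otimes> a) (y \<otimes> b) = K_frac A p (x' \<otimes> a) (y' \<otimes> b)"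
proof -
  obtain u where u: "u \<in> carrier A - p" "congruent_mod A p (x \<otimes> y' \<otimes> u) (x' \<otimes> y \<otimes> u)"
    using e unfolding K_frac_eq_iff[OF p c(1-4)] frac_eq_def by blast
  have "congruent_mod A p (x \<otimes> y' \<otimes> u \<otimes> (a \<otimes> b)) (x' \<otimes> y \<otimes> u \<otimes> (a \<otimes> b))"
    using congruent_mult[OF p _ _ u(2), of "a \<otimes> b"] c u by simp
  moreover have "x \<otimes> y' \<otimes> u \<otimes> (a \<otimes> b) = x \<otimes> a \<otimes> (y' \<otimes> b) \<otimes> u"
    "x' \<otimes> y \<otimes> u \<otimes> (a \<otimes> b) = x' \<otimes> a \<otimes> (y \<otimes> b) \<otimes> u" using c u by (simp_all add: m_ac)
  ultimately have "frac_eq A p (x \<otimes> a) (y \<otimes> b) (x' \<otimes> a) (y' \<otimes> b)"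
    using u(1) unfolding frac_eq_def by auto
  then show ?thesis
    using K_frac_eq_iff[OF p] spec_mult_notin[OF p] c by simp
qed

lemma K_mult:
  assumes p: "p \<in> multiring_spec A" and c: "x \<in> carrier A" "y \<in> carrier A - p"
    "x' \<in> carrier A" "y' \<in> carrier A - p"
  shows "K_frac A p x y \<otimes>\<^bsub>K A p\<^esub> K_frac A p x' y' = K_frac A p (x \<otimes> x') (y \<otimes> y')"
proof -
  let ?q = "quotient_multiring A p"
  define f where "f a b s t = fraction_class ?q (nonzero ?q) (a \<otimes>\<^bsub>?q\<^esub> b) (s \<otimes>\<^bsub>?q\<^esub> t)" for a b s t
  have f: "f (residue_class A p a) (residue_class A p b) (residue_class A p s) (residue_class A p t)
      = K_frac A p (a \<otimes> b) (s \<otimes> t)"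
    if "a \<in> carrier A" "b \<in> carrier A" "s \<in> carrier A - p" "t \<in> carrier A - p" for a b s t
    using that by (simp add: f_def quotient_mult p K_frac_def)
  have val: "f X X' Y Y' = K_frac A p (x \<otimes> x') (y \<otimes> y')"
    if X: "(X, Y) \<in> K_frac A p x y" and X': "(X', Y') \<in> K_frac A p x' y'" for X Y X' Y'
  proof -
    obtain a b where ab: "a \<in> carrier A" "b \<in> carrier A - p" "X = residue_class A p a"
      "Y = residue_class A p b" "K_frac A p x y = K_frac A p a b"
      using K_frac_repr[OF p c(1,2) X] by blast
    obtain a' b' where ab': "a' \<in> carrier A" "b' \<in> carrier A - p" "X' = residue_class A p a'"
      "Y' = residue_class A p b'" "K_frac A p x' y' = K_frac A p a' b'"
      using K_frac_repr[OF p c(3,4) X'] by blast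
    have "f X X' Y Y' = K_frac A p (a \<otimes> a') (b \<otimes> b')" using ab ab' f by simp
    also have "\<dots> = K_frac A p (x \<otimes> a') (y \<otimes> b')"
      using K_frac_mult_cong[OF p c(1,2) ab(1,2) ab'(1,2) ab(5)] by simp
    also have "\<dots> = K_frac A p (x \<otimes> x') (y \<otimes> y')"
      using K_frac_mult_cong[OF p c(3,4) ab'(1,2) c(1,2) ab'(5)] c ab' by (simp add: m_comm)
    finally show ?thesis .
  qed
  have "(\<Union>w'\<in>K_frac A p x' y'. f (fst w) (fst w') (snd w) (snd w')) = K_frac A p (x \<otimes> x') (y \<otimes> y')"
    if "w \<in> K_frac A p x y" for w
    by (rule UN_eq_const[OF K_frac_self[OF p c(3,4)]]) (use val that in auto)
  then have "(\<Union>w\<in>K_frac A p x y. \<Union>w'\<in>K_frac A p x' y'. f (fst w) (fst w') (snd w) (snd w')) =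
      K_frac A p (x \<otimes> x') (y \<otimes> y')"
    by (rule UN_eq_const[OF K_frac_self[OF p c(1,2)]])
  then show ?thesis by (simp add: K_def fractions_def Let_def f_def case_prod_beta)
qed

lemma K_neg:
  assumes p: "p \<in> multiring_spec A" and c: "x \<in> carrier A" "y \<in> carrier A - p"
  shows "\<boxminus>\<^bsub>K A p\<^esub> K_frac A p x y = K_frac A p (\<boxminus> x) y"
proof -
  let ?q = "quotient_multiring A p"
  define f where "f a s = fraction_class ?q (nonzero ?q) (\<boxminus>\<^bsub>?q\<^esub> a) s" for a s
  have val: "f X Y = K_frac A p (\<boxminus> x) y"
    if X: "(X, Y) \<in> K_frac A p x y" for X Y
  proof -
    obtain a b where ab: "a \<in> carrier A" "b \<in> carrier A - p" "X = residue_class A p a"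
      "Y = residue_class A p b" "K_frac A p x y = K_frac A p a b"
      using K_frac_repr[OF p c(1,2) X] by blast
    have o: "\<one> \<in> carrier A - p" using specD(3)[OF p] by simp
    have "f X Y = K_frac A p (\<boxminus> a) b" using ab by (simp add: f_def quotient_neg p K_frac_def)
    also have "\<dots> = K_frac A p (\<boxminus> x) y"
      using K_frac_mult_cong[OF p c ab(1,2) neg_closed[OF one_closed] o ab(5)] c ab
      by (simp add: mult_neg)
    finally show ?thesis .
  qed
  have "(\<Union>w\<in>K_frac A p x y. f (fst w) (snd w)) = K_frac A p (\<boxminus> x) y"
    by (rule UN_eq_const[OF K_frac_self[OF p c]]) (use val in auto)
  then show ?thesis by (simp add: K_def fractions_def Let_def f_def case_prod_beta)
qed

text \<open>Sums in the residue multiring are exactly the images of sums in \<open>A\<close> over a common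
  denominator.\<close>

lemma K_add_iff:
  assumes p: "p \<in> multiring_spec A" and c: "F \<in> carrier (K A p)" "G \<in> carrier (K A p)"
    "H \<in> carrier (K A p)"
  shows "F \<in> G \<boxplus>\<^bsub>K A p\<^esub> H \<longleftrightarrow> (\<exists>x\<in>carrier A. \<exists>y\<in>carrier A. \<exists>z\<in>carrier A. \<exists>d\<in>carrier A - p.
    F = K_frac A p x d \<and> G = K_frac A p y d \<and> H = K_frac A p z d \<and> x \<in> y \<boxplus> z)" (is "?L \<longleftrightarrow> ?R")
proof -
  let ?q = "quotient_multiring A p" and ?N = "nonzero (quotient_multiring A p)"
  let ?r = "residue_class A p"
  have L: "?L \<longleftrightarrow> (\<exists>(a, s)\<in>F. \<exists>(b, t)\<in>G. \<exists>(e, u)\<in>H. \<exists>v\<in>?N.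
       a \<otimes>\<^bsub>?q\<^esub> t \<otimes>\<^bsub>?q\<^esub> u \<otimes>\<^bsub>?q\<^esub> v \<in> (b \<otimes>\<^bsub>?q\<^esub> s \<otimes>\<^bsub>?q\<^esub> u \<otimes>\<^bsub>?q\<^esub> v) \<boxplus>\<^bsub>?q\<^esub> (e \<otimes>\<^bsub>?q\<^esub> s \<otimes>\<^bsub>?q\<^esub> t \<otimes>\<^bsub>?q\<^esub> v))"
    using c(1) by (auto simp: K_def fractions_def Let_def)
  obtain x y where F: "x \<in> carrier A" "y \<in> carrier A - p" "F = K_frac A p x y"
    using K_cases[OF p c(1)] by blast
  obtain x' y' where G: "x' \<in> carrier A" "y' \<in> carrier A - p" "G = K_frac A p x' y'"
    using K_cases[OF p c(2)] by blast
  obtain x'' y'' where H: "x'' \<in> carrier A" "y'' \<in> carrier A - p" "H = K_frac A p x'' y''"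
    using K_cases[OF p c(3)] by blast
  show ?thesis
  proof
    assume ?L
    then obtain a s b t e u v where m: "(a, s) \<in> F" "(b, t) \<in> G" "(e, u) \<in> H" "v \<in> ?N"
      and sum: "a \<otimes>\<^bsub>?q\<^esub> t \<otimes>\<^bsub>?q\<^esub> u \<otimes>\<^bsub>?q\<^esub> v \<in> (b \<otimes>\<^bsub>?q\<^esub> s \<otimes>\<^bsub>?q\<^esub> u \<otimes>\<^bsub>?q\<^esub> v) \<boxplus>\<^bsub>?q\<^esub> (e \<otimes>\<^bsub>?q\<^esub> s \<otimes>\<^bsub>?q\<^esub> t \<otimes>\<^bsub>?q\<^esub> v)"
      unfolding L by auto
    obtain a1 s1 where 1: "a1 \<in> carrier A" "s1 \<in> carrier A - p" "a = ?r a1" "s = ?r s1"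
      "F = K_frac A p a1 s1" using K_frac_repr[OF p F(1,2)] m(1) F(3) by metis
    obtain b1 t1 where 2: "b1 \<in> carrier A" "t1 \<in> carrier A - p" "b = ?r b1" "t = ?r t1"
      "G = K_frac A p b1 t1" using K_frac_repr[OF p G(1,2)] m(2) G(3) by metis
    obtain e1 u1 where 3: "e1 \<in> carrier A" "u1 \<in> carrier A - p" "e = ?r e1" "u = ?r u1"
      "H = K_frac A p e1 u1" using K_frac_repr[OF p H(1,2)] m(3) H(3) by metis
    obtain v1 where 4: "v1 \<in> carrier A - p" "v = ?r v1" using m(4) by (auto simp: nonzero_quotient p)
    have cl: "a1 \<otimes> t1 \<otimes> u1 \<otimes> v1 \<in> carrier A" "b1 \<otimes> s1 \<otimes> u1 \<otimes> v1 \<in> carrier A"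
      "e1 \<otimes> s1 \<otimes> t1 \<otimes> v1 \<in> carrier A" using 1 2 3 4 by auto
    have "?r (a1 \<otimes> t1 \<otimes> u1 \<otimes> v1) \<in> ?r (b1 \<otimes> s1 \<otimes> u1 \<otimes> v1) \<boxplus>\<^bsub>?q\<^esub> ?r (e1 \<otimes> s1 \<otimes> t1 \<otimes> v1)"
      using sum 1 2 3 4 by (simp add: quotient_mult p)
    then obtain x1 y1 z1 where 5: "x1 \<in> carrier A" "y1 \<in> carrier A" "z1 \<in> carrier A"
      "x1 \<in> y1 \<boxplus> z1" "?r (a1 \<otimes> t1 \<otimes> u1 \<otimes> v1) = ?r x1" "?r (b1 \<otimes> s1 \<otimes> u1 \<otimes> v1) = ?r y1"
      "?r (e1 \<otimes> s1 \<otimes> t1 \<otimes> v1) = ?r z1"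
      using quotient_add_iff[OF p, of "?r (a1 \<otimes> t1 \<otimes> u1 \<otimes> v1)" "?r (b1 \<otimes> s1 \<otimes> u1 \<otimes> v1)"
        "?r (e1 \<otimes> s1 \<otimes> t1 \<otimes> v1)"] cl unfolding quotient_simps by blast
    define d where "d = s1 \<otimes> t1 \<otimes> u1 \<otimes> v1"
    have d: "d \<in> carrier A - p"
      unfolding d_def by (intro spec_mult_notin[OF p] 1(2) 2(2) 3(2) 4(1))
    have n: "t1 \<otimes> u1 \<otimes> v1 \<in> carrier A - p" "s1 \<otimes> u1 \<otimes> v1 \<in> carrier A - p"
      "s1 \<otimes> t1 \<otimes> v1 \<in> carrier A - p"
      by (intro spec_mult_notin[OF p] 1(2) 2(2) 3(2) 4(1))+
    have "F = K_frac A p (a1 \<otimes> (t1 \<otimes> u1 \<otimes> v1)) (s1 \<otimes> (t1 \<otimes> u1 \<otimes> v1))"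
      using K_frac_expand[OF p 1(1,2) n(1)] 1 by simp
    moreover have "a1 \<otimes> (t1 \<otimes> u1 \<otimes> v1) = a1 \<otimes> t1 \<otimes> u1 \<otimes> v1" "s1 \<otimes> (t1 \<otimes> u1 \<otimes> v1) = d"
      using 1 2 3 4 by (auto simp: d_def m_ac)
    ultimately have "F = K_frac A p x1 d" using 5(5) by (simp add: K_frac_def)
    moreover have "G = K_frac A p (b1 \<otimes> (s1 \<otimes> u1 \<otimes> v1)) (t1 \<otimes> (s1 \<otimes> u1 \<otimes> v1))"
      using K_frac_expand[OF p 2(1,2) n(2)] 2 by simp
    moreover have "b1 \<otimes> (s1 \<otimes> u1 \<otimes> v1) = b1 \<otimes> s1 \<otimes> u1 \<otimes> v1" "t1 \<otimes> (s1 \<otimes> u1 \<otimes> v1) = d"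
      using 1 2 3 4 by (auto simp: d_def m_ac)
    ultimately have "F = K_frac A p x1 d" "G = K_frac A p y1 d" using 5(6) by (simp_all add: K_frac_def)
    moreover have "H = K_frac A p (e1 \<otimes> (s1 \<otimes> t1 \<otimes> v1)) (u1 \<otimes> (s1 \<otimes> t1 \<otimes> v1))"
      using K_frac_expand[OF p 3(1,2) n(3)] 3 by simp
    moreover have "e1 \<otimes> (s1 \<otimes> t1 \<otimes> v1) = e1 \<otimes> s1 \<otimes> t1 \<otimes> v1" "u1 \<otimes> (s1 \<otimes> t1 \<otimes> v1) = d"
      using 1 2 3 4 by (auto simp: d_def m_ac)
    ultimately have "H = K_frac A p z1 d" using 5(7) by (simp add: K_frac_def)
    then show ?R using \<open>F = K_frac A p x1 d\<close> \<open>G = K_frac A p y1 d\<close> 5 d by blast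
  next
    assume ?R
    then obtain x y z d where *: "x \<in> carrier A" "y \<in> carrier A" "z \<in> carrier A" "d \<in> carrier A - p"
      "F = K_frac A p x d" "G = K_frac A p y d" "H = K_frac A p z d" "x \<in> y \<boxplus> z" by blast
    have m: "(?r x, ?r d) \<in> F" "(?r y, ?r d) \<in> G" "(?r z, ?r d) \<in> H" "?r \<one> \<in> ?N"
      using * K_frac_self[OF p] specD(3)[OF p] by (auto simp: nonzero_quotient p)
    have "x \<otimes> d \<otimes> d \<otimes> \<one> \<in> (y \<otimes> d \<otimes> d \<otimes> \<one>) \<boxplus> (z \<otimes> d \<otimes> d \<otimes> \<one>)"
      using mult_distrib[OF *(1-3) _ *(8), of "d \<otimes> d"] *(1-4) by (simp add: m_assoc)
    then have "?r (x \<otimes> d \<otimes> d \<otimes> \<one>) \<in> ?r (y \<otimes> d \<otimes> d \<otimes> \<one>) \<boxplus>\<^bsub>?q\<^esub> ?r (z \<otimes> d \<otimes> d \<otimes> \<one>)"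
      using quotient_add_iff[OF p, of "?r (x \<otimes> d \<otimes> d \<otimes> \<one>)" "?r (y \<otimes> d \<otimes> d \<otimes> \<one>)"
        "?r (z \<otimes> d \<otimes> d \<otimes> \<one>)"] *(1-4) by auto
    moreover have "?r (w \<otimes> d \<otimes> d \<otimes> \<one>) = ?r w \<otimes>\<^bsub>?q\<^esub> ?r d \<otimes>\<^bsub>?q\<^esub> ?r d \<otimes>\<^bsub>?q\<^esub> ?r \<one>"
      if "w \<in> carrier A" for w using that *(4) quotient_mult[OF p] by simp
    ultimately show ?L unfolding L using m *(1-3) by (metis (no_types, lifting) case_prodI)
  qed
qed

lemma K_addI:
  assumes "p \<in> multiring_spec A" "x \<in> y \<boxplus> z" "y \<in> carrier A" "z \<in> carrier A" "d \<in> carrier A - p"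
  shows "K_frac A p x d \<in> K_frac A p y d \<boxplus>\<^bsub>K A p\<^esub> K_frac A p z d"
  using K_add_iff[OF assms(1)] K_frac_closed[OF assms(1)] add_mem_carrier[OF assms(2-4)] assms(2-5)
  by blast

lemma K_add_closed: "G \<boxplus>\<^bsub>K A p\<^esub> H \<subseteq> carrier (K A p)"
  by (auto simp: K_def fractions_def Let_def)

text \<open>The fraction for the first summand can be prescribed up to expansion: the discrepancy between
  two fractions for it is an error term, which the second summand absorbs.\<close>

lemma K_add_rebase:
  assumes p: "p \<in> multiring_spec A" and c: "H \<in> carrier (K A p)" "b \<in> carrier A" "t \<in> carrier A - p"
    and F: "F \<in> K_frac A p b t \<boxplus>\<^bsub>K A p\<^esub> H"
  obtains x w z where "x \<in> carrier A" "w \<in> carrier A" "z \<in> carrier A - p" "x \<in> (b \<otimes> z) \<boxplus> w"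
    "F = K_frac A p x (t \<otimes> z)" "H = K_frac A p w (t \<otimes> z)"
proof -
  have "F \<in> carrier (K A p)" using K_add_closed F by blast
  then obtain x0 y0 z0 d where 0: "x0 \<in> carrier A" "y0 \<in> carrier A" "z0 \<in> carrier A" "d \<in> carrier A - p"
    "F = K_frac A p x0 d" "K_frac A p b t = K_frac A p y0 d" "H = K_frac A p z0 d" "x0 \<in> y0 \<boxplus> z0"
    using K_add_iff[OF p _ K_frac_closed[OF p c(2,3)] c(1), of F] F by blast
  then obtain u where u: "u \<in> carrier A - p" "congruent_mod A p (b \<otimes> d \<otimes> u) (y0 \<otimes> t \<otimes> u)"
    using K_frac_eq_iff[OF p c(2,3) 0(2,4)] unfolding frac_eq_def by blast
  have "congruent_mod A p (y0 \<otimes> t \<otimes> u) (b \<otimes> d \<otimes> u)" using congruent_sym[OF p _ u(2)] 0 c u by simp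
  then obtain i where i: "i \<in> p" "y0 \<otimes> t \<otimes> u \<in> (b \<otimes> d \<otimes> u) \<boxplus> i" unfolding congruent_mod_def by blast
  have ic: "i \<in> carrier A" using i specD(1)[OF p] by blast
  have "x0 \<otimes> (t \<otimes> u) \<in> (y0 \<otimes> (t \<otimes> u)) \<boxplus> (z0 \<otimes> (t \<otimes> u))"
    using mult_distrib[OF 0(1-3) _ 0(8), of "t \<otimes> u"] c u by simp
  then have 1: "x0 \<otimes> (t \<otimes> u) \<in> (y0 \<otimes> t \<otimes> u) \<boxplus> (z0 \<otimes> (t \<otimes> u))" using 0 c u by (simp add: m_assoc)
  obtain w where w: "w \<in> i \<boxplus> (z0 \<otimes> (t \<otimes> u))" "x0 \<otimes> (t \<otimes> u) \<in> (b \<otimes> d \<otimes> u) \<boxplus> w"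
    using add_assoc[OF _ ic _ i(2) 1] 0 c u by auto
  have wc: "w \<in> carrier A" using add_mem_carrier[OF w(1) ic] 0 c u by simp
  have "w \<in> (z0 \<otimes> (t \<otimes> u)) \<boxplus> i" using w(1) add_commute[OF ic, of "z0 \<otimes> (t \<otimes> u)"] 0 c u by simp
  then have "congruent_mod A p w (z0 \<otimes> (t \<otimes> u))" using i(1) unfolding congruent_mod_def by blast
  then have rw: "residue_class A p w = residue_class A p (z0 \<otimes> (t \<otimes> u))"
    using wc 0 c u by (simp add: residue_class_eq_iff p)
  have tu: "t \<otimes> u \<in> carrier A - p" and du: "d \<otimes> u \<in> carrier A - p"
    using spec_mult_notin[OF p] c u 0 by auto
  have eq: "d \<otimes> (t \<otimes> u) = t \<otimes> (d \<otimes> u)" using 0 c u by (simp add: m_ac)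
  have "F = K_frac A p (x0 \<otimes> (t \<otimes> u)) (t \<otimes> (d \<otimes> u))"
    using K_frac_expand[OF p 0(1,4) tu] 0(5) eq by simp
  moreover have "H = K_frac A p w (t \<otimes> (d \<otimes> u))"
    using K_frac_expand[OF p 0(3,4) tu] 0(7) eq rw by (simp add: K_frac_def)
  moreover have "x0 \<otimes> (t \<otimes> u) \<in> (b \<otimes> (d \<otimes> u)) \<boxplus> w" using w(2) 0 c u by (simp add: m_assoc)
  moreover have "x0 \<otimes> (t \<otimes> u) \<in> carrier A" using 0 c u by simp
  ultimately show thesis using that[OF _ wc du] by blast
qed

text \<open>Associativity: the inner sum is written over a common denominator, the outer sum is rebased
  to the resulting fraction for its first summand, and associativity in \<open>A\<close> applies.\<close>

theorem multiring_K:
  assumes p: "p \<in> multiring_spec A"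
  shows "multiring (K A p)"
proof -
  note S = specD[OF p]
  have one: "\<one> \<in> carrier A - p" using S(3) by simp
  note nm = spec_mult_notin[OF p]
  note Kc = K_cases[OF p]
  have comm: "X \<in> G \<boxplus>\<^bsub>K A p\<^esub> F" if FG: "F \<in> carrier (K A p)" "G \<in> carrier (K A p)" "X \<in> F \<boxplus>\<^bsub>K A p\<^esub> G" for F G X
  proof -
    have X: "X \<in> carrier (K A p)" using FG(3) K_add_closed by blast
    obtain x y z d where *: "x \<in> carrier A" "y \<in> carrier A" "z \<in> carrier A" "d \<in> carrier A - p"
      "X = K_frac A p x d" "F = K_frac A p y d" "G = K_frac A p z d" "x \<in> y \<boxplus> z"
      using FG(3) K_add_iff[OF p X FG(1,2)] by blast
    then show ?thesis using K_addI[OF p add_commute_mem[OF *(8,2,3)] *(3,2,4)] by simp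
  qed
  show ?thesis
  proof (unfold_locales)
    fix F G H assume c: "F \<in> carrier (K A p)" "G \<in> carrier (K A p)" "H \<in> carrier (K A p)"
    then show "F \<otimes>\<^bsub>K A p\<^esub> G \<otimes>\<^bsub>K A p\<^esub> H = F \<otimes>\<^bsub>K A p\<^esub> (G \<otimes>\<^bsub>K A p\<^esub> H)"
      by (elim Kc) (use nm in \<open>auto simp: K_mult p m_assoc\<close>)
    assume F: "F \<in> G \<boxplus>\<^bsub>K A p\<^esub> H"
    obtain x y z d where *: "x \<in> carrier A" "y \<in> carrier A" "z \<in> carrier A" "d \<in> carrier A - p"
      "F = K_frac A p x d" "G = K_frac A p y d" "H = K_frac A p z d" "x \<in> y \<boxplus> z"
      using F K_add_iff[OF p c] by blast
    show "H \<in> \<boxminus>\<^bsub>K A p\<^esub> G \<boxplus>\<^bsub>K A p\<^esub> F \<and> G \<in> F \<boxplus>\<^bsub>K A p\<^esub> \<boxminus>\<^bsub>K A p\<^esub> H"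
      using K_addI[OF p, of z "\<boxminus> y" x d] K_addI[OF p, of y x "\<boxminus> z" d] add_reversible[OF *(1-3,8)] *
      by (simp add: K_neg p neg_closed)
    fix D assume "D \<in> carrier (K A p)"
    then obtain a b where D: "a \<in> carrier A" "b \<in> carrier A - p" "D = K_frac A p a b" by (rule Kc)
    show "F \<otimes>\<^bsub>K A p\<^esub> D \<in> G \<otimes>\<^bsub>K A p\<^esub> D \<boxplus>\<^bsub>K A p\<^esub> H \<otimes>\<^bsub>K A p\<^esub> D"
      using K_addI[OF p mult_distrib[OF *(1-3) D(1) *(8)], of "d \<otimes> b"] * D nm by (simp add: K_mult p)
  next
    fix F G assume c: "F \<in> carrier (K A p)" "G \<in> carrier (K A p)"
    show "F \<boxplus>\<^bsub>K A p\<^esub> G = G \<boxplus>\<^bsub>K A p\<^esub> F" using comm c by blast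
    show "F \<boxplus>\<^bsub>K A p\<^esub> G \<subseteq> carrier (K A p)" by (rule K_add_closed)
    show "F \<otimes>\<^bsub>K A p\<^esub> G = G \<otimes>\<^bsub>K A p\<^esub> F"
      using c by (elim Kc) (auto simp: K_mult p m_comm)
    show "F \<otimes>\<^bsub>K A p\<^esub> G \<in> carrier (K A p)"
      using c by (elim Kc) (use nm in \<open>auto simp: K_mult p intro!: K_frac_closed\<close>)
    obtain x y where F: "x \<in> carrier A" "y \<in> carrier A - p" "F = K_frac A p x y" using c(1) by (rule Kc)
    obtain x' y' where G: "x' \<in> carrier A" "y' \<in> carrier A - p" "G = K_frac A p x' y'"
      using c(2) by (rule Kc)
    obtain z where z: "z \<in> (x \<otimes> y') \<boxplus> (x' \<otimes> y)" using add_nonempty[of "x \<otimes> y'" "x' \<otimes> y"] F G by auto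
    have "F = K_frac A p (x \<otimes> y') (y \<otimes> y')" "G = K_frac A p (x' \<otimes> y) (y \<otimes> y')"
      using K_frac_expand[OF p F(1,2) G(2)] K_frac_expand[OF p G(1,2) F(2)] F G m_comm[of y y'] by auto
    then show "F \<boxplus>\<^bsub>K A p\<^esub> G \<noteq> {}" using K_addI[OF p z, of "y \<otimes> y'"] F G nm by auto
    show "F \<in> G \<boxplus>\<^bsub>K A p\<^esub> \<zero>\<^bsub>K A p\<^esub> \<longleftrightarrow> F = G"
    proof
      assume "F = G"
      then have "F = K_frac A p x' y'" "\<zero>\<^bsub>K A p\<^esub> = K_frac A p \<zero> y'"
        using G K_frac_zero[OF p, of y'] by (auto simp: K_zero)
      then show "F \<in> G \<boxplus>\<^bsub>K A p\<^esub> \<zero>\<^bsub>K A p\<^esub>"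
        using K_addI[OF p _ G(1) zero_closed G(2), of x'] add_zero[OF G(1,1)] G by simp
    next
      assume "F \<in> G \<boxplus>\<^bsub>K A p\<^esub> \<zero>\<^bsub>K A p\<^esub>"
      then have "F \<in> K_frac A p \<zero> \<one> \<boxplus>\<^bsub>K A p\<^esub> G"
        using comm[OF c(2) K_frac_closed[OF p zero_closed one]] by (simp add: K_zero)
      then obtain x w z where *: "x \<in> carrier A" "w \<in> carrier A" "z \<in> carrier A - p"
        "x \<in> (\<zero> \<otimes> z) \<boxplus> w" "F = K_frac A p x (\<one> \<otimes> z)" "G = K_frac A p w (\<one> \<otimes> z)"
        using K_add_rebase[OF p c(2) zero_closed one] by metis
      then show "F = G" using zero_add[OF *(1,2)] by simp
    qed
  next
    fix F G H X Y assume c: "F \<in> carrier (K A p)" "G \<in> carrier (K A p)" "H \<in> carrier (K A p)"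
      and X: "X \<in> F \<boxplus>\<^bsub>K A p\<^esub> G" and Y: "Y \<in> X \<boxplus>\<^bsub>K A p\<^esub> H"
    have Xc: "X \<in> carrier (K A p)" using X K_add_closed by blast
    obtain x y z d where *: "x \<in> carrier A" "y \<in> carrier A" "z \<in> carrier A" "d \<in> carrier A - p"
      "X = K_frac A p x d" "F = K_frac A p y d" "G = K_frac A p z d" "x \<in> y \<boxplus> z"
      using X K_add_iff[OF p Xc c(1,2)] by blast
    have "Y \<in> K_frac A p x d \<boxplus>\<^bsub>K A p\<^esub> H" using Y *(5) by simp
    then obtain a w u where **: "a \<in> carrier A" "w \<in> carrier A" "u \<in> carrier A - p"
      "a \<in> (x \<otimes> u) \<boxplus> w" "Y = K_frac A p a (d \<otimes> u)" "H = K_frac A p w (d \<otimes> u)"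
      by (rule K_add_rebase[OF p c(3) *(1,4)])
    have uc: "u \<in> carrier A" using ** by simp
    have "x \<otimes> u \<in> (y \<otimes> u) \<boxplus> (z \<otimes> u)" using mult_distrib[OF *(1-3) uc *(8)] .
    then obtain h where h: "h \<in> (z \<otimes> u) \<boxplus> w" "a \<in> (y \<otimes> u) \<boxplus> h"
      using add_assoc[of "y \<otimes> u" "z \<otimes> u" w "x \<otimes> u" a] * ** uc by auto
    have hc: "h \<in> carrier A" using add_mem_carrier[OF h(1)] *(3) uc **(2) by simp
    have du: "d \<otimes> u \<in> carrier A - p" using nm * ** by blast
    have "F = K_frac A p (y \<otimes> u) (d \<otimes> u)" "G = K_frac A p (z \<otimes> u) (d \<otimes> u)"
      using K_frac_expand[OF p _ *(4) **(3)] * by auto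
    then have "K_frac A p h (d \<otimes> u) \<in> G \<boxplus>\<^bsub>K A p\<^esub> H" "Y \<in> F \<boxplus>\<^bsub>K A p\<^esub> K_frac A p h (d \<otimes> u)"
      using K_addI[OF p h(1) _ **(2) du] K_addI[OF p h(2) _ hc du] * ** uc by auto
    then show "\<exists>Z\<in>G \<boxplus>\<^bsub>K A p\<^esub> H. Y \<in> F \<boxplus>\<^bsub>K A p\<^esub> Z" by blast
  next
    fix F assume "F \<in> carrier (K A p)"
    then obtain x y where F: "x \<in> carrier A" "y \<in> carrier A - p" "F = K_frac A p x y" by (rule Kc)
    show "F \<otimes>\<^bsub>K A p\<^esub> \<zero>\<^bsub>K A p\<^esub> = \<zero>\<^bsub>K A p\<^esub>"
      using F one K_frac_zero[OF p F(2)] by (simp add: K_zero K_mult p zero_closed mult_zero)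
    show "\<boxminus>\<^bsub>K A p\<^esub> F \<in> carrier (K A p)"
      using F by (simp add: K_neg p K_frac_closed neg_closed)
    show "\<one>\<^bsub>K A p\<^esub> \<otimes>\<^bsub>K A p\<^esub> F = F" using F one by (simp add: K_one K_mult p)
    show "F \<otimes>\<^bsub>K A p\<^esub> \<one>\<^bsub>K A p\<^esub> = F" using F one by (simp add: K_one K_mult p)
  qed (use one zero_closed in \<open>auto simp: K_zero K_one intro!: K_frac_closed[OF p]\<close>)
qed

end

section \<open>The constructible topology\<close>

text \<open>The sets of primes that omit one element and contain finitely many are a basis of clopen
  sets. \<open>near A p P\<close> says that \<open>P\<close> holds on such a neighbourhood of \<open>p\<close>; unlike an arbitrary open
  set, its description by elements can be moved along a morphism.\<close>

definition near :: "'a multiring \<Rightarrow> 'a set \<Rightarrow> ('a set \<Rightarrow> bool) \<Rightarrow> bool" where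
  "near A p P \<longleftrightarrow> (\<exists>a\<in>carrier A. \<exists>B. finite B \<and> B \<subseteq> carrier A \<and> a \<notin> p \<and> B \<subseteq> p \<and>
     (\<forall>q\<in>multiring_spec A. a \<notin> q \<longrightarrow> B \<subseteq> q \<longrightarrow> P q))"

lemma nearE:
  assumes "near A p P"
  obtains a B where "a \<in> carrier A" "finite B" "B \<subseteq> carrier A" "a \<notin> p" "B \<subseteq> p"
    "\<And>q. q \<in> multiring_spec A \<Longrightarrow> a \<notin> q \<Longrightarrow> B \<subseteq> q \<Longrightarrow> P q"
proof -
  from assms obtain a B where "a \<in> carrier A" and B: "finite B \<and> B \<subseteq> carrier A \<and> a \<notin> p \<and>
      B \<subseteq> p \<and> (\<forall>q\<in>multiring_spec A. a \<notin> q \<longrightarrow> B \<subseteq> q \<longrightarrow> P q)"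
    unfolding near_def by (elim bexE exE)
  then show thesis by (intro that[of a B]) simp_all
qed

context multiring
begin

lemma specI:
  assumes "p \<subseteq> carrier A" "\<zero> \<in> p" "\<one> \<notin> p"
    and "\<And>a b. a \<in> p \<Longrightarrow> b \<in> p \<Longrightarrow> a \<boxplus> b \<subseteq> p"
    and "\<And>a b. a \<in> carrier A \<Longrightarrow> b \<in> p \<Longrightarrow> a \<otimes> b \<in> p"
    and "\<And>a b. \<lbrakk>a \<in> carrier A; b \<in> carrier A; a \<otimes> b \<in> p\<rbrakk> \<Longrightarrow> a \<in> p \<or> b \<in> p"
  shows "p \<in> multiring_spec A"
  unfolding multiring_spec_def multiring_ideal_def
  by (intro CollectI conjI ballI impI) (use assms in \<open>simp_all, auto\<close>)

lemma near_mono: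
  "\<lbrakk>near A p P; \<And>q. q \<in> multiring_spec A \<Longrightarrow> P q \<Longrightarrow> R q\<rbrakk> \<Longrightarrow> near A p R"
  unfolding near_def by meson

lemma near_self: "\<lbrakk>near A p P; p \<in> multiring_spec A\<rbrakk> \<Longrightarrow> P p"
  unfolding near_def by blast

lemma near_conj:
  assumes p: "p \<in> multiring_spec A" and "near A p P" "near A p R"
  shows "near A p (\<lambda>q. P q \<and> R q)"
proof -
  obtain a B where a: "a \<in> carrier A" "finite B" "B \<subseteq> carrier A" "a \<notin> p" "B \<subseteq> p"
    "\<And>q. q \<in> multiring_spec A \<Longrightarrow> a \<notin> q \<Longrightarrow> B \<subseteq> q \<Longrightarrow> P q"
    using assms(2) by (rule nearE) (rule that)
  obtain b C where b: "b \<in> carrier A" "finite C" "C \<subseteq> carrier A" "b \<notin> p" "C \<subseteq> p"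
    "\<And>q. q \<in> multiring_spec A \<Longrightarrow> b \<notin> q \<Longrightarrow> C \<subseteq> q \<Longrightarrow> R q"
    using assms(3) by (rule nearE) (rule that)
  have "P q \<and> R q" if q: "q \<in> multiring_spec A" "a \<otimes> b \<notin> q" "B \<union> C \<subseteq> q" for q
    using specD(5,6)[OF q(1)] a(1,6) b(1,6) q by blast
  moreover have "a \<otimes> b \<notin> p" using specD(8)[OF p] a b by blast
  ultimately show ?thesis
    unfolding near_def using a b
    by (intro bexI[of _ "a \<otimes> b"] exI[of _ "B \<union> C"]) auto
qed

lemma near_notin: "\<lbrakk>a \<in> carrier A; a \<notin> p\<rbrakk> \<Longrightarrow> near A p (\<lambda>q. a \<notin> q)"
  unfolding near_def by (intro bexI[of _ a] exI[of _ "{}"]) auto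

lemma near_subset:
  "\<lbrakk>p \<in> multiring_spec A; finite B; B \<subseteq> p\<rbrakk> \<Longrightarrow> near A p (\<lambda>q. B \<subseteq> q)"
  unfolding near_def using specD(1,3) one_closed by blast

lemma near_UNIV: "p \<in> multiring_spec A \<Longrightarrow> (\<And>q. q \<in> multiring_spec A \<Longrightarrow> P q) \<Longrightarrow> near A p P"
  using near_mono[OF near_subset[of p "{}"]] by simp

lemma topspace_constructible [simp]: "topspace (constructible_topology A) = multiring_spec A"
proof -
  have "basic_open A \<one> = multiring_spec A" using specD(3) by (auto simp: basic_open_def)
  then show ?thesis
    unfolding constructible_topology_def topology_generated_by_topspace
    using one_closed by (auto simp: basic_open_def)
qed

lemma near_of_open:
  assumes "openin (constructible_topology A) U" "p \<in> U"
  shows "near A p (\<lambda>q. q \<in> U)"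
proof -
  have p: "p \<in> multiring_spec A" using openin_subset[OF assms(1)] assms(2) by auto
  have "generate_topology_on
    (basic_open A ` carrier A \<union> (\<lambda>a. multiring_spec A - basic_open A a) ` carrier A) U"
    using assms(1) unfolding constructible_topology_def openin_topology_generated_by_iff .
  then show ?thesis using assms(2)
  proof induction
    case Empty then show ?case by simp
  next
    case (Int U W) then show ?case using near_conj[OF p] by auto
  next
    case (UN K)
    then obtain k where "k \<in> K" "p \<in> k" by blast
    then have "near A p (\<lambda>q. q \<in> k)" using UN.IH by blast
    then show ?case by (rule near_mono) (use \<open>k \<in> K\<close> in blast)
  next
    case (Basis s)
    then consider a where "a \<in> carrier A" "s = basic_open A a"
      | a where "a \<in> carrier A" "s = multiring_spec A - basic_open A a" by blast
    then show ?case
    proof cases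
      case 1
      then show ?thesis
        using near_mono[OF near_notin[of a p], of "\<lambda>q. q \<in> s"] Basis by (auto simp: basic_open_def)
    next
      case 2
      then show ?thesis
        using near_mono[OF near_subset[OF p, of "{a}"], of "\<lambda>q. q \<in> s"] Basis p
        by (auto simp: basic_open_def)
    qed
  qed
qed

lemma clopen_basic_open:
  assumes "a \<in> carrier A"
  shows "openin (constructible_topology A) (basic_open A a)"
    "closedin (constructible_topology A) (basic_open A a)"
    "openin (constructible_topology A) (multiring_spec A - basic_open A a)"
    "closedin (constructible_topology A) (multiring_spec A - basic_open A a)"
proof -
  show 1: "openin (constructible_topology A) (basic_open A a)"
    and 2: "openin (constructible_topology A) (multiring_spec A - basic_open A a)"
    unfolding constructible_topology_def using assms by (auto intro!: topology_generated_by_Basis)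
  have sub: "basic_open A a \<subseteq> multiring_spec A" by (auto simp: basic_open_def)
  then show "closedin (constructible_topology A) (basic_open A a)" using 2 by (simp add: closedin_def)
  have "multiring_spec A - (multiring_spec A - basic_open A a) = basic_open A a" using sub by blast
  then show "closedin (constructible_topology A) (multiring_spec A - basic_open A a)"
    using 1 by (simp add: closedin_def)
qed

lemma near_clopen:
  assumes "near A p P" and p: "p \<in> multiring_spec A"
  obtains U where "openin (constructible_topology A) U" "closedin (constructible_topology A) U"
    "p \<in> U" "\<And>q. q \<in> U \<Longrightarrow> P q" "U \<subseteq> multiring_spec A"
proof -
  obtain a B where a: "a \<in> carrier A" "finite B" "B \<subseteq> carrier A" "a \<notin> p" "B \<subseteq> p"
    "\<And>q. q \<in> multiring_spec A \<Longrightarrow> a \<notin> q \<Longrightarrow> B \<subseteq> q \<Longrightarrow> P q"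
    using assms(1) by (rule nearE) (rule that)
  have "openin (constructible_topology A) {q \<in> multiring_spec A. a \<notin> q \<and> B \<subseteq> q} \<and>
      closedin (constructible_topology A) {q \<in> multiring_spec A. a \<notin> q \<and> B \<subseteq> q}"
    using a(2,3)
  proof (induction B)
    case empty
    have "{q \<in> multiring_spec A. a \<notin> q \<and> {} \<subseteq> q} = basic_open A a" by (auto simp: basic_open_def)
    then show ?case using clopen_basic_open[OF a(1)] by simp
  next
    case (insert b B)
    have "{q \<in> multiring_spec A. a \<notin> q \<and> insert b B \<subseteq> q} =
        {q \<in> multiring_spec A. a \<notin> q \<and> B \<subseteq> q} \<inter> (multiring_spec A - basic_open A b)"
      by (auto simp: basic_open_def)
    then show ?case using clopen_basic_open[of b] insert by (simp add: openin_Int closedin_Int)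
  qed
  then show thesis using that[of "{q \<in> multiring_spec A. a \<notin> q \<and> B \<subseteq> q}"] a p by auto
qed

text \<open>The prime ideals form a closed subset of the compact power of the two-point space, because
  each of their defining conditions constrains finitely many coordinates.\<close>

theorem compact_space_constructible: "compact_space (constructible_topology A)"
proof -
  define X where "X = product_topology (\<lambda>_. discrete_topology (UNIV :: bool set)) (carrier A)"
  have X: "compact_space X"
    by (simp add: X_def compact_space_product_topology compact_space_discrete_topology)
  have tX: "topspace X = (\<Pi>\<^sub>E a\<in>carrier A. UNIV)" by (simp add: X_def)
  define E where "E a = {x \<in> topspace X. x a}" for a
  define N where "N a = {x \<in> topspace X. \<not> x a}" for a
  have proj: "continuous_map X (discrete_topology UNIV) (\<lambda>x. x a)" if "a \<in> carrier A" for a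
    unfolding X_def using that by (rule continuous_map_product_projection)
  have cE: "closedin X (E a)" and cN: "closedin X (N a)" and oE: "openin X (E a)" and oN: "openin X (N a)"
    if "a \<in> carrier A" for a
    using closedin_continuous_map_preimage[OF proj[OF that], of "{True}"]
      closedin_continuous_map_preimage[OF proj[OF that], of "{False}"]
      openin_continuous_map_preimage[OF proj[OF that], of "{True}"]
      openin_continuous_map_preimage[OF proj[OF that], of "{False}"]
    by (simp_all add: E_def N_def)
  define F where "F x = {a \<in> carrier A. x a}" for x :: "'a \<Rightarrow> bool"
  define S where "S = {x \<in> topspace X. F x \<in> multiring_spec A}"
  define \<F> where "\<F> = {E \<zero>, N \<one>} \<union>
    {N a \<union> N b \<union> E c | a b c. a \<in> carrier A \<and> b \<in> carrier A \<and> c \<in> a \<boxplus> b} \<union>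
    {N b \<union> E (a \<otimes> b) | a b. a \<in> carrier A \<and> b \<in> carrier A} \<union>
    {N (a \<otimes> b) \<union> E a \<union> E b | a b. a \<in> carrier A \<and> b \<in> carrier A}"
  have "closedin X T" if "T \<in> \<F>" for T
    using that add_mem_carrier unfolding \<F>_def
    by (auto intro!: closedin_Un cE cN zero_closed)
  moreover have "\<F> \<noteq> {}" by (simp add: \<F>_def)
  ultimately have "closedin X (\<Inter>\<F>)" by (intro closedin_Inter) auto
  moreover have "\<Inter>\<F> = S"
  proof (rule Set.set_eqI)
    fix x
    show "x \<in> \<Inter>\<F> \<longleftrightarrow> x \<in> S"
    proof (cases "x \<in> topspace X")
      case True
      then have mem: "x \<in> E a \<longleftrightarrow> x a" "x \<in> N a \<longleftrightarrow> \<not> x a" for a by (simp_all add: E_def N_def)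
      have "x \<in> \<Inter>\<F> \<longleftrightarrow> x \<zero> \<and> \<not> x \<one> \<and>
          (\<forall>a\<in>carrier A. \<forall>b\<in>carrier A. x a \<longrightarrow> x b \<longrightarrow> (\<forall>c\<in>a \<boxplus> b. x c)) \<and>
          (\<forall>a\<in>carrier A. \<forall>b\<in>carrier A. x b \<longrightarrow> x (a \<otimes> b)) \<and>
          (\<forall>a\<in>carrier A. \<forall>b\<in>carrier A. x (a \<otimes> b) \<longrightarrow> x a \<or> x b)" (is "_ \<longleftrightarrow> ?C")
      proof
        assume x: "x \<in> \<Inter>\<F>"
        have 0: "N a \<union> N b \<union> E c \<in> \<F>" if "a \<in> carrier A" "b \<in> carrier A" "c \<in> a \<boxplus> b" for a b c
          unfolding \<F>_def using that
          by (intro UnI1[OF UnI1[OF UnI2]] CollectI exI[of _ a] exI[of _ b] exI[of _ c]) simp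
        have 1: "N b \<union> E (a \<otimes> b) \<in> \<F>" if "a \<in> carrier A" "b \<in> carrier A" for a b
          unfolding \<F>_def using that
          by (intro UnI1[OF UnI2] CollectI exI[of _ a] exI[of _ b]) simp
        have 2: "N (a \<otimes> b) \<union> E a \<union> E b \<in> \<F>" if "a \<in> carrier A" "b \<in> carrier A" for a b
          unfolding \<F>_def using that by (intro UnI2 CollectI exI[of _ a] exI[of _ b]) simp
        have "x c" if "a \<in> carrier A" "b \<in> carrier A" "x a" "x b" "c \<in> a \<boxplus> b" for a b c
          using InterD[OF x 0[OF that(1,2,5)]] that by (simp add: mem)
        then have f1: "\<forall>a\<in>carrier A. \<forall>b\<in>carrier A. x a \<longrightarrow> x b \<longrightarrow> (\<forall>c\<in>a \<boxplus> b. x c)" by blast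
        have "x \<in> E \<zero>" "x \<in> N \<one>" by (rule InterD[OF x]; simp add: \<F>_def)+
        then have f2: "x \<zero> \<and> \<not> x \<one>" unfolding mem ..
        have f3: "\<forall>a\<in>carrier A. \<forall>b\<in>carrier A. x b \<longrightarrow> x (a \<otimes> b)"
          using InterD[OF x 1] unfolding Un_iff mem by blast
        have f4: "\<forall>a\<in>carrier A. \<forall>b\<in>carrier A. x (a \<otimes> b) \<longrightarrow> x a \<or> x b"
          using InterD[OF x 2] unfolding Un_iff mem by blast
        show ?C by (intro conjI conjunct1[OF f2] conjunct2[OF f2] f1 f3 f4)
      next
        assume c: ?C
        show "x \<in> \<Inter>\<F>"
        proof
          fix T assume "T \<in> \<F>"
          then consider "T = E \<zero>" | "T = N \<one>"
            | (add) a b c where "T = N a \<union> N b \<union> E c" "a \<in> carrier A" "b \<in> carrier A" "c \<in> a \<boxplus> b"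
            | (mult) a b where "T = N b \<union> E (a \<otimes> b)" "a \<in> carrier A" "b \<in> carrier A"
            | (prime) a b where "T = N (a \<otimes> b) \<union> E a \<union> E b" "a \<in> carrier A" "b \<in> carrier A"
            unfolding \<F>_def by blast
          then show "x \<in> T"
          proof cases
            case add
            then have "x a \<longrightarrow> x b \<longrightarrow> x c" using c by blast
            then show ?thesis by (simp add: add(1) mem)
          next
            case mult
            then have "x b \<longrightarrow> x (a \<otimes> b)" using c by blast
            then show ?thesis by (simp add: mult(1) mem)
          next
            case prime
            then have "x (a \<otimes> b) \<longrightarrow> x a \<or> x b" using c by blast
            then show ?thesis by (simp add: prime(1) mem)
          qed (use c in \<open>simp_all add: mem\<close>)
        qed
      qed
      also have "?C \<longleftrightarrow> F x \<in> multiring_spec A"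
      proof
        assume c: ?C
        then have c1: "x \<zero>" "\<not> x \<one>" by blast+
        have c2: "x d" if "a \<in> carrier A" "b \<in> carrier A" "x a" "x b" "d \<in> a \<boxplus> b" for a b d
          using c that by blast
        have c3: "x (a \<otimes> b)" if "a \<in> carrier A" "b \<in> carrier A" "x b" for a b
          using c that by blast
        have c4: "x a \<or> x b" if "a \<in> carrier A" "b \<in> carrier A" "x (a \<otimes> b)" for a b
          using c that by blast
        show "F x \<in> multiring_spec A"
        proof (rule specI)
          fix a b assume "a \<in> F x" "b \<in> F x"
          then show "a \<boxplus> b \<subseteq> F x" using c2[of a b] add_mem_carrier[of _ a b] by (auto simp: F_def)
        next
          fix a b assume "a \<in> carrier A" "b \<in> F x"
          then show "a \<otimes> b \<in> F x" using c3[of a b] by (simp add: F_def)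
        next
          fix a b assume "a \<in> carrier A" "b \<in> carrier A" "a \<otimes> b \<in> F x"
          then show "a \<in> F x \<or> b \<in> F x" using c4[of a b] by (simp add: F_def)
        qed (use c1 zero_closed in \<open>auto simp: F_def\<close>)
      next
        assume S: "F x \<in> multiring_spec A"
        note spec = specD[OF S]
        have "x \<zero> \<and> \<not> x \<one>" using spec(2,3) by (simp add: F_def)
        moreover have "x c" if "a \<in> carrier A" "b \<in> carrier A" "x a" "x b" "c \<in> a \<boxplus> b" for a b c
          using spec(4)[of a b c] that by (simp add: F_def)
        moreover have "x (a \<otimes> b)" if "a \<in> carrier A" "b \<in> carrier A" "x b" for a b
          using spec(5)[of a b] that by (simp add: F_def)
        moreover have "x a \<or> x b" if "a \<in> carrier A" "b \<in> carrier A" "x (a \<otimes> b)" for a b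
          using spec(8)[of a b] that by (simp add: F_def)
        ultimately show ?C by blast
      qed
      finally show ?thesis using True by (simp add: S_def)
    next
      case False
      then show ?thesis by (auto simp: S_def \<F>_def E_def)
    qed
  qed
  ultimately have cS: "compactin X S" using closedin_compact_space[OF X] by simp
  have "continuous_map (subtopology X S) (constructible_topology A) F"
    unfolding constructible_topology_def
  proof (rule continuous_on_generated_topo)
    fix U
    assume "U \<in> basic_open A ` carrier A \<union> (\<lambda>a. multiring_spec A - basic_open A a) ` carrier A"
    then obtain a where a: "a \<in> carrier A" "U = basic_open A a \<or> U = multiring_spec A - basic_open A a"
      by blast
    have sub: "topspace (subtopology X S) = S" by (auto simp: S_def)
    have "F -` basic_open A a \<inter> S = S \<inter> N a" "F -` (multiring_spec A - basic_open A a) \<inter> S = S \<inter> E a"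
      using a(1) by (auto simp: S_def N_def E_def F_def basic_open_def)
    then show "openin (subtopology X S) (F -` U \<inter> topspace (subtopology X S))"
      unfolding sub using a oE oN by (auto simp: openin_subtopology_Int2)
  next
    have "F x \<in> basic_open A \<one>" if "x \<in> S" for x
      using that specD(3) by (auto simp: S_def basic_open_def)
    then show "F ` topspace (subtopology X S) \<subseteq>
      \<Union> (basic_open A ` carrier A \<union> (\<lambda>a. multiring_spec A - basic_open A a) ` carrier A)"
      using one_closed by auto
  qed
  then have "compactin (constructible_topology A) (F ` S)"
    using cS image_compactin compactin_subtopology by (metis subset_refl)
  moreover have "F ` S = multiring_spec A"
  proof
    show "multiring_spec A \<subseteq> F ` S"
    proof
      fix p assume p: "p \<in> multiring_spec A"
      have "F (\<lambda>a\<in>carrier A. a \<in> p) = p" using specD(1)[OF p] by (auto simp: F_def)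
      then show "p \<in> F ` S" using p unfolding S_def tX by (intro image_eqI[of _ _ "\<lambda>a\<in>carrier A. a \<in> p"]) auto
    qed
  qed (auto simp: S_def)
  ultimately show ?thesis by (simp add: compact_space_def)
qed

end

section \<open>Constructible sections\<close>

definition fraction_near :: "'a multiring \<Rightarrow> ('a set \<Rightarrow> ('a set \<times> 'a set) set) \<Rightarrow> 'a set \<Rightarrow> bool" where
  "fraction_near A f p \<longleftrightarrow>
     (\<exists>x\<in>carrier A. \<exists>y\<in>carrier A - p. near A p (\<lambda>q. f q = K_frac A q x y))"

context multiring
begin

text \<open>Equality of two fractions at \<open>p\<close> is witnessed by one multiplier outside \<open>p\<close> and one error
  term in \<open>p\<close>, so it persists near \<open>p\<close>.\<close>

lemma K_frac_near:
  assumes p: "p \<in> multiring_spec A" and c: "x \<in> carrier A" "y \<in> carrier A - p" "a \<in> carrier A"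
    "b \<in> carrier A - p" and eq: "K_frac A p x y = K_frac A p a b"
  shows "near A p (\<lambda>q. K_frac A q x y = K_frac A q a b)"
proof -
  obtain u i where u: "u \<in> carrier A - p" "i \<in> p" "x \<otimes> b \<otimes> u \<in> (a \<otimes> y \<otimes> u) \<boxplus> i"
    using eq unfolding K_frac_eq_iff[OF p c] frac_eq_def congruent_mod_def by blast
  have "near A p (\<lambda>q. (y \<notin> q \<and> b \<notin> q) \<and> u \<notin> q \<and> {i} \<subseteq> q)"
    using c u by (intro near_conj[OF p] near_notin near_subset[OF p]) auto
  then show ?thesis
  proof (rule near_mono)
    fix q assume q: "q \<in> multiring_spec A" and n: "(y \<notin> q \<and> b \<notin> q) \<and> u \<notin> q \<and> {i} \<subseteq> q"
    then have "frac_eq A q x y a b"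
      unfolding frac_eq_def congruent_mod_def using u(1,3) by auto
    then show "K_frac A q x y = K_frac A q a b"
      using K_frac_eq_iff[OF q c(1) _ c(3)] c(2,4) n by simp
  qed
qed

lemma fraction_nearI:
  "\<lbrakk>p \<in> multiring_spec A; x \<in> carrier A; y \<in> carrier A - p\<rbrakk> \<Longrightarrow> fraction_near A (\<lambda>q. K_frac A q x y) p"
  unfolding fraction_near_def by (intro bexI[of _ x] bexI[of _ y] near_UNIV) simp_all

lemma fraction_near_eq:
  assumes p: "p \<in> multiring_spec A" and f: "fraction_near A f p"
    and c: "x \<in> carrier A" "y \<in> carrier A - p" and eq: "f p = K_frac A p x y"
  shows "near A p (\<lambda>q. f q = K_frac A q x y)"
proof -
  obtain a b where ab: "a \<in> carrier A" "b \<in> carrier A - p" "near A p (\<lambda>q. f q = K_frac A q a b)"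
    using f unfolding fraction_near_def by (elim bexE)
  have "K_frac A p a b = K_frac A p x y" using near_self[OF ab(3) p] eq by simp
  from near_conj[OF p ab(3) K_frac_near[OF p ab(1,2) c this]]
  show ?thesis by (rule near_mono) simp
qed

lemma fraction_near_carrier:
  assumes p: "p \<in> multiring_spec A" and f: "fraction_near A f p"
  shows "f p \<in> carrier (K A p)"
proof -
  obtain x y where xy: "x \<in> carrier A" "y \<in> carrier A - p" "near A p (\<lambda>q. f q = K_frac A q x y)"
    using f unfolding fraction_near_def by (elim bexE)
  then show ?thesis using near_self[OF xy(3) p] K_frac_closed[OF p xy(1,2)] by simp
qed

lemma fraction_near_add:
  assumes p: "p \<in> multiring_spec A"
    and fr: "fraction_near A f p" "fraction_near A g p" "fraction_near A h p"
    and "f p \<in> g p \<boxplus>\<^bsub>K A p\<^esub> h p"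
  shows "near A p (\<lambda>q. f q \<in> g q \<boxplus>\<^bsub>K A q\<^esub> h q)"
proof -
  obtain x y z d where *: "x \<in> carrier A" "y \<in> carrier A" "z \<in> carrier A" "d \<in> carrier A - p"
    "f p = K_frac A p x d" "g p = K_frac A p y d" "h p = K_frac A p z d" "x \<in> y \<boxplus> z"
    using assms(5) K_add_iff[OF p fr[THEN fraction_near_carrier[OF p]]] by blast
  have "near A p (\<lambda>q. (f q = K_frac A q x d \<and> g q = K_frac A q y d) \<and> h q = K_frac A q z d \<and> d \<notin> q)"
    using * fr by (intro near_conj[OF p] fraction_near_eq[OF p] near_notin) auto
  then show ?thesis by (rule near_mono) (use * K_addI in auto)
qed

lemma sections_iff:
  "s \<in> constructible_sections A \<longleftrightarrow>
     s \<in> extensional (multiring_spec A) \<and> (\<forall>p\<in>multiring_spec A. fraction_near A s p)"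
proof
  assume s: "s \<in> constructible_sections A"
  have "fraction_near A s p" if p: "p \<in> multiring_spec A" for p
  proof -
    obtain U x y where *: "x \<in> carrier A" "y \<in> carrier A" "openin (constructible_topology A) U"
      "p \<in> U" "U \<subseteq> basic_open A y" "\<And>q. q \<in> U \<Longrightarrow> s q = K_frac A q x y"
    proof -
      have "\<forall>p\<in>multiring_spec A. \<exists>U. \<exists>x\<in>carrier A. \<exists>y\<in>carrier A.
          openin (constructible_topology A) U \<and> closedin (constructible_topology A) U \<and>
          p \<in> U \<and> U \<subseteq> basic_open A y \<and> (\<forall>q\<in>U. s q = K_frac A q x y)"
        using s by (simp add: constructible_sections_def)
      from bspec[OF this p] obtain U x y where "x \<in> carrier A" "y \<in> carrier A"
        "openin (constructible_topology A) U \<and> closedin (constructible_topology A) U \<and>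
          p \<in> U \<and> U \<subseteq> basic_open A y \<and> (\<forall>q\<in>U. s q = K_frac A q x y)" by (elim exE bexE)
      then show ?thesis by (intro that[of x y U]) simp_all
    qed
    have "near A p (\<lambda>q. s q = K_frac A q x y)"
      by (rule near_mono[OF near_of_open[OF *(3,4)]]) (rule *(6))
    moreover have "y \<in> carrier A - p" using * by (auto simp: basic_open_def)
    ultimately show ?thesis
      unfolding fraction_near_def by (intro bexI[of _ x] bexI[of _ y] *(1))
  qed
  then show "s \<in> extensional (multiring_spec A) \<and> (\<forall>p\<in>multiring_spec A. fraction_near A s p)"
    using s by (auto simp: constructible_sections_def PiE_def)
next
  assume s: "s \<in> extensional (multiring_spec A) \<and> (\<forall>p\<in>multiring_spec A. fraction_near A s p)"
  have "\<exists>U. \<exists>x\<in>carrier A. \<exists>y\<in>carrier A. openin (constructible_topology A) U \<and>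
      closedin (constructible_topology A) U \<and> p \<in> U \<and> U \<subseteq> basic_open A y \<and>
      (\<forall>q\<in>U. s q = K_frac A q x y)" if p: "p \<in> multiring_spec A" for p
  proof -
    obtain x y where xy: "x \<in> carrier A" "y \<in> carrier A - p" "near A p (\<lambda>q. s q = K_frac A q x y)"
      using s p unfolding fraction_near_def by (meson bspec)
    have "near A p (\<lambda>q. s q = K_frac A q x y \<and> y \<notin> q)"
      using xy by (intro near_conj[OF p] near_notin) auto
    then obtain U where "openin (constructible_topology A) U" "closedin (constructible_topology A) U"
      "p \<in> U" "\<And>q. q \<in> U \<Longrightarrow> s q = K_frac A q x y \<and> y \<notin> q" "U \<subseteq> multiring_spec A"
      by (rule near_clopen[OF _ p]) (rule that)
    then show ?thesis using xy by (intro exI[of _ U] bexI[of _ x] bexI[of _ y]) (auto simp: basic_open_def)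
  qed
  moreover have "s \<in> (\<Pi>\<^sub>E p\<in>multiring_spec A. carrier (K A p))"
    using s fraction_near_carrier by (auto simp: PiE_def)
  ultimately show "s \<in> constructible_sections A" by (simp add: constructible_sections_def)
qed

lemma sectionD:
  assumes "s \<in> constructible_sections A"
  shows "s \<in> extensional (multiring_spec A)" "p \<in> multiring_spec A \<Longrightarrow> fraction_near A s p"
    "p \<in> multiring_spec A \<Longrightarrow> s p \<in> carrier (K A p)"
  using assms sections_iff fraction_near_carrier by blast+

lemma fraction_near_cong:
  assumes "fraction_near A f p" "near A p (\<lambda>q. g q = f q)" and p: "p \<in> multiring_spec A"
  shows "fraction_near A g p"
proof -
  obtain x y where xy: "x \<in> carrier A" "y \<in> carrier A - p" "near A p (\<lambda>q. f q = K_frac A q x y)"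
    using assms(1) unfolding fraction_near_def by (elim bexE)
  have "near A p (\<lambda>q. g q = K_frac A q x y)"
    by (rule near_mono[OF near_conj[OF p assms(2) xy(3)]]) simp
  then show ?thesis
    unfolding fraction_near_def by (intro bexI[of _ x] bexI[of _ y] xy(1,2))
qed

lemma section_restrictI:
  assumes "\<And>p. p \<in> multiring_spec A \<Longrightarrow> fraction_near A f p"
  shows "restrict f (multiring_spec A) \<in> constructible_sections A"
  unfolding sections_iff using fraction_near_cong[OF assms near_UNIV] by auto

lemma section_patch:
  assumes U: "openin (constructible_topology A) U" "closedin (constructible_topology A) U"
    and f: "\<And>p. p \<in> U \<Longrightarrow> fraction_near A f p"
    and g: "\<And>p. p \<in> multiring_spec A - U \<Longrightarrow> fraction_near A g p"
  shows "(\<lambda>q\<in>multiring_spec A. if q \<in> U then f q else g q) \<in> constructible_sections A"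
proof (rule section_restrictI)
  fix p assume p: "p \<in> multiring_spec A"
  show "fraction_near A (\<lambda>q. if q \<in> U then f q else g q) p"
  proof (cases "p \<in> U")
    case True
    then show ?thesis
      using fraction_near_cong[OF f[OF True] near_mono[OF near_of_open[OF U(1) True]] p] by simp
  next
    case False
    have "openin (constructible_topology A) (multiring_spec A - U)"
      using U(2) by (simp add: closedin_def)
    from near_of_open[OF this, of p] have "near A p (\<lambda>q. q \<in> multiring_spec A - U)"
      using p False by simp
    from fraction_near_cong[OF g near_mono[OF this] p] p False show ?thesis by simp
  qed
qed

text \<open>Local-to-global principle: let a pointwise condition on families of sections be satisfied by
  fractions near each point of a compact set \<open>R\<close> and by zero off \<open>R\<close>. Finitely many clopen sets on
  which fractions satisfy it cover \<open>R\<close>; they can be made disjoint, and the fractions on them glue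
  with zero on the rest.\<close>

lemma exists_sections:
  fixes P :: "'a set \<Rightarrow> ('i \<Rightarrow> ('a set \<times> 'a set) set) \<Rightarrow> bool"
  assumes R: "compactin (constructible_topology A) R"
    and off: "\<And>q. q \<in> multiring_spec A - R \<Longrightarrow> P q (\<lambda>_. K_frac A q \<zero> \<one>)"
    and loc: "\<And>p. p \<in> R \<Longrightarrow> \<exists>x y. (\<forall>i. x i \<in> carrier A) \<and> y \<in> carrier A - p \<and>
      near A p (\<lambda>q. P q (\<lambda>i. K_frac A q (x i) y))"
  shows "\<exists>h. (\<forall>i. h i \<in> constructible_sections A) \<and> (\<forall>q\<in>multiring_spec A. P q (\<lambda>i. h i q))"
proof -
  define good where "good U \<longleftrightarrow> openin (constructible_topology A) U \<and>
    closedin (constructible_topology A) U \<and>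
    (\<exists>h. (\<forall>i. h i \<in> constructible_sections A) \<and> (\<forall>q\<in>U. P q (\<lambda>i. h i q)))" for U
  have zero: "fraction_near A (\<lambda>q. K_frac A q \<zero> \<one>) p" if "p \<in> multiring_spec A" for p
    using fraction_nearI[OF that zero_closed, of \<one>] specD(3)[OF that] by simp
  have sub: "U \<subseteq> multiring_spec A" if "openin (constructible_topology A) U" for U
    using openin_subset[OF that] by simp
  have local_good: "\<exists>U. good U \<and> p \<in> U" if pR: "p \<in> R" for p
  proof -
    have p: "p \<in> multiring_spec A" using compactin_subset_topspace[OF R] pR by auto
    obtain x y where xy: "\<And>i. x i \<in> carrier A" "y \<in> carrier A - p"
      "near A p (\<lambda>q. P q (\<lambda>i. K_frac A q (x i) y))"
      using loc[OF pR] by blast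
    have "near A p (\<lambda>q. P q (\<lambda>i. K_frac A q (x i) y) \<and> y \<notin> q)"
      using xy by (intro near_conj[OF p] near_notin) auto
    then obtain U where U: "openin (constructible_topology A) U" "closedin (constructible_topology A) U"
      "p \<in> U" "\<And>q. q \<in> U \<Longrightarrow> P q (\<lambda>i. K_frac A q (x i) y) \<and> y \<notin> q" "U \<subseteq> multiring_spec A"
      by (rule near_clopen[OF _ p]) (rule that)
    define h where "h i = (\<lambda>q\<in>multiring_spec A. if q \<in> U then K_frac A q (x i) y else K_frac A q \<zero> \<one>)" for i
    have "h i \<in> constructible_sections A" for i
      unfolding h_def by (rule section_patch[OF U(1,2)]) (use U xy zero fraction_nearI in auto)
    moreover have "P q (\<lambda>i. h i q)" if "q \<in> U" for q
    proof -
      have "(\<lambda>i. h i q) = (\<lambda>i. K_frac A q (x i) y)" using that U(5) by (auto simp: h_def)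
      then show ?thesis using U(4)[OF that] by simp
    qed
    ultimately have "good U" unfolding good_def using U(1,2) by blast
    then show ?thesis using U(3) by blast
  qed
  have patch: "\<exists>h''. (\<forall>i. h'' i \<in> constructible_sections A) \<and>
      (\<forall>q\<in>U. P q (\<lambda>i. h'' i q)) \<and> (\<forall>q\<in>multiring_spec A - U. (\<lambda>i. h'' i q) = (\<lambda>i. h' i q))"
    if gU: "good U" and h': "\<And>i. h' i \<in> constructible_sections A" for U h'
  proof -
    obtain h where h: "\<And>i. h i \<in> constructible_sections A" "\<And>q. q \<in> U \<Longrightarrow> P q (\<lambda>i. h i q)"
      and U: "openin (constructible_topology A) U" "closedin (constructible_topology A) U"
      using gU unfolding good_def by blast
    define h'' where "h'' i = (\<lambda>q\<in>multiring_spec A. if q \<in> U then h i q else h' i q)" for i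
    have "h'' i \<in> constructible_sections A" for i
      unfolding h''_def by (rule section_patch[OF U]) (use sectionD(2) h(1) h' sub[OF U(1)] in auto)
    moreover have "(\<lambda>i. h'' i q) = (\<lambda>i. h i q)" if "q \<in> U" for q
      using that sub[OF U(1)] by (auto simp: h''_def)
    moreover have "(\<lambda>i. h'' i q) = (\<lambda>i. h' i q)" if "q \<in> multiring_spec A - U" for q
      using that by (auto simp: h''_def)
    ultimately show ?thesis using h(2) by (intro exI[of _ h'']) auto
  qed
  have zs: "(\<lambda>q\<in>multiring_spec A. K_frac A q \<zero> \<one>) \<in> constructible_sections A"
    using section_restrictI[OF zero] .
  have good_empty: "good {}" unfolding good_def using zs by (auto intro!: exI[of _ "\<lambda>_. \<lambda>q\<in>multiring_spec A. K_frac A q \<zero> \<one>"])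
  have good_Un: "good (U \<union> W)" if UW: "good U" "good W" for U W
  proof -
    obtain h where h: "\<And>i. h i \<in> constructible_sections A" "\<And>q. q \<in> W \<Longrightarrow> P q (\<lambda>i. h i q)"
      and W: "openin (constructible_topology A) W" "closedin (constructible_topology A) W"
      using UW(2) unfolding good_def by blast
    obtain h'' where h'': "\<And>i. h'' i \<in> constructible_sections A" "\<And>q. q \<in> U \<Longrightarrow> P q (\<lambda>i. h'' i q)"
      "\<And>q. q \<in> multiring_spec A - U \<Longrightarrow> (\<lambda>i. h'' i q) = (\<lambda>i. h i q)"
      using patch[OF UW(1), of h] h(1) by blast
    have "P q (\<lambda>i. h'' i q)" if "q \<in> U \<union> W" for q
      using h''(2,3)[of q] h(2)[of q] that sub[OF W(1)] by (cases "q \<in> U") auto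
    then show ?thesis
      using UW h''(1) unfolding good_def by (auto intro!: openin_Un closedin_Un)
  qed
  have Union: "good (\<Union>\<U>)" if "finite \<U>" "\<U> \<subseteq> Collect good" for \<U>
    using that by (induction \<U> rule: finite_induct) (auto simp: good_empty good_Un)
  have "\<exists>\<F>. finite \<F> \<and> \<F> \<subseteq> Collect good \<and> R \<subseteq> \<Union>\<F>"
  proof -
    have "\<And>U. U \<in> Collect good \<Longrightarrow> openin (constructible_topology A) U" by (simp add: good_def)
    moreover have "R \<subseteq> \<Union>(Collect good)" using local_good by blast
    ultimately show ?thesis using R unfolding compactin_def by meson
  qed
  then obtain W where W: "good W" "R \<subseteq> W" using Union by blast
  obtain h where h: "\<And>i. h i \<in> constructible_sections A" "\<And>q. q \<in> W \<Longrightarrow> P q (\<lambda>i. h i q)"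
      "\<And>q. q \<in> multiring_spec A - W \<Longrightarrow> (\<lambda>i. h i q) = (\<lambda>i. (\<lambda>q\<in>multiring_spec A. K_frac A q \<zero> \<one>) q)"
    using patch[OF W(1), of "\<lambda>_. \<lambda>q\<in>multiring_spec A. K_frac A q \<zero> \<one>"] zs by blast
  have "P q (\<lambda>i. h i q)" if "q \<in> multiring_spec A" for q
    using h(2,3)[of q] off[of q] that W(2) by (cases "q \<in> W") auto
  then show ?thesis using h(1) by blast
qed

lemma V_simps:
  "carrier (V A) = constructible_sections A"
  "f \<otimes>\<^bsub>V A\<^esub> g = (\<lambda>p\<in>multiring_spec A. f p \<otimes>\<^bsub>K A p\<^esub> g p)"
  "\<one>\<^bsub>V A\<^esub> = (\<lambda>p\<in>multiring_spec A. \<one>\<^bsub>K A p\<^esub>)"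
  "\<boxminus>\<^bsub>V A\<^esub> f = (\<lambda>p\<in>multiring_spec A. \<boxminus>\<^bsub>K A p\<^esub> f p)"
  "\<zero>\<^bsub>V A\<^esub> = (\<lambda>p\<in>multiring_spec A. \<zero>\<^bsub>K A p\<^esub>)"
  by (simp_all add: V_def)

lemma V_add_iff:
  "f \<in> g \<boxplus>\<^bsub>V A\<^esub> h \<longleftrightarrow> f \<in> constructible_sections A \<and>
     (\<forall>p\<in>multiring_spec A. f p \<in> g p \<boxplus>\<^bsub>K A p\<^esub> h p)"
  by (simp add: V_def)

lemma section_mult:
  assumes "f \<in> constructible_sections A" "g \<in> constructible_sections A"
  shows "(\<lambda>p\<in>multiring_spec A. f p \<otimes>\<^bsub>K A p\<^esub> g p) \<in> constructible_sections A"
proof (rule section_restrictI)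
  fix p assume p: "p \<in> multiring_spec A"
  obtain x y where xy: "x \<in> carrier A" "y \<in> carrier A - p" "near A p (\<lambda>q. f q = K_frac A q x y)"
    using sectionD(2)[OF assms(1) p] unfolding fraction_near_def by (elim bexE)
  obtain a b where ab: "a \<in> carrier A" "b \<in> carrier A - p" "near A p (\<lambda>q. g q = K_frac A q a b)"
    using sectionD(2)[OF assms(2) p] unfolding fraction_near_def by (elim bexE)
  have "near A p (\<lambda>q. (f q = K_frac A q x y \<and> g q = K_frac A q a b) \<and> y \<notin> q \<and> b \<notin> q)"
    using xy ab by (intro near_conj[OF p] near_notin) auto
  then have "near A p (\<lambda>q. f q \<otimes>\<^bsub>K A q\<^esub> g q = K_frac A q (x \<otimes> a) (y \<otimes> b))"
    by (rule near_mono) (use xy ab K_mult in auto)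
  then show "fraction_near A (\<lambda>p. f p \<otimes>\<^bsub>K A p\<^esub> g p) p"
    unfolding fraction_near_def using xy ab
    by (intro bexI[of _ "x \<otimes> a"] bexI[of _ "y \<otimes> b"] spec_mult_notin[OF p]) simp_all
qed

lemma section_neg:
  assumes "f \<in> constructible_sections A"
  shows "(\<lambda>p\<in>multiring_spec A. \<boxminus>\<^bsub>K A p\<^esub> f p) \<in> constructible_sections A"
proof (rule section_restrictI)
  fix p assume p: "p \<in> multiring_spec A"
  obtain x y where xy: "x \<in> carrier A" "y \<in> carrier A - p" "near A p (\<lambda>q. f q = K_frac A q x y)"
    using sectionD(2)[OF assms(1) p] unfolding fraction_near_def by (elim bexE)
  have "near A p (\<lambda>q. f q = K_frac A q x y \<and> y \<notin> q)"
    using xy by (intro near_conj[OF p] near_notin) auto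
  then have "near A p (\<lambda>q. \<boxminus>\<^bsub>K A q\<^esub> f q = K_frac A q (\<boxminus> x) y)"
    by (rule near_mono) (use xy K_neg in auto)
  then show "fraction_near A (\<lambda>p. \<boxminus>\<^bsub>K A p\<^esub> f p) p"
    unfolding fraction_near_def by (intro bexI[of _ "\<boxminus> x"] bexI[of _ y] neg_closed xy(1,2))
qed

lemma section_const:
  assumes "x \<in> carrier A"
  shows "(\<lambda>p\<in>multiring_spec A. K_frac A p x \<one>) \<in> constructible_sections A"
  using assms specD(3) fraction_nearI by (intro section_restrictI) simp

lemma V_add_nonempty:
  assumes f: "f \<in> constructible_sections A" and g: "g \<in> constructible_sections A"
  shows "f \<boxplus>\<^bsub>V A\<^esub> g \<noteq> {}"
proof -
  define P where "P q h \<longleftrightarrow> h () \<in> f q \<boxplus>\<^bsub>K A q\<^esub> g q" for q h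
  have "\<exists>h. (\<forall>i. h i \<in> constructible_sections A) \<and> (\<forall>q\<in>multiring_spec A. P q (\<lambda>i. h i q))"
  proof (rule exists_sections)
    show "compactin (constructible_topology A) (multiring_spec A)"
      using compact_space_constructible by (simp add: compact_space_def)
    fix p assume p: "p \<in> multiring_spec A"
    interpret Kp: multiring "K A p" using multiring_K[OF p] .
    have "f p \<boxplus>\<^bsub>K A p\<^esub> g p \<noteq> {}" using Kp.add_nonempty sectionD(3) f g p by blast
    then obtain F where F: "F \<in> f p \<boxplus>\<^bsub>K A p\<^esub> g p" by blast
    then have "F \<in> carrier (K A p)" using K_add_closed by blast
    then obtain x y where xy: "x \<in> carrier A" "y \<in> carrier A - p" "F = K_frac A p x y"
      by (rule K_cases[OF p])
    have "near A p (\<lambda>q. K_frac A q x y \<in> f q \<boxplus>\<^bsub>K A q\<^esub> g q)"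
      using fraction_near_add[OF p fraction_nearI[OF p xy(1,2)]] sectionD(2) f g p F xy(3) by blast
    then show "\<exists>x y. (\<forall>i. x i \<in> carrier A) \<and> y \<in> carrier A - p \<and>
        near A p (\<lambda>q. P q (\<lambda>i. K_frac A q (x i) y))"
      unfolding P_def using xy by (intro exI[of _ "\<lambda>_. x"] exI[of _ y]) auto
  qed auto
  then show ?thesis unfolding P_def using V_add_iff[of _ f g] by blast
qed

lemma V_add_assoc:
  assumes s: "a \<in> constructible_sections A" "b \<in> constructible_sections A" "c \<in> constructible_sections A"
    and g: "g \<in> a \<boxplus>\<^bsub>V A\<^esub> b" and x: "x \<in> g \<boxplus>\<^bsub>V A\<^esub> c"
  shows "\<exists>h\<in>b \<boxplus>\<^bsub>V A\<^esub> c. x \<in> a \<boxplus>\<^bsub>V A\<^esub> h"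
proof -
  have gx: "g \<in> constructible_sections A" "x \<in> constructible_sections A"
    using g x by (simp_all add: V_add_iff)
  define P where "P q h \<longleftrightarrow> h () \<in> b q \<boxplus>\<^bsub>K A q\<^esub> c q \<and> x q \<in> a q \<boxplus>\<^bsub>K A q\<^esub> h ()" for q h
  have "\<exists>h. (\<forall>i. h i \<in> constructible_sections A) \<and> (\<forall>q\<in>multiring_spec A. P q (\<lambda>i. h i q))"
  proof (rule exists_sections)
    show "compactin (constructible_topology A) (multiring_spec A)"
      using compact_space_constructible by (simp add: compact_space_def)
    fix p assume p: "p \<in> multiring_spec A"
    interpret Kp: multiring "K A p" using multiring_K[OF p] .
    obtain F where F: "F \<in> b p \<boxplus>\<^bsub>K A p\<^esub> c p" "x p \<in> a p \<boxplus>\<^bsub>K A p\<^esub> F"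
      using Kp.add_assoc[of "a p" "b p" "c p" "g p" "x p"] sectionD(3)[OF _ p] s g x p
      by (auto simp: V_add_iff)
    then have "F \<in> carrier (K A p)" using K_add_closed by blast
    then obtain z y where xy: "z \<in> carrier A" "y \<in> carrier A - p" "F = K_frac A p z y"
      by (rule K_cases[OF p])
    note fr = fraction_nearI[OF p xy(1,2)] sectionD(2)[OF _ p]
    have "near A p (\<lambda>q. K_frac A q z y \<in> b q \<boxplus>\<^bsub>K A q\<^esub> c q \<and> x q \<in> a q \<boxplus>\<^bsub>K A q\<^esub> K_frac A q z y)"
      using fr F xy(3) s gx by (intro near_conj[OF p] fraction_near_add[OF p]) auto
    then show "\<exists>x y. (\<forall>i. x i \<in> carrier A) \<and> y \<in> carrier A - p \<and>
        near A p (\<lambda>q. P q (\<lambda>i. K_frac A q (x i) y))"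
      unfolding P_def using xy by (intro exI[of _ "\<lambda>_. z"] exI[of _ y]) auto
  qed auto
  then obtain h where "h () \<in> constructible_sections A" "\<And>q. q \<in> multiring_spec A \<Longrightarrow> P q (\<lambda>i. h i q)"
    by blast
  then have "h () \<in> b \<boxplus>\<^bsub>V A\<^esub> c" "x \<in> a \<boxplus>\<^bsub>V A\<^esub> h ()"
    unfolding V_add_iff P_def using gx by auto
  then show ?thesis by blast
qed

text \<open>Except for associativity and the existence of sums, the axioms are pointwise.\<close>

theorem multiring_V: "multiring (V A)"
proof -
  note K = multiring_K
  have cm: "comm_monoid (K A p)" if "p \<in> multiring_spec A" for p
    using K[OF that] by (simp add: multiring_def)
  have mon: "monoid (K A p)" if "p \<in> multiring_spec A" for p
    using cm[OF that] by (simp add: comm_monoid_def)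
  note cl = sectionD(3)
  have ex: "f \<in> extensional (multiring_spec A)" if "f \<in> constructible_sections A" for f
    using sectionD(1)[OF that] .
  show ?thesis
  proof (unfold_locales, unfold V_simps)
    fix f g h
    assume f: "f \<in> constructible_sections A" and g: "g \<in> constructible_sections A"
    show "(\<lambda>p\<in>multiring_spec A. f p \<otimes>\<^bsub>K A p\<^esub> g p) \<in> constructible_sections A"
      using section_mult f g by blast
    show "(\<lambda>p\<in>multiring_spec A. f p \<otimes>\<^bsub>K A p\<^esub> g p) = (\<lambda>p\<in>multiring_spec A. g p \<otimes>\<^bsub>K A p\<^esub> f p)"
      using comm_monoid.m_comm[OF cm] cl f g by (intro restrict_ext) blast
    show "f \<boxplus>\<^bsub>V A\<^esub> g \<subseteq> constructible_sections A" by (auto simp: V_add_iff)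
    show "f \<boxplus>\<^bsub>V A\<^esub> g \<noteq> {}" using V_add_nonempty f g by blast
    show "f \<boxplus>\<^bsub>V A\<^esub> g = g \<boxplus>\<^bsub>V A\<^esub> f"
      using multiring.add_commute[OF K] cl f g by (auto simp: V_add_iff set_eq_iff)
    show "f \<in> g \<boxplus>\<^bsub>V A\<^esub> (\<lambda>p\<in>multiring_spec A. \<zero>\<^bsub>K A p\<^esub>) \<longleftrightarrow> f = g"
    proof -
      have "f \<in> g \<boxplus>\<^bsub>V A\<^esub> (\<lambda>p\<in>multiring_spec A. \<zero>\<^bsub>K A p\<^esub>) \<longleftrightarrow> (\<forall>p\<in>multiring_spec A. f p = g p)"
        using multiring.add_zero[OF K] cl f g by (auto simp: V_add_iff)
      also have "\<dots> \<longleftrightarrow> f = g" using extensionalityI[OF ex[OF f] ex[OF g]] by blast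
      finally show ?thesis .
    qed
    assume h: "h \<in> constructible_sections A"
    show "(\<lambda>p\<in>multiring_spec A. (\<lambda>p\<in>multiring_spec A. f p \<otimes>\<^bsub>K A p\<^esub> g p) p \<otimes>\<^bsub>K A p\<^esub> h p) =
      (\<lambda>p\<in>multiring_spec A. f p \<otimes>\<^bsub>K A p\<^esub> (\<lambda>p\<in>multiring_spec A. g p \<otimes>\<^bsub>K A p\<^esub> h p) p)"
      using monoid.m_assoc[OF mon] cl f g h by (intro restrict_ext) simp
    show "h \<in> (\<lambda>p\<in>multiring_spec A. \<boxminus>\<^bsub>K A p\<^esub> g p) \<boxplus>\<^bsub>V A\<^esub> f \<and>
        g \<in> f \<boxplus>\<^bsub>V A\<^esub> (\<lambda>p\<in>multiring_spec A. \<boxminus>\<^bsub>K A p\<^esub> h p)" if "f \<in> g \<boxplus>\<^bsub>V A\<^esub> h"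
      using multiring.add_reversible[OF K] cl f g h that by (auto simp: V_add_iff)
    show "(\<lambda>p\<in>multiring_spec A. f p \<otimes>\<^bsub>K A p\<^esub> d p) \<in>
        (\<lambda>p\<in>multiring_spec A. g p \<otimes>\<^bsub>K A p\<^esub> d p) \<boxplus>\<^bsub>V A\<^esub> (\<lambda>p\<in>multiring_spec A. h p \<otimes>\<^bsub>K A p\<^esub> d p)"
      if "d \<in> constructible_sections A" "f \<in> g \<boxplus>\<^bsub>V A\<^esub> h" for d
      using multiring.mult_distrib[OF K] cl f g h that section_mult[OF f that(1)]
      by (auto simp: V_add_iff)
    show "\<exists>k\<in>g \<boxplus>\<^bsub>V A\<^esub> h. x \<in> f \<boxplus>\<^bsub>V A\<^esub> k" if "y \<in> f \<boxplus>\<^bsub>V A\<^esub> g" "x \<in> y \<boxplus>\<^bsub>V A\<^esub> h" for x y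
      using V_add_assoc[OF f g h that] .
  next
    fix f assume f: "f \<in> constructible_sections A"
    show "(\<lambda>p\<in>multiring_spec A. \<boxminus>\<^bsub>K A p\<^esub> f p) \<in> constructible_sections A" using section_neg f .
    show "(\<lambda>p\<in>multiring_spec A. f p \<otimes>\<^bsub>K A p\<^esub> (\<lambda>p\<in>multiring_spec A. \<zero>\<^bsub>K A p\<^esub>) p) =
        (\<lambda>p\<in>multiring_spec A. \<zero>\<^bsub>K A p\<^esub>)"
      using multiring.mult_zero[OF K] cl f by (intro restrict_ext) simp
    show "(\<lambda>p\<in>multiring_spec A. (\<lambda>p\<in>multiring_spec A. \<one>\<^bsub>K A p\<^esub>) p \<otimes>\<^bsub>K A p\<^esub> f p) = f"
      by (rule extensionalityI[OF restrict_extensional ex[OF f]])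
        (simp add: monoid.l_one[OF mon] cl[OF f])
    show "(\<lambda>p\<in>multiring_spec A. f p \<otimes>\<^bsub>K A p\<^esub> (\<lambda>p\<in>multiring_spec A. \<one>\<^bsub>K A p\<^esub>) p) = f"
      by (rule extensionalityI[OF restrict_extensional ex[OF f]])
        (simp add: monoid.r_one[OF mon] cl[OF f])
  qed (use section_const zero_closed in \<open>auto simp: K_zero K_one\<close>)
qed

end

section \<open>Functoriality\<close>

locale multiring_morphism = A: multiring A + B: multiring B
  for A :: "'a multiring" and B :: "'b multiring" +
  fixes g :: "'a \<Rightarrow> 'b"
  assumes hom: "g \<in> multiring_hom A B"
begin

lemmas homD = multiring_homD[OF hom]

lemma preimage_spec:
  assumes p: "p \<in> multiring_spec B"
  shows "preimage A g p \<in> multiring_spec A"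
proof (rule A.specI)
  note S = B.specD[OF p]
  show "preimage A g p \<subseteq> carrier A" "\<zero>\<^bsub>A\<^esub> \<in> preimage A g p" "\<one>\<^bsub>A\<^esub> \<notin> preimage A g p"
    using S(2,3) homD(5,6) A.zero_closed by (auto simp: preimage_def)
  fix a b
  show "a \<boxplus>\<^bsub>A\<^esub> b \<subseteq> preimage A g p" if "a \<in> preimage A g p" "b \<in> preimage A g p"
  proof
    fix c assume c: "c \<in> a \<boxplus>\<^bsub>A\<^esub> b"
    have ab: "a \<in> carrier A" "b \<in> carrier A" "g a \<in> p" "g b \<in> p"
      using that by (simp_all add: preimage_def)
    have cc: "c \<in> carrier A" using A.add_mem_carrier[OF c ab(1,2)] .
    then show "c \<in> preimage A g p"
      using S(4)[OF ab(3,4) homD(2)[OF c cc ab(1,2)]] by (simp add: preimage_def)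
  qed
  show "a \<otimes>\<^bsub>A\<^esub> b \<in> preimage A g p" if "a \<in> carrier A" "b \<in> preimage A g p"
    using that S(5)[OF homD(1)] by (simp add: preimage_def homD(3))
  show "a \<in> preimage A g p \<or> b \<in> preimage A g p"
    if "a \<in> carrier A" "b \<in> carrier A" "a \<otimes>\<^bsub>A\<^esub> b \<in> preimage A g p"
    using that S(8)[OF homD(1) homD(1)] by (simp add: preimage_def homD(3))
qed

lemma not_in_preimage: "y \<in> carrier A - preimage A g p \<Longrightarrow> g y \<in> carrier B - p"
  using homD(1) by (auto simp: preimage_def)

lemma frac_eq_map:
  assumes p: "p \<in> multiring_spec B"
    and c: "x \<in> carrier A" "y \<in> carrier A" "a \<in> carrier A" "b \<in> carrier A"
    and e: "frac_eq A (preimage A g p) x y a b"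
  shows "frac_eq B p (g x) (g y) (g a) (g b)"
proof -
  obtain u i where u: "u \<in> carrier A - preimage A g p" "i \<in> preimage A g p"
    "x \<otimes>\<^bsub>A\<^esub> b \<otimes>\<^bsub>A\<^esub> u \<in> (a \<otimes>\<^bsub>A\<^esub> y \<otimes>\<^bsub>A\<^esub> u) \<boxplus>\<^bsub>A\<^esub> i"
    using e unfolding frac_eq_def congruent_mod_def by blast
  have "i \<in> carrier A" "g i \<in> p" using u(2) by (simp_all add: preimage_def)
  moreover from this have "g (x \<otimes>\<^bsub>A\<^esub> b \<otimes>\<^bsub>A\<^esub> u) \<in> g (a \<otimes>\<^bsub>A\<^esub> y \<otimes>\<^bsub>A\<^esub> u) \<boxplus>\<^bsub>B\<^esub> g i"
    using homD(2)[OF u(3)] c u(1) by simp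
  then have "g x \<otimes>\<^bsub>B\<^esub> g b \<otimes>\<^bsub>B\<^esub> g u \<in> (g a \<otimes>\<^bsub>B\<^esub> g y \<otimes>\<^bsub>B\<^esub> g u) \<boxplus>\<^bsub>B\<^esub> g i"
    using c u(1) by (simp add: homD(3))
  ultimately show ?thesis
    unfolding frac_eq_def congruent_mod_def using not_in_preimage[OF u(1)] by blast
qed

lemma K_map_frac:
  assumes p: "p \<in> multiring_spec B" and c: "x \<in> carrier A" "y \<in> carrier A - preimage A g p"
  shows "K_map B g p (K_frac A (preimage A g p) x y) = K_frac B p (g x) (g y)"
proof -
  let ?q = "preimage A g p"
  note q = preimage_spec[OF p]
  have val: "K_frac B p (g x') (g y') = K_frac B p (g x) (g y)"
    if XY: "(X, Y) \<in> K_frac A ?q x y" "x' \<in> X" "y' \<in> Y" for X Y x' y'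
  proof -
    obtain a b where ab: "a \<in> carrier A" "b \<in> carrier A - ?q" "X = residue_class A ?q a"
      "Y = residue_class A ?q b" "K_frac A ?q x y = K_frac A ?q a b"
      using A.K_frac_repr[OF q c XY(1)] by blast
    have x': "x' \<in> carrier A" "residue_class A ?q x' = X"
      using A.residue_class_of_mem[OF q ab(1)] XY(2) ab(3) by auto
    have y': "y' \<in> carrier A" "residue_class A ?q y' = Y"
      using A.residue_class_of_mem[OF q _ , of b y'] XY(3) ab(2,4) by auto
    have "y' \<notin> ?q"
    proof
      assume "y' \<in> ?q"
      then have "residue_class A ?q b = residue_class A ?q \<zero>\<^bsub>A\<^esub>"
        using y' ab(4) A.residue_class_eq_iff[OF q y'(1) A.zero_closed] A.congruent_zero_iff[OF q y'(1)]
        by simp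
      then have "b \<in> ?q"
        using A.residue_class_eq_iff[OF q _ A.zero_closed, of b] A.congruent_zero_iff[OF q, of b] ab(2)
        by simp
      then show False using ab(2) by simp
    qed
    then have y'': "y' \<in> carrier A - ?q" using y' by simp
    have "K_frac A ?q x' y' = K_frac A ?q x y" using x' y' ab by (simp add: K_frac_def)
    then have "frac_eq A ?q x' y' x y" using A.K_frac_eq_iff[OF q x'(1) y'' c] by simp
    from frac_eq_map[OF p x'(1) y'(1) c(1) _ this] show ?thesis
      using B.K_frac_eq_iff[OF p homD(1)[OF x'(1)] not_in_preimage[OF y''] homD(1)[OF c(1)]
          not_in_preimage[OF c(2)]] c(2) by simp
  qed
  have ne: "\<exists>x'. x' \<in> X" "\<exists>y'. y' \<in> Y" if "(X, Y) \<in> K_frac A ?q x y" for X Y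
    using A.K_frac_repr[OF q c that] A.mem_residue_class[OF q] by (metis DiffD1)+
  have "(\<Union>w\<in>K_frac A ?q x y. \<Union>x'\<in>fst w. \<Union>y'\<in>snd w. K_frac B p (g x') (g y')) =
      K_frac B p (g x) (g y)"
  proof (rule UN_eq_const[OF A.K_frac_self[OF q c]])
    fix w assume w: "w \<in> K_frac A ?q x y"
    then have w': "(fst w, snd w) \<in> K_frac A ?q x y" by simp
    obtain x0 y0 where 0: "x0 \<in> fst w" "y0 \<in> snd w" using ne[OF w'] by blast
    show "(\<Union>x'\<in>fst w. \<Union>y'\<in>snd w. K_frac B p (g x') (g y')) = K_frac B p (g x) (g y)"
      by (rule UN_eq_const[OF 0(1)], rule UN_eq_const[OF 0(2)]) (use val[OF w'] in blast)
  qed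
  then show ?thesis by (simp add: K_map_def case_prod_beta)
qed

lemma near_pullback:
  assumes "near A (preimage A g p) P"
  shows "near B p (\<lambda>q. P (preimage A g q))"
proof -
  obtain a C where a: "a \<in> carrier A" "finite C" "C \<subseteq> carrier A" "a \<notin> preimage A g p"
    "C \<subseteq> preimage A g p" "\<And>q. q \<in> multiring_spec A \<Longrightarrow> a \<notin> q \<Longrightarrow> C \<subseteq> q \<Longrightarrow> P q"
    using assms by (rule nearE) (rule that)
  have "g a \<in> carrier B" "finite (g ` C)" "g ` C \<subseteq> carrier B" "g a \<notin> p" "g ` C \<subseteq> p"
    using a homD(1) by (auto simp: preimage_def)
  moreover have "P (preimage A g q)" if q: "q \<in> multiring_spec B" "g a \<notin> q" "g ` C \<subseteq> q" for q
    by (rule a(6)[OF preimage_spec[OF q(1)]]) (use q a(3) in \<open>auto simp: preimage_def\<close>)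
  ultimately show ?thesis
    unfolding near_def by (intro bexI[of _ "g a"] exI[of _ "g ` C"]) simp_all
qed

lemma V_map_apply:
  "\<lbrakk>s \<in> constructible_sections A; p \<in> multiring_spec B\<rbrakk> \<Longrightarrow>
    V_map A B g s p = K_map B g p (s (preimage A g p))"
  by (simp add: V_map_def A.V_simps)

lemma V_map_frac:
  assumes "s \<in> constructible_sections A" "p \<in> multiring_spec B" "x \<in> carrier A"
    "y \<in> carrier A - preimage A g p" "s (preimage A g p) = K_frac A (preimage A g p) x y"
  shows "V_map A B g s p = K_frac B p (g x) (g y)"
  using assms by (simp add: V_map_apply K_map_frac)

lemma V_map_closed:
  assumes s: "s \<in> constructible_sections A"
  shows "V_map A B g s \<in> constructible_sections B"
  unfolding B.sections_iff
proof (intro conjI ballI)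
  show "V_map A B g s \<in> extensional (multiring_spec B)"
    using s by (simp add: V_map_def A.V_simps)
  fix p assume p: "p \<in> multiring_spec B"
  note q = preimage_spec[OF p]
  obtain x y where xy: "x \<in> carrier A" "y \<in> carrier A - preimage A g p"
    "near A (preimage A g p) (\<lambda>q. s q = K_frac A q x y)"
    using A.sectionD(2)[OF s q] unfolding fraction_near_def by (elim bexE)
  have "near A (preimage A g p) (\<lambda>q. s q = K_frac A q x y \<and> y \<notin> q)"
    using xy by (intro A.near_conj[OF q] A.near_notin) auto
  from near_pullback[OF this]
  have "near B p (\<lambda>q. V_map A B g s q = K_frac B q (g x) (g y))"
    by (rule B.near_mono) (use V_map_frac[OF s _ xy(1)] xy(2) in auto)
  then show "fraction_near B (V_map A B g s) p"
    unfolding fraction_near_def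
    by (intro bexI[of _ "g x"] bexI[of _ "g y"] not_in_preimage xy(2) homD(1) xy(1))
qed

lemma section_frac:
  assumes "s \<in> constructible_sections A" "p \<in> multiring_spec A"
  obtains x y where "x \<in> carrier A" "y \<in> carrier A - p" "s p = K_frac A p x y"
  using A.K_cases[OF assms(2) A.sectionD(3)[OF assms]] by blast

lemma K_map_add:
  assumes p: "p \<in> multiring_spec B" and c: "F \<in> carrier (K A (preimage A g p))"
    "G \<in> carrier (K A (preimage A g p))" "H \<in> carrier (K A (preimage A g p))"
    and F: "F \<in> G \<boxplus>\<^bsub>K A (preimage A g p)\<^esub> H"
  shows "K_map B g p F \<in> K_map B g p G \<boxplus>\<^bsub>K B p\<^esub> K_map B g p H"
proof -
  obtain x y z d where *: "x \<in> carrier A" "y \<in> carrier A" "z \<in> carrier A"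
    "d \<in> carrier A - preimage A g p" "F = K_frac A (preimage A g p) x d"
    "G = K_frac A (preimage A g p) y d" "H = K_frac A (preimage A g p) z d" "x \<in> y \<boxplus>\<^bsub>A\<^esub> z"
    using F A.K_add_iff[OF preimage_spec[OF p] c] by blast
  show ?thesis
    using B.K_addI[OF p homD(2)[OF *(8,1-3)] homD(1)[OF *(2)] homD(1)[OF *(3)] not_in_preimage[OF *(4)]] *
    by (simp add: K_map_frac p)
qed

theorem V_map_hom: "V_map A B g \<in> multiring_hom (V A) (V B)"
  unfolding multiring_hom_def
proof (intro CollectI conjI ballI impI)
  show "V_map A B g \<in> carrier (V A) \<rightarrow>\<^sub>E carrier (V B)"
    unfolding PiE_def using V_map_closed by (auto simp: A.V_simps B.V_simps V_map_def)
  have ext: "f = h" if "f \<in> extensional (multiring_spec B)" "h \<in> extensional (multiring_spec B)"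
    "\<And>p. p \<in> multiring_spec B \<Longrightarrow> f p = h p" for f h :: "'b set \<Rightarrow> ('b set \<times> 'b set) set"
    using extensionalityI[OF that] .
  have ex: "V_map A B g s \<in> extensional (multiring_spec B)" if "s \<in> constructible_sections A" for s
    using B.sectionD(1)[OF V_map_closed[OF that]] .
  fix s t r
  assume s: "s \<in> carrier (V A)" and t: "t \<in> carrier (V A)"
  show "V_map A B g (s \<otimes>\<^bsub>V A\<^esub> t) = V_map A B g s \<otimes>\<^bsub>V B\<^esub> V_map A B g t"
  proof (rule ext)
    fix p assume p: "p \<in> multiring_spec B"
    note q = preimage_spec[OF p]
    obtain x y where xy: "x \<in> carrier A" "y \<in> carrier A - preimage A g p"
      "s (preimage A g p) = K_frac A (preimage A g p) x y"
      using section_frac[OF s[unfolded A.V_simps] q] .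
    obtain a b where ab: "a \<in> carrier A" "b \<in> carrier A - preimage A g p"
      "t (preimage A g p) = K_frac A (preimage A g p) a b"
      using section_frac[OF t[unfolded A.V_simps] q] .
    have yb: "y \<otimes>\<^bsub>A\<^esub> b \<in> carrier A - preimage A g p" using A.spec_mult_notin[OF q xy(2) ab(2)] .
    have "V_map A B g (s \<otimes>\<^bsub>V A\<^esub> t) p = K_frac B p (g (x \<otimes>\<^bsub>A\<^esub> a)) (g (y \<otimes>\<^bsub>A\<^esub> b))"
      by (rule V_map_frac) (use s t p q xy ab yb A.section_mult in \<open>simp_all add: A.V_simps A.K_mult\<close>)
    also have "\<dots> = K_frac B p (g x) (g y) \<otimes>\<^bsub>K B p\<^esub> K_frac B p (g a) (g b)"
      using B.K_mult[OF p homD(1)[OF xy(1)] not_in_preimage[OF xy(2)] homD(1)[OF ab(1)]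
          not_in_preimage[OF ab(2)]] xy ab by (simp add: homD(3))
    also have "\<dots> = (V_map A B g s \<otimes>\<^bsub>V B\<^esub> V_map A B g t) p"
      using V_map_frac[OF s[unfolded A.V_simps] p xy] V_map_frac[OF t[unfolded A.V_simps] p ab] p
      by (simp add: B.V_simps)
    finally show "V_map A B g (s \<otimes>\<^bsub>V A\<^esub> t) p = (V_map A B g s \<otimes>\<^bsub>V B\<^esub> V_map A B g t) p" .
  qed (use s t A.section_mult ex in \<open>simp_all add: A.V_simps B.V_simps\<close>)
  show "V_map A B g s \<in> V_map A B g t \<boxplus>\<^bsub>V B\<^esub> V_map A B g r"
    if r: "r \<in> carrier (V A)" and str: "s \<in> t \<boxplus>\<^bsub>V A\<^esub> r"
    unfolding B.V_add_iff
  proof (intro conjI ballI)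
    show "V_map A B g s \<in> constructible_sections B" using V_map_closed s by (simp add: A.V_simps)
    fix p assume p: "p \<in> multiring_spec B"
    note q = preimage_spec[OF p]
    show "V_map A B g s p \<in> V_map A B g t p \<boxplus>\<^bsub>K B p\<^esub> V_map A B g r p"
      using K_map_add[OF p A.sectionD(3)[OF _ q] A.sectionD(3)[OF _ q] A.sectionD(3)[OF _ q], of s t r]
        s t r str p q by (simp add: A.V_add_iff A.V_simps V_map_apply)
  qed
  show "V_map A B g (\<boxminus>\<^bsub>V A\<^esub> s) = \<boxminus>\<^bsub>V B\<^esub> V_map A B g s"
  proof (rule ext)
    fix p assume p: "p \<in> multiring_spec B"
    note q = preimage_spec[OF p]
    obtain x y where xy: "x \<in> carrier A" "y \<in> carrier A - preimage A g p"
      "s (preimage A g p) = K_frac A (preimage A g p) x y"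
      using section_frac[OF s[unfolded A.V_simps] q] .
    have "V_map A B g (\<boxminus>\<^bsub>V A\<^esub> s) p = K_frac B p (g (\<boxminus>\<^bsub>A\<^esub> x)) (g y)"
      by (rule V_map_frac)
        (use s p q xy A.section_neg A.neg_closed in \<open>simp_all add: A.V_simps A.K_neg\<close>)
    also have "\<dots> = \<boxminus>\<^bsub>K B p\<^esub> K_frac B p (g x) (g y)"
      using B.K_neg[OF p homD(1)[OF xy(1)] not_in_preimage[OF xy(2)]] xy by (simp add: homD(4))
    also have "\<dots> = (\<boxminus>\<^bsub>V B\<^esub> V_map A B g s) p"
      using V_map_frac[OF s[unfolded A.V_simps] p xy] p by (simp add: B.V_simps)
    finally show "V_map A B g (\<boxminus>\<^bsub>V A\<^esub> s) p = (\<boxminus>\<^bsub>V B\<^esub> V_map A B g s) p" .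
  qed (use s A.section_neg ex in \<open>simp_all add: A.V_simps B.V_simps\<close>)
next
  have const: "V_map A B g (\<lambda>q\<in>multiring_spec A. K_frac A q c \<one>\<^bsub>A\<^esub>) =
      (\<lambda>p\<in>multiring_spec B. K_frac B p (g c) \<one>\<^bsub>B\<^esub>)" if c: "c \<in> carrier A" for c
  proof (rule extensionalityI)
    show "V_map A B g (\<lambda>q\<in>multiring_spec A. K_frac A q c \<one>\<^bsub>A\<^esub>) \<in> extensional (multiring_spec B)"
      using B.sectionD(1)[OF V_map_closed[OF A.section_const[OF c]]] .
    fix p assume p: "p \<in> multiring_spec B"
    have "\<one>\<^bsub>A\<^esub> \<in> carrier A - preimage A g p" using A.specD(3)[OF preimage_spec[OF p]] by simp
    then show "V_map A B g (\<lambda>q\<in>multiring_spec A. K_frac A q c \<one>\<^bsub>A\<^esub>) p =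
        (\<lambda>p\<in>multiring_spec B. K_frac B p (g c) \<one>\<^bsub>B\<^esub>) p"
      using V_map_frac[OF A.section_const[OF c] p c, of "\<one>\<^bsub>A\<^esub>"] p preimage_spec[OF p]
      by (simp add: homD(6))
  qed simp
  show "V_map A B g \<zero>\<^bsub>V A\<^esub> = \<zero>\<^bsub>V B\<^esub>"
    using const[OF A.zero_closed] by (simp add: A.V_simps B.V_simps A.K_zero B.K_zero homD(5))
  show "V_map A B g \<one>\<^bsub>V A\<^esub> = \<one>\<^bsub>V B\<^esub>"
    using const[OF A.one_closed] by (simp add: A.V_simps B.V_simps A.K_one B.K_one homD(6))
qed

lemma compactin_preimages:
  "compactin (constructible_topology A) (preimage A g ` multiring_spec B)"
proof (rule image_compactin)
  show "compactin (constructible_topology B) (multiring_spec B)"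
    using B.compact_space_constructible by (simp add: compact_space_def)
  show "continuous_map (constructible_topology B) (constructible_topology A) (preimage A g)"
    unfolding constructible_topology_def[of A]
  proof (rule continuous_on_generated_topo)
    fix U
    assume "U \<in> basic_open A ` carrier A \<union> (\<lambda>a. multiring_spec A - basic_open A a) ` carrier A"
    then obtain a where a: "a \<in> carrier A" "U = basic_open A a \<or> U = multiring_spec A - basic_open A a"
      by blast
    have "preimage A g -` basic_open A a \<inter> multiring_spec B = basic_open B (g a)"
      "preimage A g -` (multiring_spec A - basic_open A a) \<inter> multiring_spec B =
        multiring_spec B - basic_open B (g a)"
      using a(1) preimage_spec by (auto simp: basic_open_def preimage_def)
    then show "openin (constructible_topology B) (preimage A g -` U \<inter> topspace (constructible_topology B))"
      using a(2) B.clopen_basic_open[OF homD(1)[OF a(1)]] by auto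
  next
    have "preimage A g p \<in> basic_open A \<one>\<^bsub>A\<^esub>" if "p \<in> multiring_spec B" for p
      using preimage_spec[OF that] A.specD(3) by (simp add: basic_open_def)
    then show "preimage A g ` topspace (constructible_topology B) \<subseteq>
      \<Union> (basic_open A ` carrier A \<union> (\<lambda>a. multiring_spec A - basic_open A a) ` carrier A)"
      using A.one_closed by auto
  qed
qed

end

section \<open>Signs on residue multirings\<close>

context multiring
begin

lemma sper_kernel:
  assumes "\<sigma> \<in> sper A"
  shows "{a \<in> carrier A. \<sigma> a = 0} \<in> multiring_spec A"
proof (rule specI)
  fix a b assume ab: "a \<in> {a \<in> carrier A. \<sigma> a = 0}" "b \<in> {a \<in> carrier A. \<sigma> a = 0}"
  show "a \<boxplus> b \<subseteq> {a \<in> carrier A. \<sigma> a = 0}"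
  proof
    fix c assume c: "c \<in> a \<boxplus> b"
    then show "c \<in> {a \<in> carrier A. \<sigma> a = 0}"
      using add_mem_carrier[OF c] sperD(6)[OF assms c] ab by auto
  qed
qed (use sperD[OF assms] zero_closed in auto)

lemma sper_frac_eq:
  assumes s: "\<sigma> \<in> sper A" and p: "p = {a \<in> carrier A. \<sigma> a = 0}"
    and c: "x \<in> carrier A" "y \<in> carrier A - p" "a \<in> carrier A" "b \<in> carrier A - p"
    and eq: "K_frac A p x y = K_frac A p a b"
  shows "\<sigma> x * \<sigma> b = \<sigma> a * \<sigma> y"
proof -
  have "p \<in> multiring_spec A" using sper_kernel[OF s] p by simp
  then obtain u i where u: "u \<in> carrier A - p" "i \<in> p" "x \<otimes> b \<otimes> u \<in> (a \<otimes> y \<otimes> u) \<boxplus> i"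
    using eq K_frac_eq_iff[OF _ c] unfolding frac_eq_def congruent_mod_def by blast
  have "\<sigma> (x \<otimes> b \<otimes> u) = \<sigma> (a \<otimes> y \<otimes> u)"
    using sperD(6)[OF s u(3)] c u(1,2) p by auto
  then have "\<sigma> x * \<sigma> b * \<sigma> u = \<sigma> a * \<sigma> y * \<sigma> u" using c u(1) s by (simp add: sperD(2))
  moreover have "\<sigma> u \<noteq> 0" using u(1) p by auto
  ultimately show ?thesis by simp
qed

text \<open>In a multiring whose nonzero elements have square \<open>1\<close> and in which \<open>1 + 1 = {1}\<close>, the
  preordering generated by \<open>-c\<close> is \<open>{0, 1} + {0, -c}\<close>. It avoids \<open>-1\<close> unless \<open>c = 1\<close>, so for
  \<open>c = x \<otimes> y\<close> with \<open>x \<noteq> y\<close> there is an ordering in which \<open>x\<close> and \<open>y\<close> do not have the same sign.\<close>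

lemma sper_separates:
  assumes sq: "\<And>x. \<lbrakk>x \<in> carrier A; x \<noteq> \<zero>\<rbrakk> \<Longrightarrow> x \<otimes> x = \<one>" and add: "\<And>x. x \<in> \<one> \<boxplus> \<one> \<Longrightarrow> x = \<one>"
    and nz: "\<one> \<noteq> \<zero>" and xy: "x \<in> carrier A" "y \<in> carrier A" "x \<noteq> y"
  shows "\<exists>\<sigma>\<in>sper A. \<sigma> x \<noteq> \<sigma> y"
proof -
  define c where "c = x \<otimes> y"
  have c: "c \<in> carrier A" using xy by (simp add: c_def)
  have c1: "c \<noteq> \<one>"
  proof
    assume 1: "c = \<one>"
    then have "y \<noteq> \<zero>" using nz mult_zero[OF xy(1)] by (auto simp: c_def)
    then have "x = x \<otimes> (y \<otimes> y)" using sq[OF xy(2)] xy by simp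
    also have "\<dots> = c \<otimes> y" using xy by (simp add: c_def m_assoc)
    finally show False using 1 xy by simp
  qed
  have T0: "preordering A {\<zero>, \<one>}"
  proof (rule preorderingI)
    show "z \<otimes> z \<in> {\<zero>, \<one>}" if "z \<in> carrier A" for z
      using sq[OF that] mult_zero[OF zero_closed] by (cases "z = \<zero>") auto
    show "w \<in> {\<zero>, \<one>}" if ab: "a \<in> {\<zero>, \<one>}" "b \<in> {\<zero>, \<one>}" "w \<in> a \<boxplus> b" for a b w
    proof -
      have "a \<in> carrier A" "b \<in> carrier A" using ab zero_closed by auto
      then have w: "w \<in> carrier A" using add_mem_carrier[OF ab(3)] by blast
      consider "a = \<zero>" | "b = \<zero>" | "a = \<one>" "b = \<one>" using ab by blast
      then show ?thesis
      proof cases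
        case 1 then show ?thesis using zero_add[OF w \<open>b \<in> carrier A\<close>] ab by auto
      next
        case 2 then show ?thesis using add_zero[OF w \<open>a \<in> carrier A\<close>] ab by auto
      next
        case 3 then show ?thesis using add[of w] ab by auto
      qed
    qed
  qed (use zero_closed mult_zero in auto)
  define a where "a = \<boxminus> c"
  have a: "a \<in> carrier A" using c neg_closed by (simp add: a_def)
  have aa: "w = a" if w: "w \<in> a \<boxplus> a" for w
  proof -
    have wc: "w \<in> carrier A" using add_mem_carrier[OF w a a] .
    show ?thesis
    proof (cases "a = \<zero>")
      case True then show ?thesis using w zero_add[OF wc, of a] a by auto
    next
      case False
      have "w \<otimes> a \<in> \<one> \<boxplus> \<one>" using mult_distrib[OF wc a a a w] sq[OF a False] by simp
      then have wa: "w \<otimes> a = \<one>" using add by simp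
      have "w = w \<otimes> (a \<otimes> a)" using sq[OF a False] wc by simp
      also have "\<dots> = (w \<otimes> a) \<otimes> a" using wc a by (simp add: m_assoc)
      finally show ?thesis using wa a by simp
    qed
  qed
  have cone: "multiple_sums A {\<zero>, \<one>} a \<subseteq> {\<zero>, a}"
  proof (rule multiple_sums_subset)
    show "s \<boxplus> t \<subseteq> {\<zero>, a}" if st: "s \<in> {\<zero>, a}" "t \<in> {\<zero>, a}" for s t
    proof
      fix w assume w: "w \<in> s \<boxplus> t"
      have "s \<in> carrier A" "t \<in> carrier A" using st a zero_closed by auto
      then have wc: "w \<in> carrier A" using add_mem_carrier[OF w] by blast
      consider "s = \<zero>" | "t = \<zero>" | "s = a" "t = a" using st by blast
      then show "w \<in> {\<zero>, a}"
      proof cases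
        case 1 then show ?thesis using zero_add[OF wc \<open>t \<in> carrier A\<close>] w st by auto
      next
        case 2 then show ?thesis using add_zero[OF wc \<open>s \<in> carrier A\<close>] w st by auto
      next
        case 3 then show ?thesis using aa w by auto
      qed
    qed
  qed (use a mult_zero in auto)
  note adj = preordering_adjoin[OF T0 a]
  have n1: "\<boxminus> \<one> \<noteq> \<one>"
    using zero_in_add_neg[OF one_closed] add[of \<zero>] nz by auto
  have "\<boxminus> \<one> \<notin> adjoin A {\<zero>, \<one>} a"
  proof
    assume "\<boxminus> \<one> \<in> adjoin A {\<zero>, \<one>} a"
    then obtain s u where su: "s \<in> {\<zero>, \<one>}" "u \<in> {\<zero>, a}" "\<boxminus> \<one> \<in> s \<boxplus> u"
      using cone unfolding adjoin_def by blast
    have neg1: "\<boxminus> \<one> \<in> carrier A" using neg_closed by simp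
    have "s \<in> carrier A" "u \<in> carrier A" using su a zero_closed by auto
    consider "s = \<zero>" | "s = \<one>" "u = \<zero>" | "s = \<one>" "u = a" using su by blast
    then show False
    proof cases
      case 1
      then have "u = \<boxminus> \<one>" using zero_add[OF neg1 \<open>u \<in> carrier A\<close>] su by simp
      then have "\<boxminus> u = \<one>" by simp
      then have "\<boxminus> u = \<one>" "u = \<zero> \<or> \<boxminus> u = c" using su(2) c by (auto simp: a_def)
      then show False using nz c1 by auto
    next
      case 2
      then show False using add_zero[OF neg1 one_closed] su n1 by simp
    next
      case 3
      then have "a \<in> (\<boxminus> \<one>) \<boxplus> (\<boxminus> \<one>)" using add_solve_right[OF su(3)] a by simp
      from neg_add[OF this] have "c \<in> \<one> \<boxplus> \<one>" using neg1 c by (simp add: a_def)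
      then show False using add c1 by blast
    qed
  qed
  then obtain \<sigma> where \<sigma>: "\<sigma> \<in> sper A" "\<forall>t\<in>adjoin A {\<zero>, \<one>} a. 0 \<le> \<sigma> t"
    using positivstellensatz[OF adj(1), of "{\<one>}"] preorderingD(4)[OF adj(1)] by auto
  have "\<sigma> x \<noteq> \<sigma> y"
  proof
    assume eq: "\<sigma> x = \<sigma> y"
    have "0 \<le> \<sigma> a" using \<sigma>(2) adj(3) by blast
    then have "\<sigma> x * \<sigma> x \<le> 0" using \<sigma>(1) xy c eq by (simp add: a_def c_def sperD)
    then have z: "\<sigma> x = 0" "\<sigma> y = 0" using eq by (auto simp: mult_le_0_iff)
    have "w = \<zero>" if "w \<in> carrier A" "\<sigma> w = 0" for w
      using sq[OF that(1)] sperD(2)[OF \<sigma>(1) that(1,1)] sperD(5)[OF \<sigma>(1)] that(2) by force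
    then show False using z xy by blast
  qed
  then show ?thesis using \<sigma>(1) by blast
qed

text \<open>Evaluation at \<open>\<sigma>\<close> is the point of the real spectrum of \<open>Q A\<close> that lies over \<open>\<sigma>\<close>.\<close>

lemma sper_Q_eval:
  assumes s: "\<sigma> \<in> sper A"
  shows "(\<lambda>F\<in>carrier (Q A). F \<sigma>) \<in> sper (Q A)"
proof -
  have hat: "hat A a \<sigma> = \<sigma> a" for a using s by (simp add: hat_def)
  have hom: "\<sigma> \<in> multiring_hom A three" using s by (simp add: sper_def)
  show ?thesis
    unfolding sper_def multiring_hom_def
  proof (intro CollectI conjI ballI impI)
    show "(\<lambda>F\<in>carrier (Q A). F \<sigma>) \<in> carrier (Q A) \<rightarrow>\<^sub>E carrier three"
      using multiring_homD(1)[OF hom] by (auto simp: hat simp del: three_simps)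
    show "(\<lambda>F\<in>carrier (Q A). F \<sigma>) \<zero>\<^bsub>Q A\<^esub> = \<zero>\<^bsub>three\<^esub>" "(\<lambda>F\<in>carrier (Q A). F \<sigma>) \<one>\<^bsub>Q A\<^esub> = \<one>\<^bsub>three\<^esub>"
      using sperD(4,5)[OF s] zero_closed by (simp_all add: hat)
    fix F G H assume c: "F \<in> carrier (Q A)" "G \<in> carrier (Q A)"
    show "(\<lambda>F\<in>carrier (Q A). F \<sigma>) (F \<otimes>\<^bsub>Q A\<^esub> G) =
        (\<lambda>F\<in>carrier (Q A). F \<sigma>) F \<otimes>\<^bsub>three\<^esub> (\<lambda>F\<in>carrier (Q A). F \<sigma>) G"
    proof -
      obtain a b where ab: "F = hat A a" "G = hat A b" "a \<in> carrier A" "b \<in> carrier A" using c by auto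
      have "hat A (a \<otimes> b) \<in> carrier (Q A)" using ab by simp
      then show ?thesis using c ab sperD(2)[OF s ab(3,4)] by (simp add: hat del: Q_simps)
    qed
    show "(\<lambda>F\<in>carrier (Q A). F \<sigma>) (\<boxminus>\<^bsub>Q A\<^esub> F) = \<boxminus>\<^bsub>three\<^esub> (\<lambda>F\<in>carrier (Q A). F \<sigma>) F"
    proof -
      obtain a where a: "F = hat A a" "a \<in> carrier A" using c by auto
      have "hat A (\<boxminus> a) \<in> carrier (Q A)" using a neg_closed by simp
      then show ?thesis using c a sperD(3)[OF s a(2)] by (simp add: hat del: Q_simps)
    qed
    assume H: "H \<in> carrier (Q A)" and F: "F \<in> G \<boxplus>\<^bsub>Q A\<^esub> H"
    obtain a b d where *: "a \<in> carrier A" "b \<in> carrier A" "d \<in> carrier A" "F = hat A a" "G = hat A b"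
      "H = hat A d" "a \<in> b \<boxplus> d"
      using F unfolding Q_add_iff by blast
    have "\<sigma> a \<in> \<sigma> b \<boxplus>\<^bsub>three\<^esub> \<sigma> d" using multiring_homD(2)[OF hom *(7,1-3)] .
    then show "(\<lambda>F\<in>carrier (Q A). F \<sigma>) F \<in>
        (\<lambda>F\<in>carrier (Q A). F \<sigma>) G \<boxplus>\<^bsub>three\<^esub> (\<lambda>F\<in>carrier (Q A). F \<sigma>) H"
      using * by (simp add: hat)
  qed
qed

lemma Q_cube: "F \<in> carrier (Q A) \<Longrightarrow> F \<otimes>\<^bsub>Q A\<^esub> F \<otimes>\<^bsub>Q A\<^esub> F = F"
proof -
  assume "F \<in> carrier (Q A)"
  then obtain a where a: "a \<in> carrier A" "F = hat A a" by auto
  have "\<sigma> (a \<otimes> a \<otimes> a) = \<sigma> a" if "\<sigma> \<in> sper A" for \<sigma>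
    using sperD(1)[OF that a(1)] a(1) that by (auto simp: sperD(2))
  then show ?thesis using a by (simp add: hat_eq_iff)
qed

lemma Q_add_self:
  assumes "F \<in> G \<boxplus>\<^bsub>Q A\<^esub> G"
  shows "F = G"
proof -
  obtain a b c where *: "a \<in> carrier A" "b \<in> carrier A" "c \<in> carrier A" "F = hat A a" "G = hat A b"
    "hat A b = hat A c" "a \<in> b \<boxplus> c"
    using assms unfolding Q_add_iff by auto
  have "\<sigma> a = \<sigma> b" if s: "\<sigma> \<in> sper A" for \<sigma>
    using sperD(6)[OF s *(7,1-3)] *(6) s by (auto simp: hat_eq_iff)
  then show ?thesis unfolding *(4,5) by (simp add: hat_eq_iff)
qed

text \<open>The residue multirings of \<open>Q A\<close> inherit \<open>a a a = a\<close> and \<open>a + a = {a}\<close>, so their elements are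
  separated by signs.\<close>

lemma sper_K_Q_separates:
  assumes p: "p \<in> multiring_spec (Q A)" and c: "F \<in> carrier (K (Q A) p)" "G \<in> carrier (K (Q A) p)"
    "F \<noteq> G"
  shows "\<exists>\<sigma>\<in>sper (K (Q A) p). \<sigma> F \<noteq> \<sigma> G"
proof -
  interpret QA: multiring "Q A" by (rule multiring_Q)
  interpret Kp: multiring "K (Q A) p" by (rule QA.multiring_K[OF p])
  note K_simps = QA.K_one QA.K_zero
  have one: "\<one>\<^bsub>Q A\<^esub> \<in> carrier (Q A) - p" using QA.specD(3)[OF p] QA.one_closed by blast
  show ?thesis
  proof (rule Kp.sper_separates[OF _ _ _ c])
    fix X assume X: "X \<in> carrier (K (Q A) p)" "X \<noteq> \<zero>\<^bsub>K (Q A) p\<^esub>"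
    obtain x y where xy: "x \<in> carrier (Q A)" "y \<in> carrier (Q A) - p" "X = K_frac (Q A) p x y"
      using QA.K_cases[OF p X(1)] .
    have x: "x \<in> carrier (Q A) - p" using X(2) QA.K_frac_zero_iff[OF p xy(1,2)] xy by (auto simp: K_simps)
    let ?m = "\<lambda>a b. a \<otimes>\<^bsub>Q A\<^esub> b"
    have yc: "y \<in> carrier (Q A)" using xy by blast
    have "X \<otimes>\<^bsub>K (Q A) p\<^esub> X = K_frac (Q A) p (?m x x) (?m y y)"
      using QA.K_mult[OF p xy(1,2) xy(1,2)] xy by simp
    also have "\<dots> = K_frac (Q A) p \<one>\<^bsub>Q A\<^esub> \<one>\<^bsub>Q A\<^esub>"
    proof (rule QA.K_frac_eqI[OF p])
      show "?m x y \<in> carrier (Q A) - p" "?m y y \<in> carrier (Q A) - p"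
        using QA.spec_mult_notin[OF p] x xy by blast+
      have "?m (?m x x) (?m x y) = ?m (?m (?m x x) x) y" "?m (?m y y) (?m x y) = ?m x (?m (?m y y) y)"
        using xy(1) yc by (simp_all only: QA.m_ac QA.m_closed)
      then have "?m (?m x x) (?m x y) = ?m (?m y y) (?m x y)"
        using Q_cube[OF xy(1)] Q_cube[OF yc] by simp
      then show "?m (?m (?m x x) \<one>\<^bsub>Q A\<^esub>) (?m x y) = ?m (?m \<one>\<^bsub>Q A\<^esub> (?m y y)) (?m x y)"
        using QA.r_one[OF QA.m_closed[OF xy(1) xy(1)]] QA.l_one[OF QA.m_closed[OF yc yc]] by simp
    qed (use xy one QA.m_closed in blast)+
    finally show "X \<otimes>\<^bsub>K (Q A) p\<^esub> X = \<one>\<^bsub>K (Q A) p\<^esub>" by (simp only: K_simps)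
  next
    fix X assume X: "X \<in> \<one>\<^bsub>K (Q A) p\<^esub> \<boxplus>\<^bsub>K (Q A) p\<^esub> \<one>\<^bsub>K (Q A) p\<^esub>"
    have oc: "\<one>\<^bsub>Q A\<^esub> \<in> carrier (Q A)" by (rule QA.one_closed)
    have Ko: "K_frac (Q A) p \<one>\<^bsub>Q A\<^esub> \<one>\<^bsub>Q A\<^esub> \<in> carrier (K (Q A) p)"
      using QA.K_frac_closed[OF p oc one] .
    obtain x w z where *: "x \<in> carrier (Q A)" "w \<in> carrier (Q A)" "z \<in> carrier (Q A) - p"
      "x \<in> (\<one>\<^bsub>Q A\<^esub> \<otimes>\<^bsub>Q A\<^esub> z) \<boxplus>\<^bsub>Q A\<^esub> w" "X = K_frac (Q A) p x (\<one>\<^bsub>Q A\<^esub> \<otimes>\<^bsub>Q A\<^esub> z)"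
      "K_frac (Q A) p \<one>\<^bsub>Q A\<^esub> \<one>\<^bsub>Q A\<^esub> = K_frac (Q A) p w (\<one>\<^bsub>Q A\<^esub> \<otimes>\<^bsub>Q A\<^esub> z)"
      using QA.K_add_rebase[OF p Ko oc one X[unfolded K_simps]] by blast
    have zc: "z \<in> carrier (Q A)" using *(3) by blast
    have oz: "\<one>\<^bsub>Q A\<^esub> \<otimes>\<^bsub>Q A\<^esub> z = z" using QA.l_one[OF zc] .
    note * = *[unfolded oz]
    have "frac_eq (Q A) p w z \<one>\<^bsub>Q A\<^esub> \<one>\<^bsub>Q A\<^esub>"
      using *(6) QA.K_frac_eq_iff[OF p *(2,3) oc one] by simp
    then obtain u i where u: "u \<in> carrier (Q A) - p" "i \<in> p"
      "w \<otimes>\<^bsub>Q A\<^esub> u \<in> (z \<otimes>\<^bsub>Q A\<^esub> u) \<boxplus>\<^bsub>Q A\<^esub> i"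
      unfolding frac_eq_def congruent_mod_def using QA.r_one[OF *(2)] QA.l_one[OF zc] by auto
    have uc: "u \<in> carrier (Q A)" and ic: "i \<in> carrier (Q A)" using u QA.specD(1)[OF p] by blast+
    have zu: "z \<otimes>\<^bsub>Q A\<^esub> u \<in> carrier (Q A)" using QA.m_closed[OF zc uc] .
    have xu: "x \<otimes>\<^bsub>Q A\<^esub> u \<in> (z \<otimes>\<^bsub>Q A\<^esub> u) \<boxplus>\<^bsub>Q A\<^esub> (w \<otimes>\<^bsub>Q A\<^esub> u)"
      using QA.mult_distrib[OF *(1) zc *(2) uc *(4)] .
    obtain h where h: "h \<in> (z \<otimes>\<^bsub>Q A\<^esub> u) \<boxplus>\<^bsub>Q A\<^esub> (z \<otimes>\<^bsub>Q A\<^esub> u)" "x \<otimes>\<^bsub>Q A\<^esub> u \<in> h \<boxplus>\<^bsub>Q A\<^esub> i"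
      using QA.add_assoc_rev[OF xu u(3) zu zu ic] by blast
    then have "x \<otimes>\<^bsub>Q A\<^esub> u \<in> (z \<otimes>\<^bsub>Q A\<^esub> u) \<boxplus>\<^bsub>Q A\<^esub> i" using Q_add_self[OF h(1)] by simp
    then have "frac_eq (Q A) p x z \<one>\<^bsub>Q A\<^esub> \<one>\<^bsub>Q A\<^esub>"
      unfolding frac_eq_def congruent_mod_def using u QA.r_one[OF *(1)] QA.l_one[OF zc] by auto
    then show "X = \<one>\<^bsub>K (Q A) p\<^esub>"
      using QA.K_frac_eq_iff[OF p *(1,3) oc one] *(5) by (simp only: K_simps)
  next
    show "\<one>\<^bsub>K (Q A) p\<^esub> \<noteq> \<zero>\<^bsub>K (Q A) p\<^esub>"
      unfolding K_simps using QA.K_frac_zero_iff[OF p QA.one_closed one] one by blast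
  qed
qed

end

section \<open>Values of sections\<close>

context multiring
begin

text \<open>For a single \<open>b\<close>, the section is the indicator of the zeros of \<open>b\<close>. It lies in \<open>1 - b b'\<close>,
  where \<open>b'\<close> is \<open>1/b\<close> off the zeros of \<open>b\<close> and zero on them, so \<open>\<tau>\<close> takes the value \<open>1\<close> on it if
  it vanishes at \<open>b\<close>. For several elements, these sections are multiplied.\<close>

lemma exists_supported_section:
  assumes \<tau>: "\<tau> \<in> sper (V A)"
    and B: "finite B" "B \<subseteq> carrier A" "\<And>b. b \<in> B \<Longrightarrow> \<tau> (V_unit A b) = 0"
  shows "\<exists>e\<in>constructible_sections A. \<tau> e = 1 \<and>
    (\<forall>q\<in>multiring_spec A. \<not> B \<subseteq> q \<longrightarrow> e q = \<zero>\<^bsub>K A q\<^esub>)"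
  using B
proof (induction B)
  case empty
  have "\<tau> \<one>\<^bsub>V A\<^esub> = 1" using sperD(5)[OF \<tau>] .
  moreover have "\<one>\<^bsub>V A\<^esub> \<in> constructible_sections A"
    using section_const[OF one_closed] by (simp add: V_simps K_one)
  ultimately show ?case by blast
next
  case (insert b B)
  obtain e where e: "e \<in> constructible_sections A" "\<tau> e = 1"
    "\<And>q. q \<in> multiring_spec A \<Longrightarrow> \<not> B \<subseteq> q \<Longrightarrow> e q = \<zero>\<^bsub>K A q\<^esub>"
    using insert by auto
  have b: "b \<in> carrier A" using insert by simp
  have one: "\<one> \<in> carrier A - q" if "q \<in> multiring_spec A" for q using specD(3)[OF that] by simp
  define d where "d = (\<lambda>q\<in>multiring_spec A. if q \<in> basic_open A b then \<zero>\<^bsub>K A q\<^esub> else \<one>\<^bsub>K A q\<^esub>)"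
  define i where "i = (\<lambda>q\<in>multiring_spec A. if q \<in> basic_open A b then K_frac A q \<one> b else \<zero>\<^bsub>K A q\<^esub>)"
  have d: "d \<in> constructible_sections A"
    unfolding d_def K_zero K_one
    by (rule section_patch[OF clopen_basic_open(1,2)[OF b]])
      (use one zero_closed in \<open>auto simp: basic_open_def intro!: fraction_nearI\<close>)
  have i: "i \<in> constructible_sections A"
    unfolding i_def K_zero
    by (rule section_patch[OF clopen_basic_open(1,2)[OF b]])
      (use one zero_closed b in \<open>auto simp: basic_open_def intro!: fraction_nearI\<close>)
  have v: "V_unit A b \<in> constructible_sections A"
    using section_const[OF b] b by (simp add: V_unit_def)
  define w where "w = V_unit A b \<otimes>\<^bsub>V A\<^esub> i"
  have w: "w \<in> constructible_sections A" using section_mult[OF v i] by (simp add: w_def V_simps)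
  have nw: "\<boxminus>\<^bsub>V A\<^esub> w \<in> constructible_sections A" using section_neg[OF w] by (simp add: V_simps)
  have one_V: "\<one>\<^bsub>V A\<^esub> \<in> constructible_sections A"
    using section_const[OF one_closed] by (simp add: V_simps K_one)
  have dw: "d \<in> \<one>\<^bsub>V A\<^esub> \<boxplus>\<^bsub>V A\<^esub> \<boxminus>\<^bsub>V A\<^esub> w"
    unfolding V_add_iff
  proof (intro conjI ballI)
    fix q assume q: "q \<in> multiring_spec A"
    interpret Kq: multiring "K A q" by (rule multiring_K[OF q])
    have K1: "K_frac A q x \<one> \<in> carrier (K A q)" if "x \<in> carrier A" for x
      using K_frac_closed[OF q that one[OF q]] .
    show "d q \<in> \<one>\<^bsub>V A\<^esub> q \<boxplus>\<^bsub>K A q\<^esub> (\<boxminus>\<^bsub>V A\<^esub> w) q"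
    proof (cases "b \<in> q")
      case True
      then have "q \<notin> basic_open A b" by (simp add: basic_open_def)
      then have "w q = \<zero>\<^bsub>K A q\<^esub>" "d q = \<one>\<^bsub>K A q\<^esub>"
        using q K1[OF b] Kq.mult_zero b by (simp_all add: w_def V_simps V_unit_def i_def d_def)
      then show ?thesis
        using q Kq.add_zero[OF Kq.one_closed Kq.one_closed] by (simp add: V_simps)
    next
      case False
      then have U: "q \<in> basic_open A b" using q by (simp add: basic_open_def)
      have "K_frac A q b \<one> \<otimes>\<^bsub>K A q\<^esub> K_frac A q \<one> b = K_frac A q (b \<otimes> \<one>) (\<one> \<otimes> b)"
        using K_mult[OF q b one[OF q] one_closed, of b] False b by simp
      also have "\<dots> = K_frac A q \<one> \<one>"
        by (rule K_frac_eqI[OF q, where u = \<one>]) (use b False one[OF q] in auto)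
      finally have "w q = \<one>\<^bsub>K A q\<^esub>" "d q = \<zero>\<^bsub>K A q\<^esub>"
        using q b U by (simp_all add: w_def V_simps V_unit_def i_def d_def K_one)
      then show ?thesis
        using q Kq.zero_in_add_neg[OF Kq.one_closed] by (simp add: V_simps)
    qed
  qed (rule d)
  have "\<tau> w = 0"
    using sperD(2)[OF \<tau>, of "V_unit A b" i] v i insert.prems by (simp add: w_def V_simps)
  then have "\<tau> (\<boxminus>\<^bsub>V A\<^esub> w) = 0" using sperD(3)[OF \<tau>, of w] w by (simp add: V_simps)
  then have \<tau>d: "\<tau> d = 1"
    using sperD(6)[OF \<tau> dw] sperD(5)[OF \<tau>] d one_V nw by (simp add: V_simps(1))
  define e' where "e' = e \<otimes>\<^bsub>V A\<^esub> d"
  have "e' \<in> constructible_sections A" using section_mult[OF e(1) d] by (simp add: e'_def V_simps)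
  moreover have "\<tau> e' = 1" using sperD(2)[OF \<tau>, of e d] e(1,2) d \<tau>d by (simp add: e'_def V_simps(1))
  moreover have "e' q = \<zero>\<^bsub>K A q\<^esub>" if q: "q \<in> multiring_spec A" "\<not> insert b B \<subseteq> q" for q
  proof -
    interpret Kq: multiring "K A q" by (rule multiring_K[OF q(1)])
    have c: "e q \<in> carrier (K A q)" "d q \<in> carrier (K A q)" using sectionD(3) e(1) d q(1) by blast+
    have eq: "e' q = e q \<otimes>\<^bsub>K A q\<^esub> d q" using q by (simp add: e'_def V_simps)
    show ?thesis
    proof (cases "B \<subseteq> q")
      case True
      then have "d q = \<zero>\<^bsub>K A q\<^esub>" using q by (simp add: d_def basic_open_def)
      then show ?thesis using eq Kq.mult_zero c by simp
    next
      case False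
      then show ?thesis using eq e(3)[OF q(1)] Kq.zero_mult c by simp
    qed
  qed
  ultimately show ?case by blast
qed

lemma V_unit_hom: "V_unit A \<in> multiring_hom A (V A)"
  unfolding multiring_hom_def
proof (intro CollectI conjI ballI impI)
  have one: "\<one> \<in> carrier A - q" if "q \<in> multiring_spec A" for q using specD(3)[OF that] by simp
  show "V_unit A \<in> carrier A \<rightarrow>\<^sub>E carrier (V A)"
    using section_const by (auto simp: V_unit_def V_simps)
  show "V_unit A \<zero> = \<zero>\<^bsub>V A\<^esub>" "V_unit A \<one> = \<one>\<^bsub>V A\<^esub>"
    using zero_closed by (simp_all add: V_unit_def V_simps K_zero K_one)
  fix a b c assume ab: "a \<in> carrier A" "b \<in> carrier A"
  show "V_unit A (a \<otimes> b) = V_unit A a \<otimes>\<^bsub>V A\<^esub> V_unit A b"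
    using ab one by (auto simp: V_unit_def V_simps K_mult intro!: restrict_ext)
  show "V_unit A (\<boxminus> a) = \<boxminus>\<^bsub>V A\<^esub> V_unit A a"
    using ab one neg_closed by (auto simp: V_unit_def V_simps K_neg intro!: restrict_ext)
  assume c: "c \<in> carrier A" "a \<in> b \<boxplus> c"
  show "V_unit A a \<in> V_unit A b \<boxplus>\<^bsub>V A\<^esub> V_unit A c"
    using ab c one section_const by (auto simp: V_unit_def V_add_iff intro!: K_addI)
qed

text \<open>Multiplied by a section that is supported near \<open>p\<close> and on which \<open>\<tau>\<close> does not vanish, \<open>s y\<close>
  and \<open>x\<close> become equal everywhere.\<close>

lemma sper_V_value:
  assumes \<tau>: "\<tau> \<in> sper (V A)" and s: "s \<in> constructible_sections A"
    and p: "p = {a \<in> carrier A. \<tau> (V_unit A a) = 0}" "p \<in> multiring_spec A"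
    and c: "x \<in> carrier A" "y \<in> carrier A - p" and sp: "s p = K_frac A p x y"
  shows "\<tau> s * \<tau> (V_unit A y) = \<tau> (V_unit A x)"
proof -
  interpret VA: multiring "V A" by (rule multiring_V)
  note v = multiring_homD(1)[OF V_unit_hom, unfolded V_simps]
  have one: "\<one> \<in> carrier A - q" if "q \<in> multiring_spec A" for q using specD(3)[OF that] by simp
  have "near A p (\<lambda>q. s q = K_frac A q x y \<and> y \<notin> q)"
    using fraction_near_eq[OF p(2) sectionD(2)[OF s p(2)] c sp] c
    by (intro near_conj[OF p(2)] near_notin) auto
  then obtain a B where a: "a \<in> carrier A" "finite B" "B \<subseteq> carrier A" "a \<notin> p" "B \<subseteq> p"
    "\<And>q. q \<in> multiring_spec A \<Longrightarrow> a \<notin> q \<Longrightarrow> B \<subseteq> q \<Longrightarrow> s q = K_frac A q x y \<and> y \<notin> q"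
    by (rule nearE) (rule that)
  have "\<tau> (V_unit A b) = 0" if "b \<in> B" for b using that a(5) p(1) by blast
  then obtain e where e: "e \<in> constructible_sections A" "\<tau> e = 1"
    "\<And>q. q \<in> multiring_spec A \<Longrightarrow> \<not> B \<subseteq> q \<Longrightarrow> e q = \<zero>\<^bsub>K A q\<^esub>"
    using exists_supported_section[OF \<tau> a(2,3)] by blast
  have y: "y \<in> carrier A" using c by simp
  have pt: "(e q \<otimes>\<^bsub>K A q\<^esub> K_frac A q a \<one>) \<otimes>\<^bsub>K A q\<^esub> (s q \<otimes>\<^bsub>K A q\<^esub> K_frac A q y \<one>) =
      (e q \<otimes>\<^bsub>K A q\<^esub> K_frac A q a \<one>) \<otimes>\<^bsub>K A q\<^esub> K_frac A q x \<one>"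
    if q: "q \<in> multiring_spec A" for q
  proof -
    interpret Kq: multiring "K A q" by (rule multiring_K[OF q])
    have K1: "K_frac A q z \<one> \<in> carrier (K A q)" if "z \<in> carrier A" for z
      using K_frac_closed[OF q that one[OF q]] .
    have cl: "e q \<in> carrier (K A q)" "s q \<in> carrier (K A q)" using sectionD(3) e(1) s q by blast+
    consider "a \<in> q" | "\<not> B \<subseteq> q" | "a \<notin> q" "B \<subseteq> q" by blast
    then show ?thesis
    proof cases
      case 1
      then have "K_frac A q a \<one> = \<zero>\<^bsub>K A q\<^esub>"
        using K_frac_zero_iff[OF q a(1) one[OF q]] by (simp add: K_zero)
      then show ?thesis using cl K1 c(1) y Kq.mult_zero by simp
    next
      case 2
      then show ?thesis using e(3)[OF q] cl K1 c(1) y a(1) Kq.mult_zero by simp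
    next
      case 3
      then have s': "s q = K_frac A q x y" "y \<notin> q" using a(6)[OF q] by auto
      have "s q \<otimes>\<^bsub>K A q\<^esub> K_frac A q y \<one> = K_frac A q (x \<otimes> y) (y \<otimes> \<one>)"
        using K_mult[OF q c(1) _ y one[OF q], of y] s' y by simp
      also have "\<dots> = K_frac A q (x \<otimes> y) (\<one> \<otimes> y)" using y by simp
      also have "\<dots> = K_frac A q x \<one>" using K_frac_expand[OF q c(1) one[OF q], of y] s' y by simp
      finally show ?thesis by simp
    qed
  qed
  define ea where "ea = e \<otimes>\<^bsub>V A\<^esub> V_unit A a"
  have ea: "ea \<in> carrier (V A)" using VA.m_closed e(1) v[OF a(1)] by (simp add: ea_def V_simps(1))
  have c': "s \<in> carrier (V A)" "V_unit A y \<in> carrier (V A)" "V_unit A x \<in> carrier (V A)"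
    "V_unit A a \<in> carrier (V A)" "e \<in> carrier (V A)"
    using s v y c a(1) e(1) by (simp_all add: V_simps(1))
  have "ea \<otimes>\<^bsub>V A\<^esub> (s \<otimes>\<^bsub>V A\<^esub> V_unit A y) = ea \<otimes>\<^bsub>V A\<^esub> V_unit A x"
    using pt a(1) y c(1) by (auto simp: ea_def V_simps V_unit_def intro!: restrict_ext)
  then have "\<tau> (ea \<otimes>\<^bsub>V A\<^esub> (s \<otimes>\<^bsub>V A\<^esub> V_unit A y)) = \<tau> (ea \<otimes>\<^bsub>V A\<^esub> V_unit A x)" by simp
  then have "\<tau> ea * (\<tau> s * \<tau> (V_unit A y)) = \<tau> ea * \<tau> (V_unit A x)"
    using ea c' by (simp add: sperD(2)[OF \<tau>] VA.m_closed)
  moreover have "\<tau> ea = \<tau> (V_unit A a)"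
    using sperD(2)[OF \<tau> c'(5,4)] e(2) by (simp add: ea_def)
  moreover have "\<tau> (V_unit A a) \<noteq> 0" using a(1,4) p(1) by blast
  ultimately show ?thesis by simp
qed

end

section \<open>Comparison of sections over \<open>A\<close> and over \<open>Q A\<close>\<close>

lemma multiring_hom_compose:
  assumes "f \<in> multiring_hom A B" "h \<in> multiring_hom B C"
    and A: "multiring A"
  shows "(\<lambda>a\<in>carrier A. h (f a)) \<in> multiring_hom A C"
proof -
  interpret A: multiring A by (rule A)
  note f = multiring_homD[OF assms(1)] and h = multiring_homD[OF assms(2)]
  show ?thesis
    unfolding multiring_hom_def
    by (intro CollectI conjI ballI impI)
      (use f h A.zero_closed A.neg_closed in \<open>auto simp: PiE_def\<close>)
qed

context multiring
begin

lemma Q_map_morphism: "multiring_morphism A (Q A) (Q_map A)"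
  by (intro multiring_morphism.intro multiring_axioms multiring_Q multiring_morphism_axioms.intro Q_map_hom)

abbreviation V_hat where "V_hat \<equiv> V_map A (Q A) (Q_map A)"

lemma Q_map_apply: "a \<in> carrier A \<Longrightarrow> Q_map A a = hat A a"
  by (simp add: Q_map_def)

lemma Q_cases:
  assumes "F \<in> carrier (Q A)"
  obtains a where "a \<in> carrier A" "F = Q_map A a"
  using assms by (auto simp: Q_map_def)

lemma sper_V_of_sper_K:
  assumes p: "p \<in> multiring_spec (Q A)" and \<rho>: "\<rho> \<in> sper (K (Q A) p)"
  shows "(\<lambda>s\<in>carrier (V A). \<rho> (V_hat s p)) \<in> sper (V A)"
proof -
  interpret QA: multiring "Q A" by (rule multiring_Q)
  interpret to_Q: multiring_morphism A "Q A" "Q_map A" by (rule Q_map_morphism)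
  have ev: "(\<lambda>s\<in>carrier (V (Q A)). s p) \<in> multiring_hom (V (Q A)) (K (Q A) p)"
    unfolding multiring_hom_def
  proof (intro CollectI conjI ballI impI)
    interpret VQ: multiring "V (Q A)" by (rule QA.multiring_V)
    show "(\<lambda>s\<in>carrier (V (Q A)). s p) \<in> carrier (V (Q A)) \<rightarrow>\<^sub>E carrier (K (Q A) p)"
      using QA.sectionD(3)[OF _ p] by (auto simp: QA.V_simps(1))
    show "(\<lambda>s\<in>carrier (V (Q A)). s p) \<zero>\<^bsub>V (Q A)\<^esub> = \<zero>\<^bsub>K (Q A) p\<^esub>"
      "(\<lambda>s\<in>carrier (V (Q A)). s p) \<one>\<^bsub>V (Q A)\<^esub> = \<one>\<^bsub>K (Q A) p\<^esub>"
      using VQ.zero_closed VQ.one_closed p by (simp_all add: QA.V_simps(3,5))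
    fix s t r assume s: "s \<in> carrier (V (Q A))" and t: "t \<in> carrier (V (Q A))"
    show "(\<lambda>s\<in>carrier (V (Q A)). s p) (s \<otimes>\<^bsub>V (Q A)\<^esub> t) =
        (\<lambda>s\<in>carrier (V (Q A)). s p) s \<otimes>\<^bsub>K (Q A) p\<^esub> (\<lambda>s\<in>carrier (V (Q A)). s p) t"
      using VQ.m_closed[OF s t] s t p by (simp add: QA.V_simps(2))
    show "(\<lambda>s\<in>carrier (V (Q A)). s p) (\<boxminus>\<^bsub>V (Q A)\<^esub> s) =
        \<boxminus>\<^bsub>K (Q A) p\<^esub> (\<lambda>s\<in>carrier (V (Q A)). s p) s"
      using VQ.neg_closed[OF s] s p by (simp add: QA.V_simps(4))
    assume "r \<in> carrier (V (Q A))" "s \<in> t \<boxplus>\<^bsub>V (Q A)\<^esub> r"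
    then show "(\<lambda>s\<in>carrier (V (Q A)). s p) s \<in>
        (\<lambda>s\<in>carrier (V (Q A)). s p) t \<boxplus>\<^bsub>K (Q A) p\<^esub> (\<lambda>s\<in>carrier (V (Q A)). s p) r"
      using s t p by (simp add: QA.V_add_iff)
  qed
  have "(\<lambda>s\<in>carrier (V A). \<rho> ((\<lambda>s\<in>carrier (V A). (\<lambda>s\<in>carrier (V (Q A)). s p) (V_hat s)) s))
      \<in> multiring_hom (V A) three"
    using multiring_hom_compose[OF multiring_hom_compose[OF to_Q.V_map_hom ev multiring_V] _ multiring_V]
      \<rho> by (simp add: sper_def)
  moreover have "V_hat s \<in> carrier (V (Q A))" if "s \<in> carrier (V A)" for s
    using multiring_homD(1)[OF to_Q.V_map_hom that] .
  ultimately show ?thesis unfolding sper_def by (simp cong: restrict_cong)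
qed

text \<open>If \<open>V_hat s\<close> and \<open>V_hat t\<close> differ at \<open>p\<close>, a point of the real spectrum of \<open>K (Q A) p\<close> that
  separates their values separates \<open>s\<close> and \<open>t\<close> by composition. Conversely, \<open>\<tau>\<close> evaluates \<open>s\<close> and
  \<open>t\<close> at the prime of \<open>A\<close> below it, which comes from the prime \<open>P\<close> of \<open>Q A\<close>, so equality of
  \<open>V_hat s\<close> and \<open>V_hat t\<close> at \<open>P\<close> determines these values.\<close>

lemma hat_V_eq_iff:
  assumes s: "s \<in> constructible_sections A" and t: "t \<in> constructible_sections A"
  shows "hat (V A) s = hat (V A) t \<longleftrightarrow> V_hat s = V_hat t"
proof
  interpret QA: multiring "Q A" by (rule multiring_Q)
  interpret to_Q: multiring_morphism A "Q A" "Q_map A" by (rule Q_map_morphism)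
  assume eq: "hat (V A) s = hat (V A) t"
  note c = to_Q.V_map_closed[OF s] to_Q.V_map_closed[OF t]
  show "V_hat s = V_hat t"
  proof (rule extensionalityI[OF QA.sectionD(1)[OF c(1)] QA.sectionD(1)[OF c(2)]], rule ccontr)
    fix p assume p: "p \<in> multiring_spec (Q A)" and ne: "V_hat s p \<noteq> V_hat t p"
    obtain \<rho> where \<rho>: "\<rho> \<in> sper (K (Q A) p)" "\<rho> (V_hat s p) \<noteq> \<rho> (V_hat t p)"
      using sper_K_Q_separates[OF p QA.sectionD(3)[OF c(1) p] QA.sectionD(3)[OF c(2) p] ne] by blast
    show False
      using eq sper_V_of_sper_K[OF p \<rho>(1)] \<rho>(2) s t by (auto simp: hat_eq_iff V_simps(1))
  qed
next
  interpret QA: multiring "Q A" by (rule multiring_Q)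
  interpret to_Q: multiring_morphism A "Q A" "Q_map A" by (rule Q_map_morphism)
  assume eq: "V_hat s = V_hat t"
  have "\<tau> s = \<tau> t" if \<tau>: "\<tau> \<in> sper (V A)" for \<tau>
  proof -
    define \<sigma> where "\<sigma> = (\<lambda>a\<in>carrier A. \<tau> (V_unit A a))"
    have \<sigma>: "\<sigma> \<in> sper A"
      unfolding \<sigma>_def sper_def
      by (rule multiring_hom_compose[OF V_unit_hom \<tau>[unfolded sper_def] multiring_axioms])
    have \<sigma>a: "\<tau> (V_unit A a) = \<sigma> a" if "a \<in> carrier A" for a using that by (simp add: \<sigma>_def)
    define \<rho> where "\<rho> = (\<lambda>F\<in>carrier (Q A). F \<sigma>)"
    have \<rho>: "\<rho> \<in> sper (Q A)" unfolding \<rho>_def by (rule sper_Q_eval[OF \<sigma>])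
    have \<rho>a: "\<rho> (Q_map A a) = \<sigma> a" if "a \<in> carrier A" for a
      using that \<sigma> by (simp add: \<rho>_def Q_map_def) (simp add: hat_def)
    define P where "P = {F \<in> carrier (Q A). \<rho> F = 0}"
    have P: "P \<in> multiring_spec (Q A)" unfolding P_def by (rule QA.sper_kernel[OF \<rho>])
    define p where "p = preimage A (Q_map A) P"
    have p: "p \<in> multiring_spec A" unfolding p_def by (rule to_Q.preimage_spec[OF P])
    have pa: "p = {a \<in> carrier A. \<tau> (V_unit A a) = 0}"
    proof -
      have "Q_map A a \<in> P \<longleftrightarrow> \<tau> (V_unit A a) = 0" if a: "a \<in> carrier A" for a
        using to_Q.homD(1)[OF a] \<rho>a[OF a] \<sigma>a[OF a] by (simp add: P_def del: Q_simps)
      then show ?thesis by (auto simp: p_def preimage_def)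
    qed
    obtain x y where xy: "x \<in> carrier A" "y \<in> carrier A - p" "s p = K_frac A p x y"
      using K_cases[OF p sectionD(3)[OF s p]] .
    obtain a b where ab: "a \<in> carrier A" "b \<in> carrier A - p" "t p = K_frac A p a b"
      using K_cases[OF p sectionD(3)[OF t p]] .
    have b': "b \<in> carrier A" "y \<in> carrier A" using ab xy by auto
    have "K_frac (Q A) P (Q_map A x) (Q_map A y) = K_frac (Q A) P (Q_map A a) (Q_map A b)"
      using to_Q.V_map_frac[OF s P xy[unfolded p_def]] to_Q.V_map_frac[OF t P ab[unfolded p_def]] eq
      by simp
    then have "\<rho> (Q_map A x) * \<rho> (Q_map A b) = \<rho> (Q_map A a) * \<rho> (Q_map A y)"
      by (rule QA.sper_frac_eq[OF \<rho> P_def to_Q.homD(1)[OF xy(1)]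
            to_Q.not_in_preimage[OF xy(2)[unfolded p_def]] to_Q.homD(1)[OF ab(1)]
            to_Q.not_in_preimage[OF ab(2)[unfolded p_def]]])
    then have "\<sigma> x * \<sigma> b = \<sigma> a * \<sigma> y" using xy(1) ab(1) b' by (simp add: \<rho>a)
    moreover have "\<tau> s * \<sigma> y = \<sigma> x" "\<tau> t * \<sigma> b = \<sigma> a"
      using sper_V_value[OF \<tau> s pa p xy] sper_V_value[OF \<tau> t pa p ab] xy(1) ab(1) b' by (simp_all add: \<sigma>a)
    ultimately have "\<tau> s * (\<sigma> y * \<sigma> b) = \<tau> t * (\<sigma> y * \<sigma> b)" by (metis mult.assoc mult.commute)
    moreover have "\<sigma> y * \<sigma> b \<noteq> 0" using xy(2) ab(2) pa \<sigma>a b' by auto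
    ultimately show ?thesis by simp
  qed
  then show "hat (V A) s = hat (V A) t" by (simp add: hat_eq_iff)
qed

text \<open>Every basic clopen set of primes of \<open>Q A\<close> comes from one of primes of \<open>A\<close>.\<close>

lemma near_lift:
  assumes "near (Q A) p P"
  shows "near A (preimage A (Q_map A) p)
    (\<lambda>q. \<forall>p'\<in>multiring_spec (Q A). preimage A (Q_map A) p' = q \<longrightarrow> P p')"
proof -
  obtain a C where a: "a \<in> carrier (Q A)" "finite C" "C \<subseteq> carrier (Q A)" "a \<notin> p" "C \<subseteq> p"
    "\<And>q. q \<in> multiring_spec (Q A) \<Longrightarrow> a \<notin> q \<Longrightarrow> C \<subseteq> q \<Longrightarrow> P q"
    using assms by (rule nearE) (rule that)
  obtain b where b: "b \<in> carrier A" "a = Q_map A b" using Q_cases[OF a(1)] .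
  have "C \<subseteq> Q_map A ` carrier A" using a(3) by (auto simp: Q_map_def)
  then obtain D where D: "D \<subseteq> carrier A" "finite D" "C = Q_map A ` D"
    using finite_subset_image[OF a(2), of "Q_map A" "carrier A"] by metis
  have "b \<notin> preimage A (Q_map A) p" "D \<subseteq> preimage A (Q_map A) p"
    using a(4,5) b D by (auto simp: preimage_def)
  moreover have "P p'" if "p' \<in> multiring_spec (Q A)" "preimage A (Q_map A) p' = q" "b \<notin> q" "D \<subseteq> q" for p' q
    by (rule a(6)[OF that(1)]) (use that b D in \<open>auto simp: preimage_def\<close>)
  ultimately show ?thesis
    unfolding near_def using b(1) D(1,2) by (intro bexI[of _ b] exI[of _ D]) simp_all
qed

text \<open>Locally, a sum of sections over \<open>Q A\<close> is the image of a sum in \<open>A\<close> over a common denominator.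
  The primes of \<open>A\<close> that come from \<open>Q A\<close> form a compact set, so the local lifts glue.\<close>

lemma V_hat_lifts_sums:
  assumes F: "F \<in> carrier (V (Q A))" and G: "G \<in> carrier (V (Q A))" and H: "H \<in> carrier (V (Q A))"
    and FGH: "F \<in> G \<boxplus>\<^bsub>V (Q A)\<^esub> H"
  shows "\<exists>f\<in>carrier (V A). \<exists>g\<in>carrier (V A). \<exists>h\<in>carrier (V A).
    V_hat f = F \<and> V_hat g = G \<and> V_hat h = H \<and> f \<in> g \<boxplus>\<^bsub>V A\<^esub> h"
proof -
  interpret QA: multiring "Q A" by (rule multiring_Q)
  interpret to_Q: multiring_morphism A "Q A" "Q_map A" by (rule Q_map_morphism)
  \<comment> \<open>The three sections are lifted simultaneously, as one family indexed by \<open>nat\<close>.\<close>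
  define Z where "Z i = (if i = 0 then F else if i = 1 then G else H)" for i :: nat
  have Z: "Z i \<in> constructible_sections (Q A)" for i using F G H by (simp add: Z_def QA.V_simps(1))
  define R where "R = preimage A (Q_map A) ` multiring_spec (Q A)"
  define P where "P q k \<longleftrightarrow> k 0 \<in> k 1 \<boxplus>\<^bsub>K A q\<^esub> k 2 \<and>
    (\<forall>p'\<in>multiring_spec (Q A). preimage A (Q_map A) p' = q \<longrightarrow>
       (\<forall>i. K_map (Q A) (Q_map A) p' (k i) = Z i p'))" for q and k :: "nat \<Rightarrow> ('a set \<times> 'a set) set"
  have "\<exists>k. (\<forall>i. k i \<in> constructible_sections A) \<and> (\<forall>q\<in>multiring_spec A. P q (\<lambda>i. k i q))"
  proof (rule exists_sections)
    show "compactin (constructible_topology A) R"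
      unfolding R_def by (rule to_Q.compactin_preimages)
  next
    fix q assume q: "q \<in> multiring_spec A - R"
    interpret Kq: multiring "K A q" using multiring_K q by blast
    show "P q (\<lambda>_. K_frac A q \<zero> \<one>)"
      using q Kq.add_zero[OF Kq.zero_closed Kq.zero_closed] by (auto simp: P_def R_def K_zero)
  next
    fix p assume "p \<in> R"
    then obtain p' where p': "p' \<in> multiring_spec (Q A)" "p = preimage A (Q_map A) p'"
      by (auto simp: R_def)
    have p: "p \<in> multiring_spec A" using to_Q.preimage_spec p' by simp
    have FGH': "F p' \<in> G p' \<boxplus>\<^bsub>K (Q A) p'\<^esub> H p'" using FGH p' by (simp add: QA.V_add_iff)
    obtain X Y W D where 1: "X \<in> carrier (Q A)" "Y \<in> carrier (Q A)" "W \<in> carrier (Q A)"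
      "D \<in> carrier (Q A) - p'" "F p' = K_frac (Q A) p' X D" "G p' = K_frac (Q A) p' Y D"
      "H p' = K_frac (Q A) p' W D" "X \<in> Y \<boxplus>\<^bsub>Q A\<^esub> W"
    proof -
      note c = QA.sectionD(3)[OF F[unfolded QA.V_simps(1)] p'(1)]
        QA.sectionD(3)[OF G[unfolded QA.V_simps(1)] p'(1)] QA.sectionD(3)[OF H[unfolded QA.V_simps(1)] p'(1)]
      from FGH' obtain X Y W D where "X \<in> carrier (Q A)" "Y \<in> carrier (Q A)" "W \<in> carrier (Q A)"
        "D \<in> carrier (Q A) - p'" "F p' = K_frac (Q A) p' X D \<and> G p' = K_frac (Q A) p' Y D \<and>
        H p' = K_frac (Q A) p' W D \<and> X \<in> Y \<boxplus>\<^bsub>Q A\<^esub> W"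
        unfolding QA.K_add_iff[OF p'(1) c] by (elim bexE)
      then show thesis by - (elim conjE, rule that)
    qed
    obtain a b c where 2: "a \<in> carrier A" "b \<in> carrier A" "c \<in> carrier A" "X = hat A a" "Y = hat A b"
      "W = hat A c" "a \<in> b \<boxplus> c"
      using 1(8) unfolding Q_add_iff by blast
    have "D \<in> carrier (Q A)" using 1(4) by blast
    then obtain d where d: "d \<in> carrier A" "D = Q_map A d" by (rule Q_cases)
    have dp: "d \<in> carrier A - p" using 1(4) d p'(2) by (simp add: preimage_def)
    define x where "x i = (if i = 0 then a else if i = 1 then b else c)" for i :: nat
    have x: "x i \<in> carrier A" for i using 2 by (simp add: x_def)
    have "near (Q A) p' (\<lambda>q'. Z i q' = K_frac (Q A) q' (Q_map A (x i)) D)" for i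
      using 1 2 by (intro QA.fraction_near_eq[OF p'(1) QA.sectionD(2)[OF Z p'(1)]])
        (auto simp: Z_def x_def Q_map_apply)
    then have "near (Q A) p' (\<lambda>q'. Z 0 q' = K_frac (Q A) q' (Q_map A (x 0)) D \<and>
        Z 1 q' = K_frac (Q A) q' (Q_map A (x 1)) D \<and> Z 2 q' = K_frac (Q A) q' (Q_map A (x 2)) D)"
      by (intro QA.near_conj[OF p'(1)])
    then have "near (Q A) p' (\<lambda>q'. \<forall>i. Z i q' = K_frac (Q A) q' (Q_map A (x i)) D)"
      by (rule QA.near_mono) (auto simp: Z_def x_def)
    from near_lift[OF this]
    have "near A p (\<lambda>q. (\<forall>p''\<in>multiring_spec (Q A). preimage A (Q_map A) p'' = q \<longrightarrow>
        (\<forall>i. Z i p'' = K_frac (Q A) p'' (Q_map A (x i)) D)) \<and> d \<notin> q)"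
      using dp unfolding p'(2)[symmetric] by (intro near_conj[OF p] near_notin) auto
    then have "near A p (\<lambda>q. P q (\<lambda>i. K_frac A q (x i) d))"
    proof (rule near_mono)
      fix q assume q: "q \<in> multiring_spec A"
        and n: "(\<forall>p''\<in>multiring_spec (Q A). preimage A (Q_map A) p'' = q \<longrightarrow>
          (\<forall>i. Z i p'' = K_frac (Q A) p'' (Q_map A (x i)) D)) \<and> d \<notin> q"
      have dq: "d \<in> carrier A - q" using n d by simp
      have "K_frac A q (x 0) d \<in> K_frac A q (x 1) d \<boxplus>\<^bsub>K A q\<^esub> K_frac A q (x 2) d"
        using K_addI[OF q 2(7,2,3) dq] by (simp add: x_def)
      moreover have "K_map (Q A) (Q_map A) p'' (K_frac A q (x i) d) = Z i p''"
        if "p'' \<in> multiring_spec (Q A)" "preimage A (Q_map A) p'' = q" for p'' i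
        using to_Q.K_map_frac[OF that(1) x, of d i] that dq n d(2) by simp
      ultimately show "P q (\<lambda>i. K_frac A q (x i) d)" by (simp add: P_def)
    qed
    then show "\<exists>x y. (\<forall>i. x i \<in> carrier A) \<and> y \<in> carrier A - p \<and>
        near A p (\<lambda>q. P q (\<lambda>i. K_frac A q (x i) y))"
      using x dp by (intro exI[of _ x] exI[of _ d]) simp
  qed
  then obtain k where k: "\<And>i. k i \<in> constructible_sections A"
    "\<And>q. q \<in> multiring_spec A \<Longrightarrow> P q (\<lambda>i. k i q)" by blast
  have "V_hat (k i) = Z i" for i
  proof (rule extensionalityI[OF QA.sectionD(1)[OF to_Q.V_map_closed[OF k(1)]] QA.sectionD(1)[OF Z]])
    fix p' assume p': "p' \<in> multiring_spec (Q A)"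
    show "V_hat (k i) p' = Z i p'"
      using k(2)[OF to_Q.preimage_spec[OF p']] p' by (simp add: P_def to_Q.V_map_apply[OF k(1)])
  qed
  from this[of 0] this[of 1] this[of 2] have "V_hat (k 0) = F" "V_hat (k 1) = G" "V_hat (k 2) = H"
    by (simp_all add: Z_def)
  moreover have "k 0 \<in> k 1 \<boxplus>\<^bsub>V A\<^esub> k 2" using k by (simp add: V_add_iff P_def)
  ultimately show ?thesis using k(1) by (metis V_simps(1))
qed

end

section \<open>The induced isomorphism\<close>

text \<open>A morphism whose fibres are those of \<open>W \<rightarrow> Q W\<close>, and along which sums lift, induces an
  isomorphism on \<open>Q W\<close>.\<close>

lemma Q_universal_iso:
  assumes W: "multiring W" and C: "multiring C" and v: "v \<in> multiring_hom W C"
    and fib: "\<And>s t. \<lbrakk>s \<in> carrier W; t \<in> carrier W\<rbrakk> \<Longrightarrow> hat W s = hat W t \<longleftrightarrow> v s = v t"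
    and lift: "\<And>F G H. \<lbrakk>F \<in> carrier C; G \<in> carrier C; H \<in> carrier C; F \<in> G \<boxplus>\<^bsub>C\<^esub> H\<rbrakk> \<Longrightarrow>
      \<exists>f\<in>carrier W. \<exists>g\<in>carrier W. \<exists>h\<in>carrier W. v f = F \<and> v g = G \<and> v h = H \<and> f \<in> g \<boxplus>\<^bsub>W\<^esub> h"
  shows "(\<exists>!f. f \<in> multiring_hom (Q W) C \<and> compose (carrier W) f (Q_map W) = v) \<and>
    (\<forall>f. f \<in> multiring_hom (Q W) C \<and> compose (carrier W) f (Q_map W) = v \<longrightarrow> f \<in> multiring_iso (Q W) C)"
proof -
  interpret W: multiring W by (rule W)
  interpret C: multiring C by (rule C)
  note v' = multiring_homD[OF v]
  have comp: "compose (carrier W) f (Q_map W) = v \<longleftrightarrow> (\<forall>s\<in>carrier W. f (hat W s) = v s)" for f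
  proof -
    have "compose (carrier W) f (Q_map W) = v \<longleftrightarrow> (\<forall>s\<in>carrier W. compose (carrier W) f (Q_map W) s = v s)"
      using extensionalityI[OF compose_extensional v'(7), of f "Q_map W"] by auto
    then show ?thesis by (simp add: compose_def Q_map_def)
  qed
  define f0 where "f0 = (\<lambda>\<Phi>\<in>carrier (Q W). v (SOME s. s \<in> carrier W \<and> hat W s = \<Phi>))"
  have f0: "f0 (hat W s) = v s" if s: "s \<in> carrier W" for s
  proof -
    let ?t = "SOME t. t \<in> carrier W \<and> hat W t = hat W s"
    have "?t \<in> carrier W \<and> hat W ?t = hat W s" by (rule someI[of _ s]) (use s in simp)
    then show ?thesis using fib[of ?t s] s by (simp add: f0_def)
  qed
  have f0_hom: "f0 \<in> multiring_hom (Q W) C"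
    unfolding multiring_hom_def
  proof (intro CollectI conjI ballI impI)
    have "f0 \<Phi> \<in> carrier C" if "\<Phi> \<in> carrier (Q W)" for \<Phi> using that f0 v'(1) by auto
    moreover have "f0 \<in> extensional (carrier (Q W))" by (simp only: f0_def restrict_extensional)
    ultimately show "f0 \<in> carrier (Q W) \<rightarrow>\<^sub>E carrier C" by (simp add: PiE_def Pi_def)
    show "f0 \<zero>\<^bsub>Q W\<^esub> = \<zero>\<^bsub>C\<^esub>" "f0 \<one>\<^bsub>Q W\<^esub> = \<one>\<^bsub>C\<^esub>"
      using f0[OF W.zero_closed] f0[OF W.one_closed] v'(5,6) by simp_all
    fix \<Phi> \<Gamma> \<Theta> assume c: "\<Phi> \<in> carrier (Q W)" "\<Gamma> \<in> carrier (Q W)"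
    show "f0 (\<Phi> \<otimes>\<^bsub>Q W\<^esub> \<Gamma>) = f0 \<Phi> \<otimes>\<^bsub>C\<^esub> f0 \<Gamma>" "f0 (\<boxminus>\<^bsub>Q W\<^esub> \<Phi>) = \<boxminus>\<^bsub>C\<^esub> f0 \<Phi>"
      using c f0 v'(3,4) W.neg_closed by auto
    assume "\<Phi> \<in> \<Gamma> \<boxplus>\<^bsub>Q W\<^esub> \<Theta>"
    then show "f0 \<Phi> \<in> f0 \<Gamma> \<boxplus>\<^bsub>C\<^esub> f0 \<Theta>" unfolding Q_add_iff using f0 v'(2) by auto
  qed
  have uniq: "f = f0" if f: "f \<in> multiring_hom (Q W) C" "\<forall>s\<in>carrier W. f (hat W s) = v s" for f
    by (rule extensionalityI[OF multiring_homD(7)[OF f(1)] multiring_homD(7)[OF f0_hom]])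
      (use f(2) f0 in auto)
  have surj: "\<exists>s\<in>carrier W. v s = F" if "F \<in> carrier C" for F
  proof -
    have "F \<in> F \<boxplus>\<^bsub>C\<^esub> \<zero>\<^bsub>C\<^esub>" using C.add_zero that by blast
    then show ?thesis using lift[OF that that C.zero_closed] by blast
  qed
  define k where "k = (\<lambda>F\<in>carrier C. hat W (SOME s. s \<in> carrier W \<and> v s = F))"
  have k: "k (v s) = hat W s" if s: "s \<in> carrier W" for s
  proof -
    let ?t = "SOME t. t \<in> carrier W \<and> v t = v s"
    have "?t \<in> carrier W \<and> v ?t = v s" by (rule someI[of _ s]) (use s in simp)
    then show ?thesis using fib[of ?t s] s v'(1) by (simp add: k_def)
  qed
  have "k \<in> multiring_hom C (Q W)"
    unfolding multiring_hom_def
  proof (intro CollectI conjI ballI impI)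
    have "k F \<in> carrier (Q W)" if "F \<in> carrier C" for F
      using surj[OF that] k by auto
    then show "k \<in> carrier C \<rightarrow>\<^sub>E carrier (Q W)" by (auto simp: PiE_def k_def)
    show "k \<zero>\<^bsub>C\<^esub> = \<zero>\<^bsub>Q W\<^esub>" "k \<one>\<^bsub>C\<^esub> = \<one>\<^bsub>Q W\<^esub>"
      using k[OF W.zero_closed] k[OF W.one_closed] v'(5,6) by simp_all
    fix F G H assume c: "F \<in> carrier C" "G \<in> carrier C"
    obtain s t where st: "s \<in> carrier W" "t \<in> carrier W" "F = v s" "G = v t"
      using surj[OF c(1)] surj[OF c(2)] by blast
    show "k (F \<otimes>\<^bsub>C\<^esub> G) = k F \<otimes>\<^bsub>Q W\<^esub> k G"
      using k[of "s \<otimes>\<^bsub>W\<^esub> t"] k st v'(3)[OF st(1,2)] by simp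
    show "k (\<boxminus>\<^bsub>C\<^esub> F) = \<boxminus>\<^bsub>Q W\<^esub> k F"
      using k[of "\<boxminus>\<^bsub>W\<^esub> s"] k st v'(4)[OF st(1)] W.neg_closed by simp
    assume H: "H \<in> carrier C" "F \<in> G \<boxplus>\<^bsub>C\<^esub> H"
    obtain f g h where *: "f \<in> carrier W" "g \<in> carrier W" "h \<in> carrier W" "v f = F" "v g = G" "v h = H"
      "f \<in> g \<boxplus>\<^bsub>W\<^esub> h"
      using lift[OF c H] by blast
    have "hat W f \<in> hat W g \<boxplus>\<^bsub>Q W\<^esub> hat W h" unfolding Q_add_iff using * by blast
    then show "k F \<in> k G \<boxplus>\<^bsub>Q W\<^esub> k H" using k * by metis
  qed
  moreover have "\<forall>\<Phi>\<in>carrier (Q W). k (f0 \<Phi>) = \<Phi>" using f0 k by auto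
  moreover have "\<forall>F\<in>carrier C. f0 (k F) = F"
  proof
    fix F assume "F \<in> carrier C"
    then obtain s where "s \<in> carrier W" "F = v s" using surj by blast
    then show "f0 (k F) = F" using f0 k by simp
  qed
  ultimately have "f0 \<in> multiring_iso (Q W) C" unfolding multiring_iso_def using f0_hom by blast
  then show ?thesis unfolding comp using f0_hom f0 uniq by blast
qed

text \<open>A point of the real spectrum of \<open>V A\<close> is obtained from one of \<open>A\<close> through the residue multiring
  of \<open>Q A\<close> at the kernel of the latter.\<close>

lemma (in semireal_multiring) semireal_V: "semireal_multiring (V A)"
proof -
  interpret QA: multiring "Q A" by (rule multiring_Q)
  interpret VA: multiring "V A" by (rule multiring_V)
  obtain \<sigma> where \<sigma>: "\<sigma> \<in> sper A"
    using positivstellensatz[OF preordering_sums_of_squares, of "{\<one>}"]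
      preorderingD(4)[OF preordering_sums_of_squares] semireal by auto
  define P where "P = {F \<in> carrier (Q A). (\<lambda>F\<in>carrier (Q A). F \<sigma>) F = 0}"
  have P: "P \<in> multiring_spec (Q A)" unfolding P_def by (rule QA.sper_kernel[OF sper_Q_eval[OF \<sigma>]])
  interpret KP: multiring "K (Q A) P" by (rule QA.multiring_K[OF P])
  have "\<one>\<^bsub>Q A\<^esub> \<in> carrier (Q A) - P" using QA.specD(3)[OF P] QA.one_closed by blast
  then have "\<one>\<^bsub>K (Q A) P\<^esub> \<noteq> \<zero>\<^bsub>K (Q A) P\<^esub>"
    unfolding QA.K_one QA.K_zero using QA.K_frac_zero_iff[OF P QA.one_closed] by blast
  then obtain \<rho> where "\<rho> \<in> sper (K (Q A) P)"
    using sper_K_Q_separates[OF P KP.one_closed KP.zero_closed] by blast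
  then obtain \<tau> where \<tau>: "\<tau> \<in> sper (V A)" using sper_V_of_sper_K[OF P] by blast
  have "\<boxminus>\<^bsub>V A\<^esub> \<one>\<^bsub>V A\<^esub> \<notin> sums_of_squares (V A)"
    using VA.sper_sum_of_squares_nonneg[OF \<tau>, of "\<boxminus>\<^bsub>V A\<^esub> \<one>\<^bsub>V A\<^esub>"] sperD(3)[OF \<tau> VA.one_closed]
      sperD(5)[OF \<tau>] by auto
  then show ?thesis
    by (intro semireal_multiring.intro multiring_V semireal_multiring_axioms.intro)
qed

theorem theorem4p12:
  fixes A :: "'a multiring"
  assumes "semireal_multiring A"
  shows "semireal_multiring (V A) \<and>
    (\<exists>!f. f \<in> multiring_hom (Q (V A)) (V (Q A)) \<and>
       compose (carrier (V A)) f (Q_map (V A)) = V_map A (Q A) (Q_map A)) \<and>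
    (\<forall>f. f \<in> multiring_hom (Q (V A)) (V (Q A)) \<and>
       compose (carrier (V A)) f (Q_map (V A)) = V_map A (Q A) (Q_map A)
       \<longrightarrow> f \<in> multiring_iso (Q (V A)) (V (Q A)))"
proof -
  interpret semireal_multiring A by (rule assms)
  interpret to_Q: multiring_morphism A "Q A" "Q_map A" by (rule Q_map_morphism)
  have "(\<exists>!f. f \<in> multiring_hom (Q (V A)) (V (Q A)) \<and>
       compose (carrier (V A)) f (Q_map (V A)) = V_map A (Q A) (Q_map A)) \<and>
    (\<forall>f. f \<in> multiring_hom (Q (V A)) (V (Q A)) \<and>
       compose (carrier (V A)) f (Q_map (V A)) = V_map A (Q A) (Q_map A)
       \<longrightarrow> f \<in> multiring_iso (Q (V A)) (V (Q A)))"
    by (rule Q_universal_iso[OF multiring_V multiring.multiring_V[OF multiring_Q] to_Q.V_map_hom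
          _ V_hat_lifts_sums]) (simp_all add: hat_V_eq_iff V_simps(1))
  then show ?thesis using semireal_V by blast
qed

end
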